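(* Let $w\in S_n$. If $w$ is multiplicity-free, then the Schubert polynomial $\mathfrak{S}_w$ is zero-one (all its coefficients are $0$ or $1$).
   Context: Schubert polynomials: $\mathfrak{S}_{w_0}=x_1^{n-1}\cdots x_{n-1}$ for $w_0=n\cdots 1$, and $\mathfrak{S}_w=\partial_i\mathfrak{S}_{ws_i}$ when $w_i<w_{i+1}$, with $\partial_if=(f-s_if)/(x_i-x_{i+1})$. The Rothe diagram is $D(w)=\{(i,j)\in[n]^2: i<w^{-1}(j),\ j<w_i\}$ ($i$ = row, $j$ = column); a diagram is regarded as the sequence of its columns $C_1,\dots,C_n\subseteq[n]$. Write $[j]=\{1,\dots,j\}$. A missing tooth of a column $C$ is an integer $i\ge1$ with $i\notin C$, $i+1\in C$. Orthodontia: replace every column of $D(w)$ equal to some $[j]$ by an empty column, obtaining $E_0$. For $r\ge1$, while $E_{r-1}$ has a nonempty column, let $i_r$ be the smallest missing tooth of the leftmost nonempty column of $E_{r-1}$, swap rows $i_r$ and $i_r+1$ of $E_{r-1}$ to get $O_r$, and let $E_r$ be $O_r$ with all columns equal to $[i_r]$ replaced by empty columns (column indices are kept throughout, as in $D(w)$). The process stops at some $l$, giving $\bm{i}=(i_1,\dots,i_l)$. The orthodontic impact function $\mathcal{I}_w:[l]\to 2^{[n]}$ is $\mathcal{I}_w(j)=\{c\in[n]: (i_j+1,c)\in E_{j-1}\}$. The permutation $w$ is multiplicity-free if for all $r\ne s$ in $[l]$ with $i_r=i_s$ there is $c\in[n]$ with $\mathcal{I}_w(r)=\mathcal{I}_w(s)=\{c\}$.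 *)

theory Defs
  imports "HOL-Combinatorics.Combinatorics"
begin

text \<open>A polynomial is represented by its coefficient function: it maps an exponent
vector b (b j = exponent of variable x_j, j >= 1) to the coefficient of that monomial.\<close>

type_synonym mono = "nat \<Rightarrow> nat"
type_synonym ipoly = "mono \<Rightarrow> int"

definition swap_vars :: "nat \<Rightarrow> ipoly \<Rightarrow> ipoly" where
  "swap_vars i f = (\<lambda>b. f (b \<circ> Transposition.transpose i (Suc i)))"

text \<open>Multiplication by (x_i - x_(i+1)).\<close>
definition mult_diff :: "nat \<Rightarrow> ipoly \<Rightarrow> ipoly" where
  "mult_diff i g = (\<lambda>b.
     (if 1 \<le> b i then g (b(i := b i - 1)) else 0)
   - (if 1 \<le> b (Suc i) then g (b(Suc i := b (Suc i) - 1)) else 0))"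

definition ddiff :: "nat \<Rightarrow> ipoly \<Rightarrow> ipoly" where
  "ddiff i f = (THE g. mult_diff i g = (\<lambda>b. f b - swap_vars i f b))"

definition w0 :: "nat \<Rightarrow> nat \<Rightarrow> nat" where
  "w0 n = (\<lambda>j. if 1 \<le> j \<and> j \<le> n then Suc n - j else j)"

definition top_mono :: "nat \<Rightarrow> ipoly" where
  "top_mono n = (\<lambda>b. if b = (\<lambda>j. if 1 \<le> j \<and> j \<le> n then n - j else 0) then 1 else 0)"

inductive is_schubert :: "nat \<Rightarrow> (nat \<Rightarrow> nat) \<Rightarrow> ipoly \<Rightarrow> bool" for n where
  top: "is_schubert n (w0 n) (top_mono n)"
| step: "\<lbrakk>1 \<le> i; Suc i \<le> n; w i < w (Suc i);
          is_schubert n (w \<circ> Transposition.transpose i (Suc i)) f\<rbrakk>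
         \<Longrightarrow> is_schubert n w (ddiff i f)"

definition schubert :: "nat \<Rightarrow> (nat \<Rightarrow> nat) \<Rightarrow> ipoly" where
  "schubert n w = (THE f. is_schubert n w f)"

type_synonym diagram = "(nat \<times> nat) set"

definition col :: "diagram \<Rightarrow> nat \<Rightarrow> nat set" where
  "col E c = {r. (r, c) \<in> E}"

definition rothe :: "nat \<Rightarrow> (nat \<Rightarrow> nat) \<Rightarrow> diagram" where
  "rothe n w = {(i, j). i \<in> {1..n} \<and> j \<in> {1..n} \<and> i < inv w j \<and> j < w i}"

definition ortho_E0 :: "nat \<Rightarrow> (nat \<Rightarrow> nat) \<Rightarrow> diagram" where
  "ortho_E0 n w = {(r, c) \<in> rothe n w. \<not> (\<exists>j. col (rothe n w) c = {1..j})}"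

definition lead_col :: "diagram \<Rightarrow> nat" where
  "lead_col E = Min {c. col E c \<noteq> {}}"

definition tooth :: "diagram \<Rightarrow> nat" where
  "tooth E = (LEAST i. 1 \<le> i \<and> i \<notin> col E (lead_col E) \<and> Suc i \<in> col E (lead_col E))"

definition swap_rows :: "nat \<Rightarrow> diagram \<Rightarrow> diagram" where
  "swap_rows i E = (\<lambda>(r, c). (Transposition.transpose i (Suc i) r, c)) ` E"

definition ortho_step :: "diagram \<Rightarrow> diagram" where
  "ortho_step E = (let i = tooth E; D = swap_rows i E
                   in {(r, c) \<in> D. col D c \<noteq> {1..i}})"

definition ortho_E :: "nat \<Rightarrow> (nat \<Rightarrow> nat) \<Rightarrow> nat \<Rightarrow> diagram" where
  "ortho_E n w r = (ortho_step ^^ r) (ortho_E0 n w)"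

text \<open>i_r (for r >= 1).\<close>
definition ortho_i :: "nat \<Rightarrow> (nat \<Rightarrow> nat) \<Rightarrow> nat \<Rightarrow> nat" where
  "ortho_i n w r = tooth (ortho_E n w (r - 1))"

definition impact :: "nat \<Rightarrow> (nat \<Rightarrow> nat) \<Rightarrow> nat \<Rightarrow> nat set" where
  "impact n w j = {c \<in> {1..n}. (Suc (ortho_i n w j), c) \<in> ortho_E n w (j - 1)}"

definition multiplicity_free :: "nat \<Rightarrow> (nat \<Rightarrow> nat) \<Rightarrow> bool" where
  "multiplicity_free n w \<longleftrightarrow> (\<exists>l. ortho_E n w l = {} \<and> (\<forall>r<l. ortho_E n w r \<noteq> {}) \<and>
     (\<forall>r\<in>{1..l}. \<forall>s\<in>{1..l}. r \<noteq> s \<and> ortho_i n w r = ortho_i n w s \<longrightarrow>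
        (\<exists>c\<in>{1..n}. impact n w r = {c} \<and> impact n w s = {c})))"

end

theory Submission
  imports Defs "HOL-Library.Function_Algebras"
begin

text \<open>
  The Fomin--Kirillov product of nilCoxeter factors $1 + x u_j$ is nonnegative and satisfies all
  divided difference recursions, so its coefficients are the Schubert polynomials; in particular
  these are nonnegative.

  Magyar's orthodontia formula writes $\mathfrak{S}_w$ as a monomial times
  $\pi_{i_1}(\omega_{i_1}^{m_1} \pi_{i_2}(\cdots))$ with $\pi_i f = \partial_i(x_i f)$. It is proved
  by induction: let $c$ be the leftmost column of $D(w)$ that is not an interval $[j]$ and $q$ the
  first ascent of $w$ with $w_q < c$. Passing to $w s_q$ either performs the next orthodontia step
  or only lengthens an interval column, in which case the remaining factor is symmetric in
  $x_q, x_{q+1}$.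

  Applying $\pi_i$ changes only the partial sum $b_1 + \cdots + b_i$ of an exponent vector $b$.
  Hence if the tooth $i$ does not occur later in the process, every $i$-string carries at most
  one monomial and the coefficients stay in $\{-1, 0, 1\}$. If $w$ is multiplicity-free, a
  repeated tooth forces the leading column to be alone in all the rows it passes through; that
  column then splits off as a factor $\sum_{V \le C} x^V$ in variables in which the
  remaining factor has constant exponents. So all coefficients lie in $\{-1, 0, 1\}$, and by
  nonnegativity in $\{0, 1\}$.
\<close>

section \<open>Operators on coefficient functions\<close>

text \<open>Coefficient functions carry no finiteness condition, and \<open>ddiff\<close> is a
  definite description. Every divided difference is therefore certified by multiplying back with x_i
  - x_(i+1), never obtained by division. Two models of the same polynomial are needed because
  \<pi>_i produces signs: a monomial with b_i + 1 < b_(i+1) goes to minus a sum of monomials. The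
  nilCoxeter product settles the sign of the coefficients, orthodontia only their size. An induction
  along the process must know enough about each intermediate diagram. The invariant is that every
  E_r is again the E_0 of some permutation; this forces whole rows of it to be empty. The obstacle
  is a tooth that recurs within the leading column: an i-string may then carry several monomials.
  Such a column is not treated step by step; its whole run of swaps is taken at once.\<close>

definition var_exp :: "nat \<Rightarrow> mono" where
  "var_exp i = (\<lambda>_. 0)(i := 1)"

text \<open>Multiplication by the monomial x^a. The guard is needed because \<open>b - a\<close>
  truncates at 0, so that exponents not divisible by x^a would otherwise receive
  coefficients.\<close>

definition shift :: "mono \<Rightarrow> ipoly \<Rightarrow> ipoly" where
  "shift a f = (\<lambda>b. if a \<le> b then f (b - a) else 0)"

lemma shift_add: "shift a (f + g) = shift a f + shift a g"
  by (auto simp: shift_def fun_eq_iff)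

lemma shift_diff: "shift a (f - g) = shift a f - shift a g"
  by (auto simp: shift_def fun_eq_iff)

lemma shift_zero [simp]: "shift a 0 = 0"
  by (auto simp: shift_def fun_eq_iff)

lemma shift_uminus: "shift a (- f) = - shift a f"
  by (auto simp: shift_def fun_eq_iff)

lemma shift_sum: "finite I \<Longrightarrow> shift a (\<Sum>i\<in>I. f i) = (\<Sum>i\<in>I. shift a (f i))"
  by (induction I rule: finite_induct) (simp_all only: sum.empty sum.insert shift_zero shift_add not_False_eq_True)

lemma shift_shift: "shift a (shift c f) = shift (a + c) f"
proof
  fix b
  have "(a \<le> b \<and> c \<le> b - a) \<longleftrightarrow> a + c \<le> b"
  proof -
    have "(a x \<le> b x \<and> c x \<le> b x - a x) \<longleftrightarrow> a x + c x \<le> b x" for x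
      by auto
    then show ?thesis
      unfolding le_fun_def fun_diff_def plus_fun_apply by blast
  qed
  moreover have "b - a - c = b - (a + c)"
    by (simp add: fun_eq_iff)
  ultimately show "shift a (shift c f) b = shift (a + c) f b"
    by (auto simp: shift_def)
qed

lemma shift_commute: "shift a (shift c f) = shift c (shift a f)"
  by (simp add: shift_shift add.commute)

lemma shift_0_exp [simp]: "shift 0 f = f"
  by (auto simp: shift_def fun_eq_iff le_fun_def fun_diff_def)

lemma shift_var_exp: "shift (var_exp i) f b = (if 1 \<le> b i then f (b(i := b i - 1)) else 0)"
proof -
  have "var_exp i \<le> b \<longleftrightarrow> 1 \<le> b i"
    by (auto simp: var_exp_def le_fun_def)
  moreover have "b - var_exp i = b(i := b i - 1)"
    by (auto simp: var_exp_def fun_eq_iff)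
  ultimately show ?thesis by (simp add: shift_def)
qed

lemma mult_diff_eq: "mult_diff i g = shift (var_exp i) g - shift (var_exp (Suc i)) g"
  by (simp add: mult_diff_def fun_eq_iff shift_var_exp)

text \<open>Comparing coefficients at b + e_i gives f(b) = f(b + e_i - e_j) if b_j > 0, and f(b) = 0
  if b_j = 0. Each use lowers b_j, so the descent ends for functions of infinite support as
  well.\<close>

lemma shift_var_exp_diff_inj:
  assumes "i \<noteq> j" and eq: "shift (var_exp i) f = shift (var_exp j) f"
  shows "f = 0"
proof -
  have "f b = 0" if "b j = m" for b m
    using that
  proof (induction m arbitrary: b)
    case 0
    have "f b = shift (var_exp i) f (b(i := Suc (b i)))"
      by (simp add: shift_var_exp)
    also have "\<dots> = 0"
      unfolding eq using 0 assms(1) by (simp add: shift_var_exp)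
    finally show ?case .
  next
    case (Suc m)
    have "f b = shift (var_exp i) f (b(i := Suc (b i)))"
      by (simp add: shift_var_exp)
    also have "\<dots> = f (b(i := Suc (b i), j := m))"
      unfolding eq using Suc.prems assms(1) by (simp add: shift_var_exp)
    also have "\<dots> = 0"
      using Suc.IH by simp
    finally show ?case .
  qed
  then show ?thesis by (simp add: fun_eq_iff)
qed

lemma shift_var_exp_diff_cancel:
  assumes "i \<noteq> j"
    and "shift (var_exp i) f - shift (var_exp j) f = shift (var_exp i) g - shift (var_exp j) g"
  shows "f = g"
proof -
  have "shift (var_exp i) (f - g) = shift (var_exp j) (f - g)"
    using assms(2) unfolding shift_diff by (metis diff_eq_eq diff_diff_eq2 diff_add_eq add.commute)
  then have "f - g = 0"
    by (rule shift_var_exp_diff_inj[OF assms(1)])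
  then show ?thesis by simp
qed

lemma mult_diff_inj: "mult_diff i f = mult_diff i g \<Longrightarrow> f = g"
  unfolding mult_diff_eq by (rule shift_var_exp_diff_cancel[of i "Suc i"]) simp_all

text \<open>Injectivity of \<open>mult_diff\<close> is the uniqueness that \<open>THE\<close>
  requires, so exhibiting a quotient identifies the divided difference.\<close>

lemma ddiff_eqI:
  assumes "mult_diff i g = f - swap_vars i f"
  shows "ddiff i f = g"
proof -
  have eq: "mult_diff i g = (\<lambda>b. f b - swap_vars i f b)"
    using assms by (simp add: fun_eq_iff)
  then have "g' = g" if "mult_diff i g' = (\<lambda>b. f b - swap_vars i f b)" for g'
    using mult_diff_inj that by metis
  with eq show ?thesis
    unfolding ddiff_def by (rule the_equality)
qed

lemma mult_diff_shift: "mult_diff i (shift a f) = shift a (mult_diff i f)"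
  by (simp add: mult_diff_eq shift_diff shift_commute)

lemma swap_vars_shift:
  "swap_vars i (shift a f) = shift (a \<circ> Transposition.transpose i (Suc i)) (swap_vars i f)"
proof
  fix b
  let ?t = "Transposition.transpose i (Suc i)"
  have "a \<le> b \<circ> ?t \<longleftrightarrow> a \<circ> ?t \<le> b"
    unfolding le_fun_def comp_def by (metis transpose_involutory)
  moreover have "(b \<circ> ?t) - a = (b - (a \<circ> ?t)) \<circ> ?t"
    by (simp add: fun_eq_iff)
  ultimately show "swap_vars i (shift a f) b = shift (a \<circ> ?t) (swap_vars i f) b"
    by (simp add: swap_vars_def shift_def)
qed

lemma var_exp_transpose:
  "var_exp k \<circ> Transposition.transpose i j = var_exp (Transposition.transpose i j k)"
  by (auto simp: var_exp_def fun_eq_iff Transposition.transpose_def)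

lemma swap_vars_diff: "swap_vars i (f - g) = swap_vars i f - swap_vars i g"
  by (simp add: swap_vars_def fun_eq_iff)

lemma swap_vars_add: "swap_vars i (f + g) = swap_vars i f + swap_vars i g"
  by (simp add: swap_vars_def fun_eq_iff)

lemma swap_vars_zero [simp]: "swap_vars i 0 = 0"
  by (simp add: swap_vars_def fun_eq_iff)

lemma swap_vars_sum:
  "finite I \<Longrightarrow> swap_vars i (\<Sum>j\<in>I. f j) = (\<Sum>j\<in>I. swap_vars i (f j))"
  by (induction I rule: finite_induct) (simp_all only: sum.empty sum.insert swap_vars_zero swap_vars_add not_False_eq_True)

lemma swap_vars_swap_vars [simp]: "swap_vars i (swap_vars i f) = f"
  by (simp add: swap_vars_def fun_eq_iff comp_assoc)

lemma swap_vars_braid: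
  "swap_vars i (swap_vars (Suc i) (swap_vars i f)) =
   swap_vars (Suc i) (swap_vars i (swap_vars (Suc i) f))"
proof -
  have "Transposition.transpose i (Suc i) \<circ> Transposition.transpose (Suc i) (Suc (Suc i)) \<circ> Transposition.transpose i (Suc i)
      = Transposition.transpose (Suc i) (Suc (Suc i)) \<circ> Transposition.transpose i (Suc i) \<circ> Transposition.transpose (Suc i) (Suc (Suc i))"
    by (auto simp: fun_eq_iff Transposition.transpose_def)
  then show ?thesis
    by (simp add: swap_vars_def comp_assoc)
qed

lemma swap_vars_commute:
  assumes "Suc i < j \<or> Suc j < i"
  shows "swap_vars i (swap_vars j f) = swap_vars j (swap_vars i f)"
proof -
  have "Transposition.transpose i (Suc i) \<circ> Transposition.transpose j (Suc j)
      = Transposition.transpose j (Suc j) \<circ> Transposition.transpose i (Suc i)"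
    using assms by (auto simp: fun_eq_iff Transposition.transpose_def)
  then show ?thesis
    by (simp add: swap_vars_def comp_assoc)
qed

section \<open>Isobaric divided differences\<close>

definition const_one :: ipoly where
  "const_one = (\<lambda>b. if b = 0 then 1 else 0)"

lemma shift_const_one: "shift a const_one = (\<lambda>b. if b = a then 1 else 0)"
  by (auto simp: shift_def const_one_def fun_eq_iff le_fun_def) (metis le_antisym)

lemma swap_vars_const_one: "swap_vars i const_one = const_one"
proof -
  have "b \<circ> Transposition.transpose i (Suc i) = 0 \<longleftrightarrow> b = 0" for b :: mono
  proof
    assume "b \<circ> Transposition.transpose i (Suc i) = 0"
    then have "b \<circ> Transposition.transpose i (Suc i) \<circ> Transposition.transpose i (Suc i) = 0 \<circ> Transposition.transpose i (Suc i)"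
      by simp
    then show "b = 0"
      by (simp add: comp_assoc fun_eq_iff)
  qed (simp add: fun_eq_iff)
  then show ?thesis
    by (simp add: swap_vars_def const_one_def fun_eq_iff)
qed

text \<open>The Demazure operator \<pi>_i in closed form. With N = s + t, the monomial x_i^a
  x_(i+1)^(N-a) contributes to the coefficient of x_i^s x_(i+1)^t the number +1 if a \<ge> max s t,
  -1 if a < min s t, and 0 otherwise; the overlap of the two sums has this effect.\<close>

definition isobaric :: "nat \<Rightarrow> ipoly \<Rightarrow> ipoly" where
  "isobaric i f = (\<lambda>b. let N = b i + b (Suc i); c = \<lambda>a. f (b(i := a, Suc i := N - a))
     in (\<Sum>a\<in>{b i..N}. c a) - (\<Sum>a<b (Suc i). c a))"

text \<open>Both terms of \<open>mult_diff\<close> read the same string of total exponent s + t - 1.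
  Lowering s adds the term a = s - 1 to the first sum, lowering t removes the term a = t - 1 from
  the second, and all else cancels. The cases s = 0 and t = 0 are separate since one half of
  \<open>mult_diff\<close> is then absent.\<close>

lemma isobaric_mult_diff:
  "mult_diff i (isobaric i f) = shift (var_exp i) f - swap_vars i (shift (var_exp i) f)"
proof
  fix b :: mono
  define s where "s = b i"
  define t where "t = b (Suc i)"
  define c where "c N a = f (b(i := a, Suc i := N - a))" for N a :: nat
  have swp: "swap_vars i (shift (var_exp i) f) b = (if 1 \<le> t then c (s + t - 1) (t - 1) else 0)"
  proof -
    have "(b \<circ> Transposition.transpose i (Suc i))(i := t - 1) = b(i := t - 1, Suc i := s + t - 1 - (t - 1))" if "1 \<le> t"
      using that by (auto simp: fun_eq_iff Transposition.transpose_def s_def t_def)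
    then show ?thesis
      by (auto simp: swap_vars_def shift_var_exp c_def t_def)
  qed
  have shf: "shift (var_exp i) f b = (if 1 \<le> s then c (s + t - 1) (s - 1) else 0)"
  proof -
    have "b(i := s - 1) = b(i := s - 1, Suc i := s + t - 1 - (s - 1))" if "1 \<le> s"
      using that by (auto simp: fun_eq_iff s_def t_def)
    then show ?thesis
      by (auto simp: shift_var_exp c_def s_def)
  qed
  have l1: "isobaric i f (b(i := s - 1)) = (\<Sum>a\<in>{s - 1..s + t - 1}. c (s + t - 1) a) - (\<Sum>a<t. c (s + t - 1) a)"
    if "1 \<le> s"
    using that by (simp add: isobaric_def Let_def c_def t_def fun_upd_twist)
  have l2: "isobaric i f (b(Suc i := t - 1)) = (\<Sum>a\<in>{s..s + t - 1}. c (s + t - 1) a) - (\<Sum>a<t - 1. c (s + t - 1) a)"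
    if "1 \<le> t"
    using that by (simp add: isobaric_def Let_def c_def s_def fun_upd_twist)
  have e1: "(\<Sum>a\<in>{s - 1..s + t - 1}. c N a) = c N (s - 1) + (\<Sum>a\<in>{s..s + t - 1}. c N a)" if "1 \<le> s" for N
    using that by (simp add: sum.atLeast_Suc_atMost)
  have e2: "(\<Sum>a<t. c N a) = (\<Sum>a<t - 1. c N a) + c N (t - 1)" if "1 \<le> t" for N
    using that by (metis Suc_diff_1 less_eq_Suc_le One_nat_def sum.lessThan_Suc)
  have L: "mult_diff i (isobaric i f) b = (if 1 \<le> s then isobaric i f (b(i := s - 1)) else 0)
      - (if 1 \<le> t then isobaric i f (b(Suc i := t - 1)) else 0)"
    by (simp add: mult_diff_def s_def t_def)
  consider "s = 0" "t = 0" | "s = 0" "1 \<le> t" | "1 \<le> s" "t = 0" | "1 \<le> s" "1 \<le> t"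
    by linarith
  then show "mult_diff i (isobaric i f) b = (shift (var_exp i) f - swap_vars i (shift (var_exp i) f)) b"
    unfolding L fun_diff_def swp shf
  proof cases
    case 2
    have "{0..t - 1} = {..<t}"
      using 2 by auto
    then show "(if 1 \<le> s then isobaric i f (b(i := s - 1)) else 0) - (if 1 \<le> t then isobaric i f (b(Suc i := t - 1)) else 0)
      = (if 1 \<le> s then c (s + t - 1) (s - 1) else 0) - (if 1 \<le> t then c (s + t - 1) (t - 1) else 0)"
      using 2 e2[of "t - 1"] l2 by simp
  next
    case 3
    then show "(if 1 \<le> s then isobaric i f (b(i := s - 1)) else 0) - (if 1 \<le> t then isobaric i f (b(Suc i := t - 1)) else 0)
      = (if 1 \<le> s then c (s + t - 1) (s - 1) else 0) - (if 1 \<le> t then c (s + t - 1) (t - 1) else 0)"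
      using l1 by simp
  next
    case 4
    then show "(if 1 \<le> s then isobaric i f (b(i := s - 1)) else 0) - (if 1 \<le> t then isobaric i f (b(Suc i := t - 1)) else 0)
      = (if 1 \<le> s then c (s + t - 1) (s - 1) else 0) - (if 1 \<le> t then c (s + t - 1) (t - 1) else 0)"
      using l1 l2 e1[of "s + t - 1"] e2[of "s + t - 1"] by simp
  qed simp
qed

lemma isobaric_eqI:
  "mult_diff i g = shift (var_exp i) f - swap_vars i (shift (var_exp i) f) \<Longrightarrow> isobaric i f = g"
  by (rule mult_diff_inj[of i]) (simp add: isobaric_mult_diff)

lemma swap_vars_shift_var_exp:
  "swap_vars i (shift (var_exp i) f) = shift (var_exp (Suc i)) (swap_vars i f)"
  by (simp add: swap_vars_shift var_exp_transpose)

lemma isobaric_symmetric: "swap_vars i f = f \<Longrightarrow> isobaric i f = f"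
  by (rule isobaric_eqI) (simp add: mult_diff_eq swap_vars_shift_var_exp)

lemma swap_vars_isobaric_commute:
  assumes "Suc i < j \<or> Suc j < i"
  shows "swap_vars j (isobaric i f) = isobaric i (swap_vars j f)"
proof (rule isobaric_eqI[symmetric])
  have t: "Transposition.transpose j (Suc j) i = i" "Transposition.transpose j (Suc j) (Suc i) = Suc i"
    using assms by (auto simp: Transposition.transpose_def)
  have "mult_diff i (swap_vars j (isobaric i f)) = swap_vars j (mult_diff i (isobaric i f))"
    by (simp add: mult_diff_eq swap_vars_diff swap_vars_shift var_exp_transpose t)
  also have "\<dots> = swap_vars j (shift (var_exp i) f) - swap_vars j (swap_vars i (shift (var_exp i) f))"
    by (simp add: isobaric_mult_diff swap_vars_diff)
  also have "swap_vars j (swap_vars i (shift (var_exp i) f)) = swap_vars i (swap_vars j (shift (var_exp i) f))"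
    using assms by (intro swap_vars_commute) auto
  also have "swap_vars j (shift (var_exp i) f) = shift (var_exp i) (swap_vars j f)"
    by (simp add: swap_vars_shift var_exp_transpose t)
  finally show "mult_diff i (swap_vars j (isobaric i f)) =
    shift (var_exp i) (swap_vars j f) - swap_vars i (shift (var_exp i) (swap_vars j f))" .
qed

text \<open>For $F$ symmetric in $y, z$ the polynomial $\pi_{yz} \pi_{xy} F$ is the sum of the three conjugates
  of $x^2 F / ((x-y)(x-z))$; clearing denominators shows its symmetry.\<close>

lemma isobaric_isobaric_symmetric:
  assumes F: "swap_vars (Suc i) F = F"
  shows "swap_vars i (isobaric (Suc i) (isobaric i F)) = isobaric (Suc i) (isobaric i F)"
proof -
  define x y z where "x = shift (var_exp i)" and "y = shift (var_exp (Suc i))"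
    and "z = shift (var_exp (Suc (Suc i)))"
  note xyz = x_def y_def z_def
  let ?s = "swap_vars i" and ?t = "swap_vars (Suc i)"
  define H where "H = isobaric i F"
  define G where "G = isobaric (Suc i) H"
  have com: "y (x f) = x (y f)" "z (x f) = x (z f)" "z (y f) = y (z f)" for f
    unfolding xyz by (auto simp: shift_commute)
  have lin: "x (f - g) = x f - x g" "y (f - g) = y f - y g" "z (f - g) = z f - z g"
     "x (f + g) = x f + x g" "y (f + g) = y f + y g" "z (f + g) = z f + z g"
     "x (- f) = - x f" "y (- f) = - y f" "z (- f) = - z f" for f g
    unfolding xyz by (auto simp: shift_diff shift_add shift_uminus)
  have sw: "?s (x f) = y (?s f)" "?s (y f) = x (?s f)" "?s (z f) = z (?s f)"
     "?t (x f) = x (?t f)" "?t (y f) = z (?t f)" "?t (z f) = y (?t f)" for f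
    unfolding xyz by (auto simp: swap_vars_shift var_exp_transpose Transposition.transpose_def)
  have H: "x H - y H = x F - y (?s F)"
    using isobaric_mult_diff[of i F] unfolding mult_diff_eq H_def xyz[symmetric] sw .
  have G: "y G - z G = y H - z (?t H)"
    using isobaric_mult_diff[of "Suc i" H] unfolding mult_diff_eq G_def xyz[symmetric] sw .
  have tH: "x (?t H) - z (?t H) = x F - z (?t (?s F))"
    using arg_cong[OF H, of ?t] by (simp add: swap_vars_diff sw F)
  \<comment> \<open>Multiplication by (x-y)(x-z)(y-z), one factor at a time so that each can be
    cancelled afterwards. It anticommutes with the swap of x and y, and the cleared numerator
    \<open>R\<close> changes sign under that swap; hence \<open>V\<close> takes the same value on
    \<open>G\<close> and on its swap.\<close>
  define V where "V f = (let a = y f - z f; b = x a - z a in x b - y b)" for f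
  define R where "R = x (x (y F - z F)) - y (y (x (?s F) - z (?s F))) + z (z (x (?t (?s F)) - y (?t (?s F))))"
  have VG: "V G = R"
  proof -
    have "V G = (let a = y H - z (?t H); b = x a - z a in x b - y b)"
      unfolding V_def G ..
    also have "\<dots> = y (x (x H - y H) - z (x H - y H)) - z (x (x (?t H) - z (?t H)) - y (x (?t H) - z (?t H)))"
      by (simp add: Let_def lin com algebra_simps)
    also have "\<dots> = R"
      unfolding H tH R_def by (simp add: lin com algebra_simps)
    finally show ?thesis .
  qed
  have VsG: "?s (V G) = - V (?s G)"
    unfolding V_def Let_def by (simp add: swap_vars_diff swap_vars_add sw lin com algebra_simps)
  have stsF: "?s (?t (?s F)) = ?t (?s F)"
    by (simp add: swap_vars_braid F)
  have sR: "?s R = - R"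
    unfolding R_def by (simp add: swap_vars_diff swap_vars_add sw lin com stsF algebra_simps)
  have VV: "V (?s G) = V G"
    using VsG sR VG by simp
  have cancel: "x f - y f = x g - y g \<Longrightarrow> f = g" "x f - z f = x g - z g \<Longrightarrow> f = g"
      "y f - z f = y g - z g \<Longrightarrow> f = g" for f g
    unfolding xyz by (rule shift_var_exp_diff_cancel[rotated], assumption, simp)+
  have "?s G = G"
    using VV unfolding V_def Let_def by (rule cancel(3)[OF cancel(2)[OF cancel(1)]])
  then show ?thesis by (simp add: G_def H_def)
qed

section \<open>Schubert polynomials by the Fomin--Kirillov product\<close>

type_synonym perm_poly = "(nat \<Rightarrow> nat) \<Rightarrow> ipoly"

definition pshift :: "mono \<Rightarrow> perm_poly \<Rightarrow> perm_poly" where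
  "pshift a F = (\<lambda>w. shift a (F w))"

definition pswap :: "nat \<Rightarrow> perm_poly \<Rightarrow> perm_poly" where
  "pswap i F = (\<lambda>w. swap_vars i (F w))"

text \<open>Right multiplication by the generator $u_j$ of the nilCoxeter algebra.\<close>

definition nilcox :: "nat \<Rightarrow> perm_poly \<Rightarrow> perm_poly" where
  "nilcox j F = (\<lambda>w. if w (Suc j) < w j then F (w \<circ> Transposition.transpose j (Suc j)) else 0)"

definition fk_factor :: "nat \<Rightarrow> mono \<Rightarrow> perm_poly \<Rightarrow> perm_poly" where
  "fk_factor j a F = F + pshift a (nilcox j F)"

text \<open>\<open>fold\<close> consumes n-1 first, so this is right multiplication by (1 + x^a
  u_(n-1)) ... (1 + x^a u_k), with the smallest index outermost.\<close>

definition fk_row :: "nat \<Rightarrow> nat \<Rightarrow> mono \<Rightarrow> perm_poly \<Rightarrow> perm_poly" where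
  "fk_row n k a = fold (\<lambda>j. fk_factor j a) (rev [k..<n])"

definition fk_one :: perm_poly where
  "fk_one = (\<lambda>w. if w = id then const_one else 0)"

text \<open>Row k carries the variable x_k; row n is the empty product.\<close>

definition fk_schubert :: "nat \<Rightarrow> perm_poly" where
  "fk_schubert n = fold (\<lambda>k. fk_row n k (var_exp k)) [1..<Suc n] fk_one"

lemma pshift_linear:
  "pshift a (F + G) = pshift a F + pshift a G"
  "pshift a (F - G) = pshift a F - pshift a G"
  "pshift a (- F) = - pshift a F"
  "pshift a 0 = 0"
  by (simp_all add: pshift_def fun_eq_iff shift_def)

lemma pshift_commute: "pshift a (pshift c F) = pshift c (pshift a F)"
  by (simp add: pshift_def shift_commute)

lemma nilcox_linear:
  "nilcox j (F + G) = nilcox j F + nilcox j G"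
  "nilcox j (F - G) = nilcox j F - nilcox j G"
  "nilcox j (- F) = - nilcox j F"
  "nilcox j 0 = 0"
  by (simp_all add: nilcox_def fun_eq_iff)

lemma nilcox_pshift: "nilcox j (pshift a F) = pshift a (nilcox j F)"
  by (simp add: nilcox_def pshift_def fun_eq_iff)

lemma nilcox_square: "nilcox j (nilcox j F) = 0"
  by (simp add: nilcox_def fun_eq_iff)

text \<open>On either side the guards amount to w decreasing along j, j+1, j+2, and the braid
  relation of transpositions identifies the arguments.\<close>

lemma nilcox_braid:
  "nilcox (Suc j) (nilcox j (nilcox (Suc j) F)) = nilcox j (nilcox (Suc j) (nilcox j F))"
proof
  fix w :: "nat \<Rightarrow> nat"
  have "Transposition.transpose j (Suc j) \<circ> Transposition.transpose (Suc j) (Suc (Suc j)) \<circ> Transposition.transpose j (Suc j)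
      = Transposition.transpose (Suc j) (Suc (Suc j)) \<circ> Transposition.transpose j (Suc j) \<circ> Transposition.transpose (Suc j) (Suc (Suc j))"
    by (auto simp: fun_eq_iff Transposition.transpose_def)
  then have "w \<circ> Transposition.transpose j (Suc j) \<circ> Transposition.transpose (Suc j) (Suc (Suc j)) \<circ> Transposition.transpose j (Suc j)
      = w \<circ> Transposition.transpose (Suc j) (Suc (Suc j)) \<circ> Transposition.transpose j (Suc j) \<circ> Transposition.transpose (Suc j) (Suc (Suc j))"
    by (simp add: comp_assoc)
  then show "nilcox (Suc j) (nilcox j (nilcox (Suc j) F)) w = nilcox j (nilcox (Suc j) (nilcox j F)) w"
    by (auto simp: nilcox_def Transposition.transpose_def)
qed

lemma nilcox_commute:
  assumes "Suc i < j"
  shows "nilcox j (nilcox i F) = nilcox i (nilcox j F)"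
proof
  fix w :: "nat \<Rightarrow> nat"
  have "Transposition.transpose i (Suc i) \<circ> Transposition.transpose j (Suc j)
      = Transposition.transpose j (Suc j) \<circ> Transposition.transpose i (Suc i)"
    using assms by (auto simp: fun_eq_iff Transposition.transpose_def)
  then have "w \<circ> Transposition.transpose i (Suc i) \<circ> Transposition.transpose j (Suc j)
      = w \<circ> Transposition.transpose j (Suc j) \<circ> Transposition.transpose i (Suc i)"
    by (simp add: comp_assoc)
  then show "nilcox j (nilcox i F) w = nilcox i (nilcox j F) w"
    using assms by (auto simp: nilcox_def Transposition.transpose_def)
qed

lemma pswap_linear: "pswap i (F + G) = pswap i F + pswap i G"
  by (simp add: pswap_def fun_eq_iff swap_vars_def)

lemma pswap_fk_factor:
  "pswap i (fk_factor j a F) = fk_factor j (a \<circ> Transposition.transpose i (Suc i)) (pswap i F)"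
  unfolding fk_factor_def pswap_linear
  by (rule arg_cong2[of _ _ _ _ "(+)"]) (auto simp: pswap_def pshift_def swap_vars_shift nilcox_def fun_eq_iff)

lemma fk_factor_linear:
  "fk_factor j a (F + G) = fk_factor j a F + fk_factor j a G"
  "fk_factor j a (F - G) = fk_factor j a F - fk_factor j a G"
  by (simp_all add: fk_factor_def nilcox_linear pshift_linear)

lemma fk_factor_pshift: "fk_factor j a (pshift c F) = pshift c (fk_factor j a F)"
  by (simp add: fk_factor_def nilcox_pshift pshift_linear pshift_commute)

lemma fk_factor_nilcox:
  "Suc i < j \<Longrightarrow> fk_factor j a (nilcox i F) = nilcox i (fk_factor j a F)"
  by (simp add: fk_factor_def nilcox_pshift nilcox_linear nilcox_commute)

lemma fk_factor_commute:
  "Suc i < j \<Longrightarrow> fk_factor j a (fk_factor i c F) = fk_factor i c (fk_factor j a F)"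
  unfolding fk_factor_def[of i]
  by (simp add: fk_factor_linear fk_factor_pshift fk_factor_nilcox)

lemma fk_row_ge [simp]: "n \<le> k \<Longrightarrow> fk_row n k a F = F"
  by (simp add: fk_row_def)

lemma fk_row_rec: "k < n \<Longrightarrow> fk_row n k a F = fk_factor k a (fk_row n (Suc k) a F)"
  by (simp add: fk_row_def upt_conv_Cons)

text \<open>Carries an operator through a whole row, possibly changing the weight. Swaps of
  variables, shifts, single factors and generators u_i are all used for \<open>T\<close>.\<close>

lemma fk_row_induct_transfer:
  assumes "\<And>j F. k \<le> j \<Longrightarrow> T (fk_factor j a F) = fk_factor j a' (T F)"
  shows "T (fk_row n k a F) = fk_row n k a' (T F)"
proof (cases "k \<le> n")
  case True
  then show ?thesis
    using assms
  proof (induction k rule: inc_induct)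
    case (step k)
    then show ?case by (simp add: fk_row_rec)
  qed simp
qed simp

lemma fk_row_linear:
  "fk_row n k a (F - G) = fk_row n k a F - fk_row n k a G"
proof (cases "k \<le> n")
  case True
  then show ?thesis
  proof (induction k rule: inc_induct)
    case (step k)
    show ?case
      by (simp only: fk_row_rec[OF step.hyps(2)] step.IH fk_factor_linear)
  qed simp
qed simp

text \<open>Put h_j(x) = 1 + x u_j. As u_(i+1) squares to zero, the innermost term is G times
  h_(i+1)(-y), the inverse of h_(i+1)(y). The claim is the symmetry in x and y of h_(i+1)(-y) h_i(x)
  h_(i+1)(y) h_i(y), a form of the Yang-Baxter equation without a factor h(x - y), whose weight
  would not be a monomial.\<close>

lemma fk_yang_baxter:
  "fk_factor i y (fk_factor (Suc i) y (fk_factor i x (G - pshift y (nilcox (Suc i) G)))) =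
   fk_factor i x (fk_factor (Suc i) x (fk_factor i y (G - pshift x (nilcox (Suc i) G))))"
  unfolding fk_factor_def
  by (simp add: nilcox_linear pshift_linear nilcox_pshift nilcox_square nilcox_braid
      pshift_commute[of y x] algebra_simps)

text \<open>Taking the factor k out of both rows leaves the product G of the rows from k+1, which is
  symmetric by induction. The factor k standing between them moves past all indices from k+2 on, and
  what is left has the shape of \<open>fk_yang_baxter\<close>. For k = n-1 there is just one
  generator.\<close>

lemma fk_row_commute: "fk_row n k y (fk_row n k x F) = fk_row n k x (fk_row n k y F)"
proof (cases "k \<le> n")
  case True
  then show ?thesis
  proof (induction k rule: inc_induct)
    case (step k)
    show ?case
    proof (cases "Suc k < n")
      case False
      then have row: "fk_row n k a H = fk_factor k a H" for a H
        using step.hyps by (simp add: fk_row_rec)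
      show ?thesis
        unfolding row
        by (simp add: fk_factor_def pshift_commute[of y x] nilcox_linear nilcox_pshift pshift_linear nilcox_square algebra_simps)
    next
      case lt: True
      define G where "G = fk_row n (Suc k) y (fk_row n (Suc k) x F)"
      have main: "fk_row n k y (fk_row n k x F) = fk_factor k y (fk_factor (Suc k) y (fk_factor k x
          (G - pshift y (nilcox (Suc k) G))))"
        if G: "G = fk_row n (Suc k) y (fk_row n (Suc k) x F)" for x y
      proof -
        \<comment> \<open>\<open>H\<close> lacks only the last factor, of index k+1, of
          \<open>G\<close>; it is recovered by multiplying \<open>G\<close> with the inverse of that
          factor.\<close>
        define H where "H = fk_row n (Suc (Suc k)) y (fk_row n (Suc k) x F)"
        have "G = fk_factor (Suc k) y H"
          using lt by (simp add: G H_def fk_row_rec[of "Suc k"])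
        then have H: "H = G - pshift y (nilcox (Suc k) G)"
          by (simp add: fk_factor_def nilcox_linear pshift_linear nilcox_pshift nilcox_square)
        have "fk_row n k y (fk_row n k x F)
          = fk_factor k y (fk_factor (Suc k) y (fk_row n (Suc (Suc k)) y (fk_factor k x (fk_row n (Suc k) x F))))"
          using lt by (simp add: fk_row_rec[of k] fk_row_rec[of "Suc k" _ y])
        also have "fk_row n (Suc (Suc k)) y (fk_factor k x (fk_row n (Suc k) x F)) = fk_factor k x H"
          unfolding H_def
          by (rule fk_row_induct_transfer[where T = "fk_factor k x", symmetric])
            (rule fk_factor_commute[symmetric], simp)
        finally show ?thesis by (simp add: H)
      qed
      have "G = fk_row n (Suc k) x (fk_row n (Suc k) y F)"
        unfolding G_def by (rule step.IH)
      then show ?thesis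
        using main[OF G_def] main[of x y] fk_yang_baxter by simp
    qed
  qed simp
qed simp

text \<open>Let Q and Q' be the two products. Completing each by a factor at i gives Q(1 + y u_i) =
  Q'(1 + x u_i) by \<open>fk_row_commute\<close>. Multiplication by u_i yields Q u_i = Q' u_i, so
  that Q - Q' = (x - y) Q u_i.\<close>

lemma fk_row_pair_diff:
  assumes "i < n"
  shows "fk_row n (Suc i) y (fk_row n i x F) - fk_row n (Suc i) x (fk_row n i y F)
    = pshift x (nilcox i (fk_row n (Suc i) y (fk_row n i x F)))
    - pshift y (nilcox i (fk_row n (Suc i) y (fk_row n i x F)))"
proof -
  define Q Q' where "Q = fk_row n (Suc i) y (fk_row n i x F)"
    and "Q' = fk_row n (Suc i) x (fk_row n i y F)"
  have eq: "Q + pshift y (nilcox i Q) = Q' + pshift x (nilcox i Q')"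
    using fk_row_commute[of n i y x F] assms
    by (simp add: fk_row_rec[of i _ _ "fk_row n i _ _"] fk_factor_def Q_def Q'_def)
  from arg_cong[OF eq, of "nilcox i"] have "nilcox i Q = nilcox i Q'"
    by (simp add: nilcox_linear nilcox_pshift nilcox_square pshift_linear)
  with eq show ?thesis
    unfolding Q_def[symmetric] Q'_def[symmetric] by (simp add: algebra_simps)
qed

lemma fold_transfer:
  assumes "\<And>k F. k \<in> set ks \<Longrightarrow> T (f k F) = g k (T F)"
  shows "T (fold f ks F) = fold g ks (T F)"
  using assms by (induction ks arbitrary: F) auto

lemma fold_diff:
  fixes f :: "'a \<Rightarrow> 'b::ab_group_add \<Rightarrow> 'b"
  assumes "\<And>k F G. f k (F - G) = f k F - f k G"
  shows "fold f ks (F - G) = fold f ks F - fold f ks G"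
  using assms by (induction ks arbitrary: F G) auto

text \<open>Rows before i contain neither variable, and rows after i+1 contain only generators u_j
  with j \<ge> i+2, which commute with u_i. So the swap affects just the two middle rows, and the
  u_i from \<open>fk_row_pair_diff\<close> can be carried to the right end.\<close>

lemma fk_schubert_diff:
  assumes "1 \<le> i" "i < n"
  shows "fk_schubert n - pswap i (fk_schubert n) =
    pshift (var_exp i) (nilcox i (fk_schubert n)) - pshift (var_exp (Suc i)) (nilcox i (fk_schubert n))"
proof -
  let ?r = "\<lambda>k. fk_row n k (var_exp k)"
  let ?R = "fold ?r [Suc (Suc i)..<Suc n]"
  have "[1..<Suc n] = [1..<i] @ [i..<Suc n]"
    using assms by (metis le_Suc_eq le_add_diff_inverse less_imp_le_nat upt_add_eq_append)
  moreover have "[i..<Suc n] = i # Suc i # [Suc (Suc i)..<Suc n]"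
    using assms by (simp add: upt_conv_Cons)
  ultimately have split: "[1..<Suc n] = [1..<i] @ i # Suc i # [Suc (Suc i)..<Suc n]"
    by simp
  define P where "P = fold ?r [1..<i] fk_one"
  let ?Q = "\<lambda>x y. fk_row n (Suc i) y (fk_row n i x P)"
  have S: "fk_schubert n = ?R (?Q (var_exp i) (var_exp (Suc i)))"
    unfolding fk_schubert_def split by (simp add: P_def)
  have pswap_row: "pswap i (fk_row n k a F) = fk_row n k (a \<circ> Transposition.transpose i (Suc i)) (pswap i F)" for k a F
    by (rule fk_row_induct_transfer[where T = "pswap i"]) (rule pswap_fk_factor)
  have pswap_row': "pswap i (?r k F) = ?r k (pswap i F)" if "k \<noteq> i" "k \<noteq> Suc i" for k F
    using that by (simp add: pswap_row var_exp_transpose)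
  have "pswap i fk_one = fk_one"
    by (simp add: pswap_def fk_one_def fun_eq_iff swap_vars_const_one)
  moreover have "pswap i (fold ?r [1..<i] F) = fold ?r [1..<i] (pswap i F)" for F
    by (rule fold_transfer[where T = "pswap i"]) (rule pswap_row', auto)
  ultimately have "pswap i P = P"
    by (simp add: P_def)
  then have "pswap i (?Q (var_exp i) (var_exp (Suc i))) = ?Q (var_exp (Suc i)) (var_exp i)"
    by (simp add: pswap_row var_exp_transpose)
  moreover have "pswap i (?R F) = ?R (pswap i F)" for F
    by (rule fold_transfer[where T = "pswap i"]) (rule pswap_row', auto)
  ultimately have "pswap i (fk_schubert n) = ?R (?Q (var_exp (Suc i)) (var_exp i))"
    by (simp add: S)
  then have "fk_schubert n - pswap i (fk_schubert n)
    = ?R (?Q (var_exp i) (var_exp (Suc i)) - ?Q (var_exp (Suc i)) (var_exp i))"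
    unfolding S by (simp only: fold_diff[of ?r, OF fk_row_linear])
  also have "\<dots> = ?R (pshift (var_exp i) (nilcox i (?Q (var_exp i) (var_exp (Suc i))))
      - pshift (var_exp (Suc i)) (nilcox i (?Q (var_exp i) (var_exp (Suc i)))))"
    by (simp only: fk_row_pair_diff[OF assms(2)])
  also have "\<dots> = ?R (pshift (var_exp i) (nilcox i (?Q (var_exp i) (var_exp (Suc i)))))
      - ?R (pshift (var_exp (Suc i)) (nilcox i (?Q (var_exp i) (var_exp (Suc i)))))"
    by (simp only: fold_diff[of ?r, OF fk_row_linear])
  finally have diff: "fk_schubert n - pswap i (fk_schubert n) = ?R (pshift (var_exp i) (nilcox i (?Q (var_exp i) (var_exp (Suc i)))))
      - ?R (pshift (var_exp (Suc i)) (nilcox i (?Q (var_exp i) (var_exp (Suc i)))))" .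
  have R_pshift: "?R (pshift a F) = pshift a (?R F)" for a F
    by (rule fold_transfer[where T = "pshift a", symmetric])
      (rule fk_row_induct_transfer[where T = "pshift a"], simp add: fk_factor_pshift)
  have R_nilcox: "?R (nilcox i F) = nilcox i (?R F)" for F
    by (rule fold_transfer[where T = "nilcox i", symmetric])
      (rule fk_row_induct_transfer[where T = "nilcox i"], rule fk_factor_nilcox[symmetric], auto)
  show ?thesis
    unfolding diff R_pshift R_nilcox by (simp only: S)
qed

text \<open>Evaluate \<open>fk_schubert_diff\<close> at w s_i: it has a descent at i, so its
  u_i-term is the value at w.\<close>

lemma mult_diff_fk_schubert:
  assumes "1 \<le> i" "i < n" "w i < w (Suc i)"
  shows "mult_diff i (fk_schubert n w) =
      fk_schubert n (w \<circ> Transposition.transpose i (Suc i))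
      - swap_vars i (fk_schubert n (w \<circ> Transposition.transpose i (Suc i)))"
proof -
  let ?v = "w \<circ> Transposition.transpose i (Suc i)"
  have "nilcox i (fk_schubert n) ?v = fk_schubert n w"
    using assms(3) by (simp add: nilcox_def comp_assoc)
  then show ?thesis
    using fun_cong[OF fk_schubert_diff[OF assms(1,2)], of ?v]
    by (simp add: mult_diff_eq pshift_def pswap_def)
qed

lemma fk_schubert_nonneg: "0 \<le> fk_schubert n w b"
proof -
  have factor: "\<forall>w b. 0 \<le> fk_factor j a F w b" if "\<forall>w b. 0 \<le> F w b" for j a and F :: perm_poly
    using that by (simp add: fk_factor_def pshift_def shift_def nilcox_def)
  have row: "\<forall>w b. 0 \<le> fk_row n k a F w b" if F: "\<forall>w b. 0 \<le> F w b" for k a and F :: perm_poly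
  proof (cases "k \<le> n")
    case True
    then show ?thesis
    proof (induction k rule: inc_induct)
      case (step k)
      then show ?case
        using factor[OF step.IH] by (simp add: fk_row_rec)
    qed (simp add: F)
  qed (simp add: F)
  have "\<forall>w b. 0 \<le> fold (\<lambda>k. fk_row n k (var_exp k)) ks F w b" if "\<forall>w b. 0 \<le> F w b" for ks and F :: perm_poly
    using that by (induction ks arbitrary: F) (simp_all add: row)
  moreover have "\<forall>w b. 0 \<le> fk_one w b"
    by (simp add: fk_one_def const_one_def)
  ultimately show ?thesis
    unfolding fk_schubert_def by blast
qed

section \<open>Length and the longest permutation\<close>

definition inversions :: "nat \<Rightarrow> (nat \<Rightarrow> nat) \<Rightarrow> (nat \<times> nat) set" where
  "inversions n w = {(a, b). a < b \<and> b \<le> n \<and> w b < w a}"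

lemma finite_inversions [simp]: "finite (inversions n w)"
  by (rule finite_subset[of _ "{..n} \<times> {..n}"]) (auto simp: inversions_def)

lemma card_inversions_descent:
  assumes "Suc j \<le> n" "w (Suc j) < w j"
  shows "card (inversions n w) = Suc (card (inversions n (w \<circ> Transposition.transpose j (Suc j))))"
proof -
  let ?t = "Transposition.transpose j (Suc j)"
  have mono: "?t a < ?t b \<and> ?t b \<le> n" if "a < b" "b \<le> n" "(a, b) \<noteq> (j, Suc j)" for a b
    using that assms(1) by (auto simp: Transposition.transpose_def)
  have "inversions n w = insert (j, Suc j) (map_prod ?t ?t ` inversions n (w \<circ> ?t))"
  proof (intro set_eqI iffI)
    fix p
    assume p: "p \<in> inversions n w"
    obtain a b where ab: "p = (a, b)" by force
    show "p \<in> insert (j, Suc j) (map_prod ?t ?t ` inversions n (w \<circ> ?t))"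
    proof (cases "p = (j, Suc j)")
      case False
      then have "(?t a, ?t b) \<in> inversions n (w \<circ> ?t)"
        using p mono[of a b] by (auto simp: ab inversions_def)
      then have "map_prod ?t ?t (?t a, ?t b) \<in> map_prod ?t ?t ` inversions n (w \<circ> ?t)"
        by (rule imageI)
      then show ?thesis by (simp add: ab)
    qed simp
  next
    fix p
    assume p: "p \<in> insert (j, Suc j) (map_prod ?t ?t ` inversions n (w \<circ> ?t))"
    show "p \<in> inversions n w"
    proof (cases "p = (j, Suc j)")
      case True
      then show ?thesis
        using assms by (simp add: inversions_def)
    next
      case False
      then obtain a b where ab: "p = (?t a, ?t b)" "(a, b) \<in> inversions n (w \<circ> ?t)"
        using p by auto
      have "(a, b) \<noteq> (j, Suc j)"
        using ab(2) assms(2) by (auto simp: inversions_def)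
      then show ?thesis
        using ab mono[of a b] by (auto simp: inversions_def)
    qed
  qed
  moreover have "(j, Suc j) \<notin> map_prod ?t ?t ` inversions n (w \<circ> ?t)"
  proof
    assume "(j, Suc j) \<in> map_prod ?t ?t ` inversions n (w \<circ> ?t)"
    then obtain a b where ab: "j = ?t a" "Suc j = ?t b" "(a, b) \<in> inversions n (w \<circ> ?t)"
      by auto
    then have "a = Suc j" "b = j"
      by (metis transpose_apply_first transpose_involutory, metis transpose_apply_second transpose_involutory ab(2))
    then show False
      using ab(3) by (simp add: inversions_def)
  qed
  moreover have "card (map_prod ?t ?t ` inversions n (w \<circ> ?t)) = card (inversions n (w \<circ> ?t))"
    by (intro card_image inj_on_subset[OF prod.inj_map]) auto
  ultimately show ?thesis
    by simp
qed

text \<open>Triangularity with respect to length: F vanishes beyond the length of w and is a single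
  monomial at w. This isolates the longest term of the product without expanding it.\<close>

definition extremal_at :: "nat \<Rightarrow> perm_poly \<Rightarrow> (nat \<Rightarrow> nat) \<Rightarrow> mono \<Rightarrow> bool" where
  "extremal_at n F w a \<longleftrightarrow>
     (\<forall>v. card (inversions n w) < card (inversions n v) \<longrightarrow> F v = 0) \<and> F w = shift a const_one"

text \<open>w is longer by one than w s_j, so F vanishes at w and only the u_j-term contributes
  there.\<close>

lemma extremal_at_fk_factor:
  assumes "extremal_at n F (w \<circ> Transposition.transpose j (Suc j)) a" "Suc j \<le> n" "w (Suc j) < w j"
  shows "extremal_at n (fk_factor j c F) w (c + a)"
  unfolding extremal_at_def
proof (intro conjI allI impI)
  have inv: "card (inversions n w) = Suc (card (inversions n (w \<circ> Transposition.transpose j (Suc j))))"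
    using assms by (intro card_inversions_descent)
  show "fk_factor j c F w = shift (c + a) const_one"
    using assms inv
    by (simp add: fk_factor_def pshift_def nilcox_def extremal_at_def shift_shift)
  fix v
  assume v: "card (inversions n w) < card (inversions n v)"
  have "nilcox j F v = 0"
    using assms v inv card_inversions_descent[of j n v]
    by (auto simp: nilcox_def extremal_at_def)
  moreover have "F v = 0"
    using assms v inv by (auto simp: extremal_at_def)
  ultimately show "fk_factor j c F v = 0"
    by (simp add: fk_factor_def pshift_def)
qed

lemma fk_schubert_w0: "fk_schubert n (w0 n) = top_mono n"
proof -
  \<comment> \<open>\<open>z k\<close> is the state before row k: the values n, n-1, ..., n-k+2
    followed by 1, 2, .... In \<open>y k j\<close> the largest value not yet placed, n+1-k, has
    travelled left from position n to position j. Its n-k moves within row k produce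
    x_k^(n-k).\<close>
  define z where "z k a = (if 1 \<le> a \<and> a < k then Suc n - a else if k \<le> a \<and> a \<le> n then Suc a - k else a)" for k a
  define y where "y k j a = (if 1 \<le> a \<and> a < k then Suc n - a else if k \<le> a \<and> a < j then Suc a - k
      else if a = j then Suc n - k else if j < a \<and> a \<le> n then a - k else a)" for k j a
  have row: "extremal_at n (fk_row n k c F) (z (Suc k)) (\<lambda>r. (n - k) * c r + a r)"
    if F: "extremal_at n F (z k) a" and k: "1 \<le> k" "k \<le> n" for k F a c
  proof -
    have "extremal_at n (fk_row n j c F) (y k j) (\<lambda>r. (n - j) * c r + a r)" if "k \<le> j" "j \<le> n" for j
      using that(2,1)
    proof (induction j rule: inc_induct)
      case base
      have "y k n = z k"
        using k by (auto simp: y_def z_def fun_eq_iff)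
      then show ?case using F by simp
    next
      case (step j)
      have yj: "y k j \<circ> Transposition.transpose j (Suc j) = y k (Suc j)"
      proof
        fix x
        show "(y k j \<circ> Transposition.transpose j (Suc j)) x = y k (Suc j) x"
          using step.hyps step.prems k by (cases "x = j"; cases "x = Suc j") (auto simp: y_def)
      qed
      have "extremal_at n (fk_factor j c (fk_row n (Suc j) c F)) (y k j) (c + (\<lambda>r. (n - Suc j) * c r + a r))"
      proof (rule extremal_at_fk_factor)
        show "extremal_at n (fk_row n (Suc j) c F) (y k j \<circ> Transposition.transpose j (Suc j)) (\<lambda>r. (n - Suc j) * c r + a r)"
          using step yj by simp
        show "y k j (Suc j) < y k j j"
          using step.hyps step.prems k by (simp add: y_def)
      qed (use step.hyps in simp)
      moreover have "c + (\<lambda>r. (n - Suc j) * c r + a r) = (\<lambda>r. (n - j) * c r + a r)"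
      proof
        fix r
        have "n - j = Suc (n - Suc j)" using step.hyps by simp
        then show "(c + (\<lambda>r. (n - Suc j) * c r + a r)) r = (n - j) * c r + a r"
          by simp
      qed
      ultimately show ?case
        using step.hyps by (simp add: fk_row_rec)
    qed
    from this[of k] have "extremal_at n (fk_row n k c F) (y k k) (\<lambda>r. (n - k) * c r + a r)"
      using k by simp
    moreover have "y k k = z (Suc k)"
      using k by (auto simp: y_def z_def fun_eq_iff)
    ultimately show ?thesis by simp
  qed
  have "extremal_at n (fold (\<lambda>k. fk_row n k (var_exp k)) [1..<k] fk_one) (z k) (\<lambda>r. if 1 \<le> r \<and> r < k then n - r else 0)"
    if "1 \<le> k" "k \<le> Suc n" for k
    using that
  proof (induction k rule: nat_induct_at_least)
    case base
    have "z 1 = id"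
      by (auto simp: z_def fun_eq_iff)
    moreover have "inversions n id = {}"
      by (auto simp: inversions_def)
    moreover have "fk_one v = 0" if "0 < card (inversions n v)" for v
    proof -
      have "v \<noteq> id"
        using that \<open>inversions n id = {}\<close> by auto
      then show ?thesis by (simp add: fk_one_def)
    qed
    moreover have "fk_one id = const_one"
      by (simp add: fk_one_def)
    moreover have "(\<lambda>r. if 1 \<le> r \<and> r < (1::nat) then n - r else 0) = 0"
      by (simp add: fun_eq_iff)
    ultimately show ?case
      by (simp only: extremal_at_def shift_0_exp) simp
  next
    case (Suc k)
    have "extremal_at n (fk_row n k (var_exp k) (fold (\<lambda>k. fk_row n k (var_exp k)) [1..<k] fk_one)) (z (Suc k))
        (\<lambda>r. (n - k) * var_exp k r + (if 1 \<le> r \<and> r < k then n - r else 0))"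
      using Suc by (intro row) auto
    moreover have "(\<lambda>r. (n - k) * var_exp k r + (if 1 \<le> r \<and> r < k then n - r else 0))
        = (\<lambda>r. if 1 \<le> r \<and> r < Suc k then n - r else 0)"
      using Suc.hyps by (auto simp: var_exp_def fun_eq_iff)
    ultimately show ?case
      using Suc.hyps by simp
  qed
  from this[of "Suc n"] have "fk_schubert n (z (Suc n)) = shift (\<lambda>r. if 1 \<le> r \<and> r < Suc n then n - r else 0) const_one"
    unfolding extremal_at_def fk_schubert_def by simp
  moreover have "z (Suc n) = w0 n"
    by (auto simp: z_def w0_def fun_eq_iff)
  ultimately show ?thesis
    by (simp add: top_mono_def shift_const_one less_Suc_eq_le)
qed

text \<open>Under strict descents w i + i never increases, yet it is at most n+1 at i = 1 and at
  least n+1 at i = n.\<close>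

lemma no_ascent_imp_w0:
  assumes w: "w permutes {1..n}" and desc: "\<And>i. 1 \<le> i \<Longrightarrow> i < n \<Longrightarrow> w (Suc i) < w i"
  shows "w = w0 n"
proof
  fix x
  have mem: "1 \<le> w i \<and> w i \<le> n" if "1 \<le> i" "i \<le> n" for i
    using permutes_in_image[OF w, of i] that by simp
  have up: "w i + i \<le> Suc n" if "1 \<le> i" "i \<le> n" for i
    using that
  proof (induction i rule: nat_induct_at_least)
    case base
    then show ?case using mem[of 1] by simp
  next
    case (Suc i)
    then show ?case using desc[of i] by simp
  qed
  have lo: "Suc n \<le> w i + i" if "1 \<le> i" "i \<le> n" for i
    using that(2,1)
  proof (induction i rule: inc_induct)
    case base
    then show ?case using mem[of n] by simp
  next
    case (step i)
    then show ?case using desc[of i] by simp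
  qed
  show "w x = w0 n x"
  proof (cases "1 \<le> x \<and> x \<le> n")
    case True
    then show ?thesis using up[of x] lo[of x] by (simp add: w0_def)
  next
    case False
    then show ?thesis using permutes_not_in[OF w, of x] by (auto simp: w0_def)
  qed
qed

text \<open>Any statistic that decreases when an ascent is swapped serves as induction measure.\<close>

definition perm_weight :: "nat \<Rightarrow> (nat \<Rightarrow> nat) \<Rightarrow> nat" where
  "perm_weight n w = (\<Sum>k\<in>{1..n}. k * w k)"

lemma perm_weight_ascent:
  assumes "1 \<le> i" "Suc i \<le> n" "w i < w (Suc i)"
  shows "perm_weight n (w \<circ> Transposition.transpose i (Suc i)) < perm_weight n w"
proof -
  let ?v = "w \<circ> Transposition.transpose i (Suc i)"
  have "{1..n} = insert i (insert (Suc i) ({1..n} - {i, Suc i}))"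
    using assms by auto
  then have split: "(\<Sum>k\<in>{1..n}. f k) = f i + f (Suc i) + (\<Sum>k\<in>{1..n} - {i, Suc i}. f k)" for f :: "nat \<Rightarrow> nat"
    by (metis (no_types, lifting) Diff_iff finite_Diff finite_atLeastAtMost finite_insert insertI1 insert_iff n_not_Suc_n sum.insert add.assoc)
  have "(\<Sum>k\<in>{1..n} - {i, Suc i}. k * ?v k) = (\<Sum>k\<in>{1..n} - {i, Suc i}. k * w k)"
    by (rule sum.cong) auto
  then show ?thesis
    unfolding perm_weight_def split using assms by simp
qed

lemma permutes_comp_transpose:
  assumes "w permutes {1..n}" "1 \<le> i" "Suc i \<le> n"
  shows "w \<circ> Transposition.transpose i (Suc i) permutes {1..n}"
  using assms by (intro permutes_compose permutes_swap_id) auto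

lemma is_schubert_fk_schubert: "w permutes {1..n} \<Longrightarrow> is_schubert n w (fk_schubert n w)"
proof (induction "perm_weight n w" arbitrary: w rule: less_induct)
  case less
  show ?case
  proof (cases "\<exists>i. 1 \<le> i \<and> i < n \<and> w i < w (Suc i)")
    case True
    then obtain i where i: "1 \<le> i" "i < n" "w i < w (Suc i)" by blast
    let ?v = "w \<circ> Transposition.transpose i (Suc i)"
    have "is_schubert n ?v (fk_schubert n ?v)"
      using less i by (intro less.hyps perm_weight_ascent permutes_comp_transpose) auto
    then have "is_schubert n w (ddiff i (fk_schubert n ?v))"
      using i by (intro is_schubert.step) auto
    then show ?thesis
      using ddiff_eqI[OF mult_diff_fk_schubert[OF i]] by simp
  next
    case False
    have "w = w0 n"
    proof (rule no_ascent_imp_w0[OF less.prems])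
      fix i assume i: "1 \<le> i" "i < n"
      have "w i \<noteq> w (Suc i)"
        using permutes_inj[OF less.prems] by (simp add: inj_eq)
      then show "w (Suc i) < w i"
        using False i by (metis linorder_neqE_nat)
    qed
    then show ?thesis
      using is_schubert.top[of n] by (simp add: fk_schubert_w0)
  qed
qed

text \<open>A permutation can be reached along many chains of ascents. Comparing all of them with
  one fixed product makes the result independent of the chain.\<close>

lemma is_schubert_unique: "is_schubert n w f \<Longrightarrow> f = fk_schubert n w"
proof (induction rule: is_schubert.induct)
  case top
  then show ?case by (simp add: fk_schubert_w0)
next
  case (step i w f)
  then have "ddiff i (fk_schubert n (w \<circ> Transposition.transpose i (Suc i))) = fk_schubert n w"
    by (intro ddiff_eqI mult_diff_fk_schubert) auto
  with step.IH show ?case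
    by metis
qed

lemma schubert_eq_fk_schubert: "w permutes {1..n} \<Longrightarrow> schubert n w = fk_schubert n w"
  unfolding schubert_def
  by (rule the_equality) (auto intro: is_schubert_fk_schubert is_schubert_unique)

section \<open>The orthodontia operators\<close>

text \<open>The part of the shape of E_0 that a single step visibly preserves; excluding nonempty
  interval columns guarantees a missing tooth in the leading column.\<close>

definition orthodontic :: "diagram \<Rightarrow> bool" where
  "orthodontic E \<longleftrightarrow> finite E \<and> (\<forall>r c. (r, c) \<in> E \<longrightarrow> 1 \<le> r) \<and> (\<forall>c j. 1 \<le> j \<longrightarrow> col E c \<noteq> {1..j})"

definition row_count :: "diagram \<Rightarrow> mono" where
  "row_count D r = card {c. (r, c) \<in> D}"

lemma mem_col [simp]: "r \<in> col E c \<longleftrightarrow> (r, c) \<in> E"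
  by (simp add: col_def)

lemma finite_col: "finite E \<Longrightarrow> finite (col E c)"
  by (rule finite_subset[of _ "fst ` E"]) force+

lemma diagram_eqI: "(\<And>c. col D c = col E c) \<Longrightarrow> D = E"
  by (auto simp: set_eq_iff)

lemma mem_swap_rows: "(r, c) \<in> swap_rows i E \<longleftrightarrow> (Transposition.transpose i (Suc i) r, c) \<in> E"
proof
  assume "(Transposition.transpose i (Suc i) r, c) \<in> E"
  then have "(\<lambda>(r, c). (Transposition.transpose i (Suc i) r, c)) (Transposition.transpose i (Suc i) r, c) \<in> swap_rows i E"
    unfolding swap_rows_def by (rule imageI)
  then show "(r, c) \<in> swap_rows i E" by simp
qed (auto simp: swap_rows_def)

lemma mem_transpose_image:
  "r \<in> Transposition.transpose i j ` C \<longleftrightarrow> Transposition.transpose i j r \<in> C"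
  by (metis image_iff transpose_involutory)

lemma col_swap_rows: "col (swap_rows i E) c = Transposition.transpose i (Suc i) ` col E c"
  by (auto simp: set_eq_iff mem_transpose_image mem_swap_rows)

lemma col_ortho_step:
  "col (ortho_step E) c = (let C = Transposition.transpose (tooth E) (Suc (tooth E)) ` col E c
     in if C = {1..tooth E} then {} else C)"
proof (rule set_eqI)
  fix r
  let ?C = "Transposition.transpose (tooth E) (Suc (tooth E)) ` col E c"
  have "r \<in> col (ortho_step E) c \<longleftrightarrow> r \<in> ?C \<and> ?C \<noteq> {1..tooth E}"
    unfolding mem_col ortho_step_def Let_def mem_transpose_image
    by (simp add: col_swap_rows mem_swap_rows)
  then show "r \<in> col (ortho_step E) c \<longleftrightarrow> r \<in> (let C = ?C in if C = {1..tooth E} then {} else C)"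
    by (simp only: Let_def split: if_split) blast
qed

lemma ortho_step_empty [simp]: "ortho_step {} = {}"
  by (simp add: ortho_step_def swap_rows_def)

lemma lead_col_nonempty:
  assumes "finite E" "E \<noteq> {}"
  shows "col E (lead_col E) \<noteq> {}" and "\<And>c. c < lead_col E \<Longrightarrow> col E c = {}"
proof -
  have "{c. col E c \<noteq> {}} \<subseteq> snd ` E"
    by force
  then have fin: "finite {c. col E c \<noteq> {}}"
    using assms(1) finite_subset by blast
  moreover have "{c. col E c \<noteq> {}} \<noteq> {}"
    using assms(2) by force
  ultimately have "lead_col E \<in> {c. col E c \<noteq> {}}"
    unfolding lead_col_def by (rule Min_in)
  then show "col E (lead_col E) \<noteq> {}" by simp
  show "col E c = {}" if "c < lead_col E" for c
    using Min_le[OF fin, of c] that unfolding lead_col_def by auto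
qed

lemma lead_col_eqI:
  assumes "finite E" "col E c \<noteq> {}" "\<And>c'. c' < c \<Longrightarrow> col E c' = {}"
  shows "lead_col E = c"
proof -
  have "E \<noteq> {}" using assms(2) by auto
  from lead_col_nonempty[OF assms(1) this] show ?thesis
    using assms(2,3) by (metis linorder_neqE_nat)
qed

text \<open>Without a missing tooth the leading column would contain every row from 1 to its maximum
  and so be an interval, which \<open>orthodontic\<close> excludes.\<close>

lemma tooth_props:
  assumes "orthodontic E" "E \<noteq> {}"
  shows "1 \<le> tooth E" "(tooth E, lead_col E) \<notin> E" "(Suc (tooth E), lead_col E) \<in> E"
    and "\<And>k. 1 \<le> k \<Longrightarrow> k < tooth E \<Longrightarrow> (Suc k, lead_col E) \<in> E \<Longrightarrow> (k, lead_col E) \<in> E"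
proof -
  let ?C = "col E (lead_col E)"
  let ?P = "\<lambda>i. 1 \<le> i \<and> i \<notin> ?C \<and> Suc i \<in> ?C"
  have fin: "finite ?C" and ne: "?C \<noteq> {}"
    using assms lead_col_nonempty(1)[of E] finite_col by (auto simp: orthodontic_def)
  have "\<exists>i. ?P i"
  proof (rule ccontr)
    assume no: "\<not> (\<exists>i. ?P i)"
    have up: "k \<in> ?C" if "k \<le> Max ?C" "1 \<le> k" for k
      using that
    proof (induction k rule: inc_induct)
      case base
      show ?case using Max_in[OF fin ne] .
    next
      case (step k)
      then show ?case using no by auto
    qed
    have lo: "1 \<le> k \<and> k \<le> Max ?C" if "k \<in> ?C" for k
      using that assms(1) Max_ge[OF fin that] unfolding orthodontic_def by (metis mem_col)
    have "?C = {1..Max ?C}"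
      by (rule set_eqI, unfold atLeastAtMost_iff) (use up lo in blast)
    moreover have "1 \<le> Max ?C"
      using Max_in[OF fin ne] assms(1) unfolding orthodontic_def by (metis mem_col)
    ultimately show False
      using assms(1) unfolding orthodontic_def by blast
  qed
  then have P: "?P (tooth E)"
    unfolding tooth_def by (rule LeastI_ex)
  then show "1 \<le> tooth E" "(tooth E, lead_col E) \<notin> E" "(Suc (tooth E), lead_col E) \<in> E"
    by auto
  show "(k, lead_col E) \<in> E" if "1 \<le> k" "k < tooth E" "(Suc k, lead_col E) \<in> E" for k
    using not_less_Least[of k ?P] that unfolding tooth_def by auto
qed

lemma tooth_eqI:
  assumes "1 \<le> i" "(i, lead_col E) \<notin> E" "(Suc i, lead_col E) \<in> E"
    and "\<And>k. 1 \<le> k \<Longrightarrow> k < i \<Longrightarrow> (Suc k, lead_col E) \<in> E \<Longrightarrow> (k, lead_col E) \<in> E"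
  shows "tooth E = i"
  unfolding tooth_def
  by (rule Least_equality) (use assms in \<open>auto simp: not_less[symmetric]\<close>)

lemma initial_below_tooth:
  assumes "orthodontic E" "E \<noteq> {}" "(r, lead_col E) \<in> E" "r \<le> tooth E" "1 \<le> k" "k \<le> r"
  shows "(k, lead_col E) \<in> E"
  using assms(6,5)
proof (induction k rule: inc_induct)
  case base
  then show ?case using assms by simp
next
  case (step k)
  then show ?case
    using tooth_props(4)[OF assms(1,2), of k] assms(4) by simp
qed

lemma transpose_image_atLeastAtMost:
  assumes "j \<noteq> i" "1 \<le> i"
  shows "Transposition.transpose i (Suc i) ` {1..j} = {1..j}"
proof -
  have "Transposition.transpose i (Suc i) r \<in> {1..j} \<longleftrightarrow> r \<in> {1..j}" for r
    using assms by (auto simp: Transposition.transpose_def)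
  then show ?thesis
    by (auto simp: set_eq_iff mem_transpose_image)
qed

lemma transpose_image_eq_iff:
  "Transposition.transpose i j ` C = D \<longleftrightarrow> C = Transposition.transpose i j ` D"
  by (metis transpose_comp_involutory image_comp image_id id_apply)

lemma finite_swap_rows: "finite E \<Longrightarrow> finite (swap_rows i E)"
  by (simp add: swap_rows_def)

lemma ortho_step_subset: "ortho_step E \<subseteq> swap_rows (tooth E) E"
  by (auto simp: ortho_step_def Let_def)

text \<open>The swap fixes every [j] with j \<noteq> i, so such a column would have been present
  before; columns equal to [i] are deleted.\<close>

lemma orthodontic_step:
  assumes "orthodontic E" "E \<noteq> {}"
  shows "orthodontic (ortho_step E)"
  unfolding orthodontic_def
proof (intro conjI allI impI)
  let ?i = "tooth E"
  note i = tooth_props[OF assms]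
  show "finite (ortho_step E)"
    using assms ortho_step_subset finite_subset finite_swap_rows unfolding orthodontic_def by metis
  show "1 \<le> r" if "(r, c) \<in> ortho_step E" for r c
  proof -
    have "(Transposition.transpose ?i (Suc ?i) r, c) \<in> E"
      using that ortho_step_subset mem_swap_rows by blast
    then have "1 \<le> Transposition.transpose ?i (Suc ?i) r"
      using assms(1) unfolding orthodontic_def by blast
    then show ?thesis
      using i(1) by (auto simp: Transposition.transpose_def split: if_splits)
  qed
  show "col (ortho_step E) c \<noteq> {1..j}" if "1 \<le> j" for c j
  proof
    assume "col (ortho_step E) c = {1..j}"
    then have "Transposition.transpose ?i (Suc ?i) ` col E c = {1..j}" "j \<noteq> ?i"
      using that by (auto simp: col_ortho_step Let_def split: if_splits)
    then have "col E c = {1..j}"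
      using transpose_image_atLeastAtMost[OF _ i(1)] by (metis transpose_image_eq_iff)
    then show False
      using assms(1) that by (simp add: orthodontic_def)
  qed
qed

text \<open>The exponent vector of \<omega>_i^m, where \<omega>_i = x_1 ... x_i and m counts the
  columns that the swap completes to [i].\<close>

lemma row_count_removed:
  assumes "finite E"
  shows "row_count (swap_rows (tooth E) E - ortho_step E) =
     (\<lambda>r. if 1 \<le> r \<and> r \<le> tooth E
       then card {c. Transposition.transpose (tooth E) (Suc (tooth E)) ` col E c = {1..tooth E}} else 0)"
proof
  fix r
  let ?t = "Transposition.transpose (tooth E) (Suc (tooth E))"
  have "(r, c) \<in> swap_rows (tooth E) E - ortho_step E \<longleftrightarrow>
     ?t ` col E c = {1..tooth E} \<and> 1 \<le> r \<and> r \<le> tooth E" for c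
  proof -
    have "(r, c) \<in> swap_rows (tooth E) E - ortho_step E \<longleftrightarrow> r \<in> ?t ` col E c \<and> ?t ` col E c = {1..tooth E}"
      unfolding ortho_step_def Let_def by (auto simp: col_swap_rows mem_swap_rows mem_transpose_image)
    then show ?thesis by auto
  qed
  then have "{c. (r, c) \<in> swap_rows (tooth E) E - ortho_step E} =
     (if 1 \<le> r \<and> r \<le> tooth E then {c. ?t ` col E c = {1..tooth E}} else {})"
    by auto
  then show "row_count (swap_rows (tooth E) E - ortho_step E) r =
     (if 1 \<le> r \<and> r \<le> tooth E then card {c. ?t ` col E c = {1..tooth E}} else 0)"
    by (simp add: row_count_def)
qed

text \<open>The nested part of Magyar's formula, read along the process; the columns stripped in
  forming \<open>ortho_E0\<close> are accounted for separately. The number of remaining steps is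
  carried along as induction measure.\<close>

inductive ortho_char :: "nat \<Rightarrow> diagram \<Rightarrow> ipoly \<Rightarrow> bool" where
  empty: "ortho_char 0 {} const_one"
| step: "E \<noteq> {} \<Longrightarrow> ortho_char l (ortho_step E) g \<Longrightarrow> ortho_char (Suc l) E
     (isobaric (tooth E) (shift (row_count (swap_rows (tooth E) E - ortho_step E)) g))"

lemma ortho_char_exists:
  assumes "(ortho_step ^^ l) E = {}" "\<And>r. r < l \<Longrightarrow> (ortho_step ^^ r) E \<noteq> {}"
  shows "\<exists>g. ortho_char l E g"
  using assms
proof (induction l arbitrary: E)
  case 0
  then show ?case using ortho_char.empty by auto
next
  case (Suc l)
  have "(ortho_step ^^ l) (ortho_step E) = {}"
    using Suc.prems(1) by (simp add: funpow_swap1)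
  moreover have "(ortho_step ^^ r) (ortho_step E) \<noteq> {}" if "r < l" for r
    using Suc.prems(2)[of "Suc r"] that by (simp add: funpow_swap1)
  ultimately obtain g where "ortho_char l (ortho_step E) g"
    using Suc.IH by blast
  moreover have "E \<noteq> {}"
    using Suc.prems(2)[of 0] by simp
  ultimately show ?case
    using ortho_char.step by blast
qed

lemma swap_vars_shift_symmetric:
  assumes "a q = a (Suc q)" "swap_vars q f = f"
  shows "swap_vars q (shift a f) = shift a f"
proof -
  have "a \<circ> Transposition.transpose q (Suc q) = a"
    using assms(1) by (auto simp: fun_eq_iff Transposition.transpose_def)
  then show ?thesis by (simp add: swap_vars_shift assms(2))
qed

text \<open>A tooth i with i = q or i + 1 = q would need a box in one of the empty rows. If i is at
  distance at least two from q, the operators commute and both rows stay empty. In the remaining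
  case i = q + 1 two steps are taken together: the box rises through both rows, and \<pi>_(q+1)
  \<pi>_q acts on a polynomial symmetric in x_(q+1), x_(q+2).\<close>

lemma ortho_char_symmetric:
  assumes "ortho_char l E g" "orthodontic E" "1 \<le> q" "\<And>c. (q, c) \<notin> E" "\<And>c. (Suc q, c) \<notin> E"
  shows "swap_vars q g = g"
  using assms
proof (induction l arbitrary: E g q rule: less_induct)
  case (less l)
  from less.prems(1) show ?case
  proof cases
    case empty
    then show ?thesis by (simp add: swap_vars_const_one)
  next
    case (step l1 g1)
    define i where "i = tooth E"
    note ne = \<open>E \<noteq> {}\<close>
    note i = tooth_props[OF less.prems(2) ne, folded i_def]
    have fin: "finite E" using less.prems(2) by (simp add: orthodontic_def)
    have orth1: "orthodontic (ortho_step E)"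
      using orthodontic_step less.prems(2) ne by blast
    have "Suc i \<noteq> q" "i \<noteq> q"
      using i(3) less.prems(4,5) by auto
    then consider (far) "Suc i < q \<or> Suc q < i" | (near) "i = Suc q"
      by linarith
    then show ?thesis
    proof cases
      case far
      have "Transposition.transpose i (Suc i) q = q" "Transposition.transpose i (Suc i) (Suc q) = Suc q"
        using far by (auto simp: Transposition.transpose_def)
      then have "(q, c) \<notin> ortho_step E" "(Suc q, c) \<notin> ortho_step E" for c
        using less.prems(4,5) ortho_step_subset[of E] mem_swap_rows[of _ c i E] by (auto simp: i_def)
      then have "swap_vars q g1 = g1"
        using less.IH[of l1 "ortho_step E" g1 q] step less.prems(3) orth1 by simp
      then have "swap_vars q (shift (row_count (swap_rows i E - ortho_step E)) g1)
          = shift (row_count (swap_rows i E - ortho_step E)) g1"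
        using far less.prems(3) unfolding i_def
        by (intro swap_vars_shift_symmetric) (auto simp: row_count_removed[OF fin])
      then show ?thesis
        using swap_vars_isobaric_commute[of i q] far step by (simp add: i_def)
    next
      case near
      define E1 where "E1 = ortho_step E"
      \<comment> \<open>Row q is empty and lies above the tooth, so the swap completes no column to
        [i]; hence no monomial comes between the two operators.\<close>
      have notint: "Transposition.transpose i (Suc i) ` col E c \<noteq> {1..i}" for c
      proof
        assume "Transposition.transpose i (Suc i) ` col E c = {1..i}"
        then have "q \<in> Transposition.transpose i (Suc i) ` col E c"
          using near less.prems(3) by simp
        moreover have "Transposition.transpose i (Suc i) q = q"
          using near by (simp add: Transposition.transpose_def)
        ultimately show False
          using less.prems(4) unfolding mem_transpose_image by simp
      qed
      then have E1: "E1 = swap_rows i E"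
        unfolding E1_def ortho_step_def Let_def i_def[symmetric] by (auto simp: col_swap_rows)
      have memE1: "(r, c) \<in> E1 \<longleftrightarrow> (Transposition.transpose i (Suc i) r, c) \<in> E" for r c
        by (simp add: E1 mem_swap_rows)
      have orthE1: "orthodontic E1"
        using orth1 by (simp add: E1_def)
      have lead1: "lead_col E1 = lead_col E"
      proof (rule lead_col_eqI)
        show "finite E1" using orthE1 by (simp add: orthodontic_def)
        have "(i, lead_col E) \<in> E1"
          using i(3) by (simp add: memE1)
        then show "col E1 (lead_col E) \<noteq> {}" by auto
        show "col E1 c = {}" if "c < lead_col E" for c
          using lead_col_nonempty(2)[OF fin ne that] by (auto simp: E1 col_swap_rows)
      qed
      have tooth1: "tooth E1 = q"
      proof (rule tooth_eqI)
        show "(q, lead_col E1) \<notin> E1"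
          using less.prems(4) near by (simp add: memE1 Transposition.transpose_def)
        show "(Suc q, lead_col E1) \<in> E1"
          using i(3) near by (simp add: memE1 lead1)
        show "(k, lead_col E1) \<in> E1" if "1 \<le> k" "k < q" "(Suc k, lead_col E1) \<in> E1" for k
          using i(4)[of k] that near by (simp add: memE1 lead1 Transposition.transpose_def)
      qed (use less.prems in simp)
      have ne1: "E1 \<noteq> {}"
        using i(3) memE1[of i "lead_col E"] by auto
      from step(4) have "ortho_char l1 E1 g1" by (simp add: E1_def)
      then obtain l2 g2 where l2: "l1 = Suc l2" "ortho_char l2 (ortho_step E1) g2"
        and g1: "g1 = isobaric q (shift (row_count (swap_rows q E1 - ortho_step E1)) g2)"
        using ne1 by cases (auto simp: tooth1)
      have memE2: "(Transposition.transpose i (Suc i) (Transposition.transpose q (Suc q) r), c) \<in> E"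
        if "(r, c) \<in> ortho_step E1" for r c
        using that ortho_step_subset[of E1] memE1[of _ c] mem_swap_rows[of r c q E1] by (auto simp: tooth1)
      have "(Suc q, c) \<notin> ortho_step E1" "(Suc (Suc q), c) \<notin> ortho_step E1" for c
        using memE2[of "Suc q" c] memE2[of "Suc (Suc q)" c] less.prems(4,5) near
        by (auto simp: Transposition.transpose_def)
      then have "swap_vars (Suc q) g2 = g2"
        using less.IH[of l2 "ortho_step E1" g2 "Suc q"] step(1) l2 orthodontic_step[OF orthE1 ne1] by simp
      moreover have "finite E1" using orthE1 by (simp add: orthodontic_def)
      ultimately have "swap_vars (Suc q) (shift (row_count (swap_rows q E1 - ortho_step E1)) g2)
          = shift (row_count (swap_rows q E1 - ortho_step E1)) g2"
        using row_count_removed[of E1] by (intro swap_vars_shift_symmetric) (auto simp: tooth1)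
      note sym = isobaric_isobaric_symmetric[OF this]
      have "row_count (swap_rows i E - ortho_step E) = 0"
        using E1 by (auto simp: E1_def row_count_def fun_eq_iff)
      then have "g = isobaric (Suc q) g1"
        using step near by (simp add: i_def)
      then show ?thesis
        using sym by (simp add: g1)
    qed
  qed
qed

section \<open>Splitting off a single column\<close>

definition ind_exp :: "nat set \<Rightarrow> mono" where
  "ind_exp V = (\<lambda>r. if r \<in> V then 1 else 0)"

text \<open>The Gale order on sets of equal size: for every k the k-th smallest element of V is at
  most that of C, expressed by counting functions.\<close>

definition col_below :: "nat \<Rightarrow> nat set \<Rightarrow> nat set set" where
  "col_below M C = {V. V \<subseteq> {1..M} \<and> card V = card C \<and> (\<forall>k. card (C \<inter> {1..k}) \<le> card (V \<inter> {1..k}))}"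

definition col_mult :: "nat \<Rightarrow> nat set \<Rightarrow> ipoly \<Rightarrow> ipoly" where
  "col_mult M C g = (\<Sum>V\<in>col_below M C. shift (ind_exp V) g)"

lemma finite_col_below [simp]: "finite (col_below M C)"
  by (rule finite_subset[of _ "Pow {1..M}"]) (auto simp: col_below_def)

lemma card_transpose_image_Int:
  assumes "k \<noteq> i" "1 \<le> i"
  shows "card (Transposition.transpose i (Suc i) ` V \<inter> {1..k}) = card (V \<inter> {1..k})"
proof -
  have "Transposition.transpose i (Suc i) ` V \<inter> {1..k} = Transposition.transpose i (Suc i) ` (V \<inter> {1..k})"
    using transpose_image_atLeastAtMost[OF assms] by (simp add: image_Int)
  then show ?thesis
    by (simp add: card_image)
qed

lemma card_Int_Suc:
  "card (V \<inter> {1..Suc k}) = card (V \<inter> {1..k}) + (if Suc k \<in> V then 1 else 0)"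
proof -
  have "V \<inter> {1..Suc k} = (if Suc k \<in> V then insert (Suc k) (V \<inter> {1..k}) else V \<inter> {1..k})"
    by (auto simp: le_Suc_eq)
  then show ?thesis by simp
qed

text \<open>Moving the box up shrinks the family of admissible V. Every V that is lost contains i+1
  but not i, whence x_i x^V = x_(i+1) x^(s_i V). The family for C is stable under s_i, so after
  multiplication by x_i - x_(i+1) the lost terms cancel and the numerator of \<pi>_i is
  left.\<close>

lemma isobaric_col_mult:
  assumes i: "1 \<le> i" "Suc i \<le> M" "i \<notin> C" "Suc i \<in> C" and g: "swap_vars i g = g"
  shows "isobaric i (col_mult M (Transposition.transpose i (Suc i) ` C) g) = col_mult M C g"
proof -
  let ?t = "Transposition.transpose i (Suc i)"
  let ?B = "col_below M C" and ?B' = "col_below M (?t ` C)"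
  obtain h where h: "i = Suc h" using i(1) by (cases i) auto
  have cnt: "card (?t ` V \<inter> {1..k}) = card (V \<inter> {1..k})" if "k \<noteq> i" for V k
    using card_transpose_image_Int that i(1) by blast
  have C1: "card (C \<inter> {1..i}) = card (C \<inter> {1..h})"
    using i card_Int_Suc[of C h] by (simp add: h)
  have C2: "card (C \<inter> {1..Suc i}) = Suc (card (C \<inter> {1..i}))"
    using i card_Int_Suc[of C i] by simp
  have C3: "card (?t ` C \<inter> {1..i}) = Suc (card (C \<inter> {1..i}))"
    using card_Int_Suc[of "?t ` C" h] cnt[of h C] C1 i by (simp add: h mem_transpose_image)
  have cardt: "card (?t ` V) = card V" for V
    by (simp add: card_image)
  have sub: "?B' \<subseteq> ?B"
  proof
    fix V assume V: "V \<in> ?B'"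
    have "card (C \<inter> {1..k}) \<le> card (V \<inter> {1..k})" for k
    proof (cases "k = i")
      case True
      have "card (?t ` C \<inter> {1..i}) \<le> card (V \<inter> {1..i})"
        using V by (simp add: col_below_def)
      then show ?thesis using C3 True by simp
    next
      case False
      then show ?thesis using cnt[of k C] V by (metis (mono_tags, lifting) col_below_def mem_Collect_eq)
    qed
    then show "V \<in> ?B" using V by (simp add: col_below_def cardt)
  qed
  \<comment> \<open>Only the bound at i can be affected. It survives because C omits i: V meets the
    same bound already at i-1, where the swap changes no count.\<close>
  have tB: "?t ` V \<in> ?B" if V: "V \<in> ?B" for V
  proof -
    have "?t ` V \<subseteq> {1..M}"
    proof
      fix r assume "r \<in> ?t ` V"
      then have "?t r \<in> {1..M}"
        using V by (auto simp: mem_transpose_image col_below_def)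
      then show "r \<in> {1..M}"
        using i by (auto simp: Transposition.transpose_def split: if_splits)
    qed
    moreover have "card (C \<inter> {1..k}) \<le> card (?t ` V \<inter> {1..k})" for k
    proof (cases "k = i")
      case True
      have "card (C \<inter> {1..i}) \<le> card (V \<inter> {1..h})"
        using V C1 by (simp add: col_below_def)
      also have "\<dots> = card (?t ` V \<inter> {1..h})"
        using cnt[of h V] h by simp
      also have "\<dots> \<le> card (?t ` V \<inter> {1..i})"
        by (rule card_mono) (auto simp: h)
      finally show ?thesis using True by simp
    next
      case False
      then show ?thesis using cnt[of k V] V by (simp add: col_below_def)
    qed
    ultimately show ?thesis
      using V by (simp add: col_below_def cardt)
  qed
  \<comment> \<open>Such a V violates only the bound at i for the swapped column, so up to i it has
    exactly as many elements as C. The bounds at i-1 and i+1 then decide about i and i+1.\<close>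
  have new: "i \<notin> V \<and> Suc i \<in> V" if V: "V \<in> ?B - ?B'" for V
  proof -
    have le: "card (C \<inter> {1..k}) \<le> card (V \<inter> {1..k})" for k
      using V by (simp add: col_below_def)
    have "card (V \<inter> {1..i}) \<le> card (C \<inter> {1..i})"
    proof (rule ccontr)
      assume "\<not> ?thesis"
      then have "card (?t ` C \<inter> {1..k}) \<le> card (V \<inter> {1..k})" for k
        using C3 cnt[of k C] le[of k] by (cases "k = i") auto
      then show False
        using V by (auto simp: col_below_def cardt)
    qed
    then show ?thesis
      using le[of h] le[of "Suc i"] C1 C2 card_Int_Suc[of V i] card_Int_Suc[of V h]
      by (auto simp: h split: if_splits)
  qed
  have inj: "inj_on ((`) ?t) A" for A
    by (rule inj_onI) (metis transpose_image_eq_iff)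
  have tBB: "(`) ?t ` ?B = ?B"
  proof
    show "(`) ?t ` ?B \<subseteq> ?B" using tB by auto
    show "?B \<subseteq> (`) ?t ` ?B"
    proof
      fix V assume "V \<in> ?B"
      then have "?t ` V \<in> ?B" by (rule tB)
      moreover have "V = ?t ` (?t ` V)" by (simp add: image_comp)
      ultimately show "V \<in> (`) ?t ` ?B" by blast
    qed
  qed
  let ?f = "\<lambda>V. shift (ind_exp V) g"
  let ?x = "shift (var_exp i)" and ?y = "shift (var_exp (Suc i))"
  have ind_t: "ind_exp V \<circ> ?t = ind_exp (?t ` V)" for V
    by (auto simp: ind_exp_def fun_eq_iff mem_transpose_image)
  have swap: "swap_vars i (col_mult M (?t ` C) g) = (\<Sum>V\<in>?B'. ?f (?t ` V))"
    unfolding col_mult_def by (simp add: swap_vars_sum swap_vars_shift g ind_t)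
  have sum_t: "(\<Sum>V\<in>A. ?f (?t ` V)) = (\<Sum>V\<in>(`) ?t ` A. ?f V)" for A
    by (rule sum.reindex_cong[OF inj refl, symmetric]) simp
  have key: "?x (?f V) = ?y (?f (?t ` V))" if "V \<in> ?B - ?B'" for V
  proof -
    have "var_exp i + ind_exp V = var_exp (Suc i) + ind_exp (?t ` V)"
      using new[OF that]
      by (auto simp: var_exp_def ind_exp_def fun_eq_iff mem_transpose_image Transposition.transpose_def)
    then show ?thesis by (simp add: shift_shift)
  qed
  have S1: "(\<Sum>V\<in>?B. ?f V) = (\<Sum>V\<in>?B'. ?f V) + (\<Sum>V\<in>?B - ?B'. ?f V)"
    using sub by (simp add: sum.subset_diff add.commute)
  have S2: "(\<Sum>V\<in>?B. ?f V) = (\<Sum>V\<in>?B'. ?f (?t ` V)) + (\<Sum>V\<in>?B - ?B'. ?f (?t ` V))"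
  proof -
    have "(\<Sum>V\<in>?B. ?f V) = (\<Sum>V\<in>?B. ?f (?t ` V))"
      using sum_t[of ?B] tBB by simp
    then show ?thesis
      using sum.subset_diff[OF sub, of "\<lambda>V. ?f (?t ` V)"] by (simp only: finite_col_below add.commute)
  qed
  have S3: "?x (\<Sum>V\<in>?B - ?B'. ?f V) = ?y (\<Sum>V\<in>?B - ?B'. ?f (?t ` V))"
    by (simp only: shift_sum finite_Diff finite_col_below) (rule sum.cong[OF refl], rule key)
  show ?thesis
  proof (rule isobaric_eqI)
    have "mult_diff i (col_mult M C g) = ?x (\<Sum>V\<in>?B. ?f V) - ?y (\<Sum>V\<in>?B. ?f V)"
      by (simp add: mult_diff_eq col_mult_def)
    also have "?x (\<Sum>V\<in>?B. ?f V) = ?x (\<Sum>V\<in>?B'. ?f V) + ?y (\<Sum>V\<in>?B - ?B'. ?f (?t ` V))"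
      unfolding S1 shift_add S3 ..
    also have "?y (\<Sum>V\<in>?B. ?f V) = ?y (\<Sum>V\<in>?B'. ?f (?t ` V)) + ?y (\<Sum>V\<in>?B - ?B'. ?f (?t ` V))"
      unfolding S2 shift_add ..
    finally have "mult_diff i (col_mult M C g) = ?x (\<Sum>V\<in>?B'. ?f V) - ?y (\<Sum>V\<in>?B'. ?f (?t ` V))"
      by (simp only: add_diff_cancel_right)
    then show "mult_diff i (col_mult M C g) = ?x (col_mult M (?t ` C) g) - swap_vars i (?x (col_mult M (?t ` C) g))"
      unfolding swap_vars_shift_var_exp swap unfolding col_mult_def .
  qed
qed

lemma col_mult_initial:
  assumes "q \<le> M"
  shows "col_mult M {1..q} g = shift (ind_exp {1..q}) g"
proof -
  have "V = {1..q}" if "V \<in> col_below M {1..q}" for V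
  proof -
    have "finite V" "card V = q"
      using that finite_subset[of V "{1..M}"] by (auto simp: col_below_def)
    moreover have "card ({1..q} \<inter> {1..q}) \<le> card (V \<inter> {1..q})"
      using that unfolding col_below_def by blast
    ultimately have "V \<inter> {1..q} = {1..q}" "V \<inter> {1..q} = V"
      by (simp_all add: card_seteq)
    then show ?thesis by simp
  qed
  moreover have "{1..q} \<in> col_below M {1..q}"
    using assms by (auto simp: col_below_def)
  ultimately have "col_below M {1..q} = {{1..q}}" by blast
  then show ?thesis by (simp add: col_mult_def)
qed

text \<open>The teeth of column c lie strictly between p and M, so its swaps involve only rows free
  of other boxes. The other columns stand still while c is straightened, and their polynomial is
  symmetric in each pair of variables passed, as \<open>isobaric_col_mult\<close> demands. At time t
  the column c has just disappeared.\<close>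

lemma ortho_char_lead_col:
  assumes "ortho_char l E g" "orthodontic E" "E \<noteq> {}" "c = lead_col E" "{1..p} \<subseteq> col E c" "col E c \<subseteq> {1..M}"
    and "\<And>r c'. c' \<noteq> c \<Longrightarrow> p < r \<Longrightarrow> r \<le> M \<Longrightarrow> (r, c') \<notin> E"
  shows "\<exists>t g'. 0 < t \<and> t \<le> l \<and> (ortho_step ^^ t) E = {(r, c') \<in> E. c' \<noteq> c} \<and>
     ortho_char (l - t) {(r, c') \<in> E. c' \<noteq> c} g' \<and> g = col_mult M (col E c) g'"
  using assms
proof (induction l arbitrary: E g)
  case 0
  from 0(1) 0(3) show ?case by cases auto
next
  case (Suc l)
  define E' where "E' = {(r, c') \<in> E. c' \<noteq> c}"
  define i where "i = tooth E"
  let ?t = "Transposition.transpose i (Suc i)"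
  note i = tooth_props[OF Suc.prems(2,3), folded i_def Suc.prems(4)]
  have fin: "finite E" using Suc.prems(2) by (simp add: orthodontic_def)
  have iM: "p < i" "Suc i \<le> M"
    using i(1,2,3) Suc.prems(5,6) by (auto simp: subset_iff)
  obtain g1 where g1: "ortho_char l (ortho_step E) g1"
    and g: "g = isobaric i (shift (row_count (swap_rows i E - ortho_step E)) g1)"
    using Suc.prems(1,3) by cases (auto simp: i_def)
  have fixed: "?t ` col E c' = col E c'" if "c' \<noteq> c" for c'
  proof -
    have "(i, c') \<notin> E" "(Suc i, c') \<notin> E"
      using Suc.prems(7)[OF that] iM by auto
    then have "(?t r, c') \<in> E \<longleftrightarrow> (r, c') \<in> E" for r
      by (auto simp: Transposition.transpose_def)
    then show ?thesis by (auto simp: mem_transpose_image set_eq_iff)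
  qed
  have notint: "col E c' \<noteq> {1..i}" if "c' \<noteq> c" for c'
  proof
    assume "col E c' = {1..i}"
    then have "Suc p \<in> col E c'" using iM by simp
    then show False using Suc.prems(7)[OF that, of "Suc p"] iM by simp
  qed
  have col1: "col (ortho_step E) c' = (if c' \<noteq> c then col E c' else if ?t ` col E c = {1..i} then {} else ?t ` col E c)" for c'
    using fixed notint by (auto simp: col_ortho_step Let_def i_def[symmetric])
  have colE': "col E' c' = (if c' \<noteq> c then col E c' else {})" for c'
    by (auto simp: E'_def)
  have E'1: "{(r, c') \<in> ortho_step E. c' \<noteq> c} = E'"
  proof (rule diagram_eqI)
    fix c'
    have "col {(r, c') \<in> ortho_step E. c' \<noteq> c} c' = (if c' \<noteq> c then col (ortho_step E) c' else {})"
      by auto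
    then show "col {(r, c') \<in> ortho_step E. c' \<noteq> c} c' = col E' c'"
      by (simp add: colE' col1)
  qed
  have orthE': "orthodontic E'"
  proof -
    have "finite E'" by (rule finite_subset[OF _ fin]) (auto simp: E'_def)
    moreover have "1 \<le> r" if "(r, c') \<in> E'" for r c'
      using that Suc.prems(2) by (auto simp: E'_def orthodontic_def)
    moreover have "col E' c' \<noteq> {1..j}" if "1 \<le> j" for c' j
      using that Suc.prems(2) by (auto simp: colE' orthodontic_def)
    ultimately show ?thesis by (simp add: orthodontic_def)
  qed
  have sym: "swap_vars i g' = g'" if "ortho_char l' E' g'" for l' g'
  proof (rule ortho_char_symmetric[OF that orthE' i(1)])
    show "(i, c') \<notin> E'" "(Suc i, c') \<notin> E'" for c'
      using Suc.prems(7)[of c' i] Suc.prems(7)[of c' "Suc i"] iM by (auto simp: E'_def)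
  qed
  have main: "isobaric i (col_mult M (?t ` col E c) g') = col_mult M (col E c) g'" if "ortho_char l' E' g'" for l' g'
    using isobaric_col_mult[OF i(1) iM(2) _ _ sym[OF that]] i(2,3) by simp
  show ?case
  proof (cases "?t ` col E c = {1..i}")
    case True
    have step: "ortho_step E = E'"
      by (rule diagram_eqI) (simp add: colE' col1 True)
    have "?t ` col E c' = {1..i} \<longleftrightarrow> c' = c" for c'
      using True fixed[of c'] notint[of c'] by (cases "c' = c") simp_all
    then have "{c'. ?t ` col E c' = {1..i}} = {c}"
      by blast
    then have "row_count (swap_rows i E - ortho_step E) = ind_exp {1..i}"
      using row_count_removed[OF fin] by (auto simp: i_def[symmetric] ind_exp_def fun_eq_iff)
    then have "g = isobaric i (col_mult M (?t ` col E c) g1)"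
      using g iM by (simp only: True col_mult_initial[of i M] Suc_leD)
    also have "\<dots> = col_mult M (col E c) g1"
      by (rule main) (use g1 step in simp)
    finally show ?thesis
      using g1 step unfolding E'_def by (intro exI[of _ 1] exI[of _ g1]) auto
  next
    case False
    have "?t ` col E c' \<noteq> {1..i}" for c'
      using False fixed[of c'] notint[of c'] by (cases "c' = c") simp_all
    then have "{c'. ?t ` col E c' = {1..i}} = {}"
      by blast
    then have "row_count (swap_rows i E - ortho_step E) = 0"
      using row_count_removed[OF fin] by (auto simp: i_def[symmetric] fun_eq_iff)
    then have gg1: "g = isobaric i g1" using g by simp
    have colc: "col (ortho_step E) c = ?t ` col E c" using col1 False by simp
    have orth1: "orthodontic (ortho_step E)"
      using orthodontic_step Suc.prems(2,3) by blast
    have ne1: "col (ortho_step E) c \<noteq> {}"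
      using colc i(3) by auto
    have lead1: "lead_col (ortho_step E) = c"
    proof (rule lead_col_eqI)
      show "finite (ortho_step E)" using orth1 by (simp add: orthodontic_def)
      show "col (ortho_step E) c' = {}" if "c' < c" for c'
        using lead_col_nonempty(2)[OF fin Suc.prems(3)] that Suc.prems(4) by (simp add: col1)
    qed (rule ne1)
    have "\<exists>t g'. 0 < t \<and> t \<le> l \<and> (ortho_step ^^ t) (ortho_step E) = {(r, c') \<in> ortho_step E. c' \<noteq> c} \<and>
     ortho_char (l - t) {(r, c') \<in> ortho_step E. c' \<noteq> c} g' \<and> g1 = col_mult M (col (ortho_step E) c) g'"
    proof (rule Suc.IH[OF g1 orth1])
      show "ortho_step E \<noteq> {}" using ne1 by auto
      show "c = lead_col (ortho_step E)" using lead1 by simp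
      show "{1..p} \<subseteq> col (ortho_step E) c"
      proof
        fix r assume "r \<in> {1..p}"
        then have "r \<in> col E c" "?t r = r"
          using Suc.prems(5) iM by (auto simp: Transposition.transpose_def)
        then show "r \<in> col (ortho_step E) c"
          unfolding colc mem_transpose_image by simp
      qed
      show "col (ortho_step E) c \<subseteq> {1..M}"
      proof
        fix r assume "r \<in> col (ortho_step E) c"
        then have "?t r \<in> {1..M}"
          using Suc.prems(6) unfolding colc mem_transpose_image by blast
        then show "r \<in> {1..M}"
          using iM i(1) by (auto simp: Transposition.transpose_def split: if_splits)
      qed
      show "(r, c') \<notin> ortho_step E" if "c' \<noteq> c" "p < r" "r \<le> M" for r c'
        using Suc.prems(7)[OF that] col1[of c'] that(1) by (metis mem_col)
    qed
    then obtain t g' where t: "t \<le> l" "(ortho_step ^^ t) (ortho_step E) = E'" "ortho_char (l - t) E' g'"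
      and g1': "g1 = col_mult M (?t ` col E c) g'"
      unfolding E'1 colc by blast
    have "g = col_mult M (col E c) g'"
      using main[OF t(3)] by (simp add: gg1 g1')
    then show ?thesis
      using t unfolding E'_def[symmetric]
      by (intro exI[of _ "Suc t"] exI[of _ g']) (simp add: funpow_swap1)
  qed
qed

section \<open>Orthodontia of Rothe diagrams\<close>

lemma mem_rothe:
  "(r, c) \<in> rothe n w \<longleftrightarrow> 1 \<le> r \<and> r \<le> n \<and> 1 \<le> c \<and> c \<le> n \<and> r < inv w c \<and> c < w r"
  by (auto simp: rothe_def)

lemma finite_rothe: "finite (rothe n w)"
  by (rule finite_subset[of _ "{1..n} \<times> {1..n}"]) (auto simp: rothe_def)

lemma col_ortho_E0:
  "col (ortho_E0 n w) c = (if \<exists>j. col (rothe n w) c = {1..j} then {} else col (rothe n w) c)"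
  by (auto simp: ortho_E0_def)

lemma ortho_E0_subset: "ortho_E0 n w \<subseteq> rothe n w"
  by (auto simp: ortho_E0_def)

lemma orthodontic_ortho_E0: "orthodontic (ortho_E0 n w)"
  unfolding orthodontic_def
proof (intro conjI allI impI)
  show "finite (ortho_E0 n w)"
    by (rule finite_subset[OF ortho_E0_subset finite_rothe])
  show "1 \<le> r" if "(r, c) \<in> ortho_E0 n w" for r c
    using subsetD[OF ortho_E0_subset that] by (simp add: mem_rothe)
  show "col (ortho_E0 n w) c \<noteq> {1..j}" if "1 \<le> j" for c j
  proof (cases "\<exists>j. col (rothe n w) c = {1..j}")
    case True
    then have "col (ortho_E0 n w) c = {}" by (simp only: col_ortho_E0 if_True)
    then show ?thesis using that by simp
  next
    case False
    then have "col (ortho_E0 n w) c = col (rothe n w) c" by (simp only: col_ortho_E0 if_False)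
    then show ?thesis using False by metis
  qed
qed

lemma down_closed_eq_initial:
  fixes C :: "nat set"
  assumes "finite C" "\<And>r. r \<in> C \<Longrightarrow> 1 \<le> r" "\<And>r k. r \<in> C \<Longrightarrow> 1 \<le> k \<Longrightarrow> k \<le> r \<Longrightarrow> k \<in> C"
  shows "\<exists>j. C = {1..j}"
proof (cases "C = {}")
  case True
  then have "C = {1..0}" by simp
  then show ?thesis by blast
next
  case False
  have "C = {1..Max C}"
  proof (rule set_eqI)
    fix k
    show "k \<in> C \<longleftrightarrow> k \<in> {1..Max C}"
      using assms(2)[of k] assms(3)[OF Max_in[OF assms(1) False], of k] Max_ge[OF assms(1), of k]
      unfolding atLeastAtMost_iff by blast
  qed
  then show ?thesis by blast
qed

lemma row_count_swap_rows: "row_count (swap_rows q X) = row_count X \<circ> Transposition.transpose q (Suc q)"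
  by (simp add: fun_eq_iff row_count_def mem_swap_rows)

lemma row_count_Un:
  assumes "finite X" "finite Y" "X \<inter> Y = {}"
  shows "row_count (X \<union> Y) = row_count X + row_count Y"
proof
  fix r
  have fin: "finite {c. (r, c) \<in> Z}" if "finite Z" for Z :: diagram
    by (rule finite_subset[of _ "snd ` Z"]) (use that in force)+
  have "{c. (r, c) \<in> X \<union> Y} = {c. (r, c) \<in> X} \<union> {c. (r, c) \<in> Y}" by auto
  moreover have "{c. (r, c) \<in> X} \<inter> {c. (r, c) \<in> Y} = {}" using assms(3) by auto
  ultimately show "row_count (X \<union> Y) r = (row_count X + row_count Y) r"
    using card_Un_disjoint[OF fin[OF assms(1)] fin[OF assms(2)]] by (simp add: row_count_def)
qed

lemma row_count_single: "row_count {(q, c)} = var_exp q"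
  by (auto simp: row_count_def var_exp_def fun_eq_iff)

text \<open>The new box is the inversion created by the exchange: position q now holds the larger
  value, and w q stands right after it.\<close>

lemma rothe_ascent:
  assumes w: "w permutes {1..n}" and q: "1 \<le> q" "q < n" "w q < w (Suc q)"
  shows "rothe n (w \<circ> Transposition.transpose q (Suc q)) = insert (q, w q) (swap_rows q (rothe n w))"
proof -
  let ?t = "Transposition.transpose q (Suc q)"
  have bij: "bij w" using w by (rule permutes_bij)
  have inv_eq: "inv (w \<circ> ?t) c = ?t (inv w c)" for c
    using o_inv_distrib[OF bij, of ?t] by simp
  have ww: "w (inv w c) = c" for c
    using permutes_inverses(1)[OF w] .
  have wq: "1 \<le> w q" "w q \<le> n"
    using permutes_in_image[OF w, of q] q by auto
  have "(r, c) \<in> rothe n (w \<circ> ?t) \<longleftrightarrow> (r, c) \<in> insert (q, w q) (swap_rows q (rothe n w))" for r c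
  proof -
    have rng: "1 \<le> ?t r \<and> ?t r \<le> n \<longleftrightarrow> 1 \<le> r \<and> r \<le> n"
      using q by (auto simp: Transposition.transpose_def)
    have main: "r < ?t (inv w c) \<and> c < w (?t r) \<longleftrightarrow> (?t r < inv w c \<and> c < w (?t r)) \<or> (r = q \<and> c = w q)"
    proof -
      have A: "r < ?t (inv w c) \<longleftrightarrow>
          ?t r < inv w c \<and> \<not> (r = Suc q \<and> inv w c = Suc q) \<or> r = q \<and> inv w c = q"
        by (auto simp: Transposition.transpose_def)
      have B: "\<not> (c < w (?t r))" if "r = Suc q" "inv w c = Suc q"
        using ww[of c] q(3) that by simp
      have C: "inv w c = q \<longleftrightarrow> c = w q"
        using permutes_inv_eq[OF w] by metis
      have D: "c < w (?t r)" if "r = q" "c = w q"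
        using q(3) that by simp
      show ?thesis
        using A B C D by blast
    qed
    show ?thesis
      unfolding insert_iff mem_swap_rows mem_rothe inv_eq comp_apply prod.inject
      using rng main wq q by (auto simp: Suc_le_eq)
  qed
  then show ?thesis by auto
qed

text \<open>Let c be the leading column and q the first ascent with w_q < c. Column w_q is [q-1] and
  grows to [q]. Row q is contained in row q+1, so no column equals [q] and the swap preserves all
  interval columns. If w_(q+1) < c, rows q and q+1 contain no surviving box; otherwise q is the
  missing tooth of c. The statement serves both the orthodontia formula and
  \<open>ortho_E0_step_exists\<close>.\<close>

lemma ortho_E0_ascent:
  assumes w: "w permutes {1..n}" and nt: "ortho_E0 n w \<noteq> {} \<or> w \<noteq> w0 n"
  obtains q where "1 \<le> q" "q < n" "w q < w (Suc q)"
    and "(row_count (rothe n w - ortho_E0 n w)) q = (row_count (rothe n w - ortho_E0 n w)) (Suc q)"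
    and "row_count (rothe n (w \<circ> Transposition.transpose q (Suc q)) - ortho_E0 n (w \<circ> Transposition.transpose q (Suc q)))
      = row_count (rothe n w - ortho_E0 n w) + (var_exp q +
        row_count (swap_rows q (ortho_E0 n w) - ortho_E0 n (w \<circ> Transposition.transpose q (Suc q))))"
    and "(ortho_E0 n (w \<circ> Transposition.transpose q (Suc q)) = ortho_E0 n w \<and> swap_rows q (ortho_E0 n w) = ortho_E0 n w \<and>
        (\<forall>c. (q, c) \<notin> ortho_E0 n w \<and> (Suc q, c) \<notin> ortho_E0 n w))
      \<or> (ortho_E0 n w \<noteq> {} \<and> tooth (ortho_E0 n w) = q
        \<and> ortho_E0 n (w \<circ> Transposition.transpose q (Suc q)) = ortho_step (ortho_E0 n w))"
proof -
  let ?D = "rothe n w" and ?E = "ortho_E0 n w"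
  \<comment> \<open>If no column survives, the value n+1 makes every ascent admissible.\<close>
  define cb where "cb = (if ?E = {} then Suc n else lead_col ?E)"
  have orth: "orthodontic ?E" by (rule orthodontic_ortho_E0)
  have finE: "finite ?E" using orth by (simp add: orthodontic_def)
  have winj: "w x = w y \<longleftrightarrow> x = y" for x y
    using permutes_inj[OF w] by (simp add: inj_eq)
  have ww: "w (inv w c) = c" for c
    using permutes_inverses(1)[OF w] .
  have iww: "inv w (w c) = c" for c
    using permutes_inverses(2)[OF w] .
  have wr: "1 \<le> w x \<and> w x \<le> n" if "1 \<le> x" "x \<le> n" for x
    using permutes_in_image[OF w, of x] that by auto
  have left: "\<exists>j. col ?D c = {1..j}" if "c < cb" for c
  proof -
    have "col ?E c = {}"
    proof (cases "?E = {}")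
      case False
      then show ?thesis using lead_col_nonempty(2)[OF finE False] that by (simp add: cb_def)
    qed auto
    then show ?thesis
      by (auto simp: col_ortho_E0 split: if_splits intro: exI[of _ 0])
  qed
  have lead: "col ?E cb = col ?D cb" "\<not> (\<exists>j. col ?D cb = {1..j})" "1 \<le> cb" "cb \<le> n" if "?E \<noteq> {}"
  proof -
    have ne: "col ?E cb \<noteq> {}"
      using lead_col_nonempty(1)[OF finE that] that by (simp add: cb_def)
    then show "col ?E cb = col ?D cb" "\<not> (\<exists>j. col ?D cb = {1..j})"
      by (auto simp: col_ortho_E0 split: if_splits)
    obtain r where "(r, cb) \<in> ?D"
      using ne ortho_E0_subset by fastforce
    then show "1 \<le> cb" "cb \<le> n" by (simp_all add: mem_rothe)
  qed
  let ?A = "\<lambda>q. 1 \<le> q \<and> q < n \<and> w q < w (Suc q) \<and> w q < cb"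
  \<comment> \<open>For nonempty E_0 the tooth itself is such an ascent.\<close>
  have "\<exists>q. ?A q"
  proof (cases "?E = {}")
    case False
    let ?i = "tooth ?E"
    have lc: "lead_col ?E = cb" using False by (simp add: cb_def)
    note i = tooth_props[OF orth False, unfolded lc]
    have i1: "(Suc ?i, cb) \<in> ?D" "(?i, cb) \<notin> ?D"
      using i(2,3) lead(1)[OF False] mem_col by metis+
    then have "Suc ?i \<le> n" "Suc ?i < inv w cb" "cb < w (Suc ?i)"
      by (auto simp: mem_rothe)
    moreover from this have "\<not> cb < w ?i"
      using i1(2) i(1) lead(3,4)[OF False] by (auto simp: mem_rothe)
    moreover have "w ?i \<noteq> cb"
      using iww[of ?i] \<open>Suc ?i < inv w cb\<close> by auto
    ultimately show ?thesis
      using i(1) by (intro exI[of _ ?i]) auto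
  next
    case True
    then have "w \<noteq> w0 n" using nt by simp
    then obtain q where "1 \<le> q" "q < n" "\<not> w (Suc q) < w q"
      using no_ascent_imp_w0[OF w] by blast
    moreover have "w q \<noteq> w (Suc q)" by (simp add: winj)
    moreover have "w q < cb" using wr[of q] \<open>1 \<le> q\<close> \<open>q < n\<close> True by (simp add: cb_def)
    ultimately show ?thesis by auto
  qed
  define q where "q = (LEAST q. ?A q)"
  have q: "1 \<le> q" "q < n" "w q < w (Suc q)" "w q < cb"
    using LeastI_ex[OF \<open>\<exists>q. ?A q\<close>] by (simp_all add: q_def)
  have desc: "w (Suc k) < w k" if "1 \<le> k" "k < q" "w k < cb" for k
  proof -
    have "\<not> ?A k" using not_less_Least[of k ?A] that(2) by (simp add: q_def)
    moreover have "w k \<noteq> w (Suc k)" by (simp add: winj)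
    ultimately show ?thesis using that q(2) by auto
  qed
  \<comment> \<open>By minimality of q, from a value below \<open>cb\<close> on the values decrease
    up to position q.\<close>
  have F1: "w k' \<le> w k" if "k \<le> k'" "k' \<le> q" "1 \<le> k" "w k < cb" for k k'
    using that
  proof (induction k' rule: dec_induct)
    case (step m)
    then have "w m \<le> w k" by simp
    then show ?case using desc[of m] step by simp
  qed simp
  define t where "t = Transposition.transpose q (Suc q)"
  define v where "v = w \<circ> t"
  let ?Dv = "rothe n v" and ?Ev = "ortho_E0 n v"
  have Dv: "?Dv = insert (q, w q) (swap_rows q ?D)"
    unfolding v_def t_def by (rule rothe_ascent[OF w q(1-3)])
  have colq: "col ?D (w q) = {1..q - 1}"
  proof (rule set_eqI)
    fix r
    have "r \<in> col ?D (w q) \<longleftrightarrow> 1 \<le> r \<and> r < q \<and> w q < w r"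
      using q wr[of q] by (auto simp: mem_rothe iww)
    moreover have "w q < w r" if "1 \<le> r" "r < q"
    proof (rule ccontr)
      assume "\<not> w q < w r"
      moreover have "w q \<noteq> w r" using that by (simp add: winj)
      ultimately have "w r < w q" by simp
      moreover have "w q \<le> w r" using F1[of r q] that q \<open>w r < w q\<close> by simp
      ultimately show False by simp
    qed
    ultimately show "r \<in> col ?D (w q) \<longleftrightarrow> r \<in> {1..q - 1}"
      using q(1) unfolding atLeastAtMost_iff by (metis Suc_diff_1 less_Suc_eq_le less_eq_Suc_le One_nat_def)
  qed
  have colvq: "col ?Dv (w q) = {1..q}"
  proof -
    have "col ?Dv (w q) = insert q (t ` {1..q - 1})"
      using colq col_swap_rows[of q ?D "w q"] by (auto simp: Dv t_def)
    also have "t ` {1..q - 1} = {1..q - 1}"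
      unfolding t_def using q(1) by (intro transpose_image_atLeastAtMost) auto
    also have "insert q {1..q - 1} = {1..q}" using q(1) by auto
    finally show ?thesis .
  qed
  have colv: "col ?Dv c = t ` col ?D c" if "c \<noteq> w q" for c
    using that col_swap_rows[of q ?D c] by (auto simp: Dv t_def)
  have row_q: "(Suc q, c) \<in> ?D" if "(q, c) \<in> ?D" for c
  proof -
    have "inv w c \<noteq> Suc q" using that q(3) ww[of c] by (auto simp: mem_rothe)
    then show ?thesis using that q by (auto simp: mem_rothe)
  qed
  have notq: "col ?D c \<noteq> {1..q}" for c
  proof
    assume *: "col ?D c = {1..q}"
    then have "(q, c) \<in> ?D" using q(1) by (auto simp: set_eq_iff)
    then have "Suc q \<in> col ?D c" using row_q by simp
    then show False using * by simp
  qed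
  have int_t: "t ` col ?D c = col ?D c" if int: "\<exists>j. col ?D c = {1..j}" for c
  proof -
    obtain j where j: "col ?D c = {1..j}" using int by blast
    then have "j \<noteq> q" using notq by blast
    then show ?thesis unfolding j t_def using transpose_image_atLeastAtMost q(1) by blast
  qed
  have memdom: "(r, c) \<in> ?D - ?E \<longleftrightarrow> (\<exists>j. col ?D c = {1..j}) \<and> r \<in> col ?D c" for r c
    unfolding ortho_E0_def by auto
  have domfix: "swap_rows q (?D - ?E) = ?D - ?E"
  proof (rule diagram_eqI)
    fix c
    have "col (?D - ?E) c = (if \<exists>j. col ?D c = {1..j} then col ?D c else {})"
    proof (rule set_eqI)
      fix r
      show "r \<in> col (?D - ?E) c \<longleftrightarrow> r \<in> (if \<exists>j. col ?D c = {1..j} then col ?D c else {})"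
        using memdom[of r c] unfolding mem_col[of r "?D - ?E"] by (simp only: split: if_split) blast
    qed
    then show "col (swap_rows q (?D - ?E)) c = col (?D - ?E) c"
      unfolding col_swap_rows t_def[symmetric] using int_t[of c] by simp
  qed
  have cases: "(?Ev = ?E \<and> swap_rows q ?E = ?E \<and> (\<forall>c. (q, c) \<notin> ?E \<and> (Suc q, c) \<notin> ?E))
      \<or> (?E \<noteq> {} \<and> tooth ?E = q \<and> ?Ev = ortho_step ?E)"
  proof (cases "w (Suc q) < cb")
    case True
    have rows: "(q, c) \<notin> ?E \<and> (Suc q, c) \<notin> ?E" for c
    proof -
      have "c < cb" if "(q, c) \<in> ?D \<or> (Suc q, c) \<in> ?D"
        using that q True by (auto simp: mem_rothe)
      then show ?thesis using left[of c] by (auto simp: ortho_E0_def)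
    qed
    have tE: "t ` col ?E c = col ?E c" for c
    proof -
      have "t r \<in> col ?E c \<longleftrightarrow> r \<in> col ?E c" for r
        using rows by (auto simp: t_def Transposition.transpose_def)
      then show ?thesis unfolding t_def by (auto simp: mem_transpose_image set_eq_iff)
    qed
    have "col ?Ev c = col ?E c" for c
    proof (cases "c = w q")
      case True
      then show ?thesis using colq colvq by (auto simp: col_ortho_E0)
    next
      case False
      show ?thesis
      proof (cases "\<exists>j. col ?D c = {1..j}")
        case True
        then show ?thesis using colv[OF False] int_t[OF True] by (simp add: col_ortho_E0)
      next
        case F: False
        then have "col ?E c = col ?D c" by (simp add: col_ortho_E0)
        then have "t ` col ?D c = col ?D c" using tE[of c] by simp
        then show ?thesis using colv[OF False] by (simp add: col_ortho_E0)
      qed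
    qed
    then have "?Ev = ?E" by (rule diagram_eqI)
    moreover have "swap_rows q ?E = ?E"
      by (rule diagram_eqI) (use tE in \<open>simp add: col_swap_rows t_def\<close>)
    ultimately show ?thesis using rows by blast
  next
    case False
    have ne: "?E \<noteq> {}"
      using False wr[of "Suc q"] q by (auto simp: cb_def split: if_splits)
    have lc: "lead_col ?E = cb" using ne by (simp add: cb_def)
    have cbmem: "(r, cb) \<in> ?E \<longleftrightarrow> (r, cb) \<in> ?D" for r
      using lead(1)[OF ne] mem_col by metis
    \<comment> \<open>If the value \<open>cb\<close> stood at position q+1 or earlier,
      \<open>F1\<close> would make its column closed downwards and thus an interval.\<close>
    have "Suc q < inv w cb"
    proof (rule ccontr)
      assume "\<not> Suc q < inv w cb"
      then have le: "inv w cb \<le> Suc q" by simp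
      have "\<exists>j. col ?D cb = {1..j}"
      proof (rule down_closed_eq_initial)
        show "finite (col ?D cb)" using finite_col finite_rothe by blast
        show "1 \<le> r" if "r \<in> col ?D cb" for r using that by (simp add: mem_rothe)
        show "k \<in> col ?D cb" if "r \<in> col ?D cb" "1 \<le> k" "k \<le> r" for r k
        proof -
          have r: "r < inv w cb" "cb < w r" "r \<le> n" "r \<le> q"
            using that(1) le by (auto simp: mem_rothe)
          have "\<not> w k < cb" using F1[of k r] that r by auto
          moreover have "w k \<noteq> cb" using iww[of k] r(1) that(3) by auto
          ultimately show ?thesis using that r lead(3,4)[OF ne] by (auto simp: mem_rothe)
        qed
      qed
      then show False using lead(2)[OF ne] by blast
    qed
    then have "w (Suc q) \<noteq> cb" using iww[of "Suc q"] by auto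
    then have "cb < w (Suc q)" using False by simp
    have tooth: "tooth ?E = q"
    proof (rule tooth_eqI, unfold lc cbmem)
      show "(q, cb) \<notin> ?D" using q(4) by (simp add: mem_rothe)
      show "(Suc q, cb) \<in> ?D"
        using \<open>Suc q < inv w cb\<close> \<open>cb < w (Suc q)\<close> q lead(3,4)[OF ne] by (simp add: mem_rothe)
      show "(k, cb) \<in> ?D" if "1 \<le> k" "k < q" "(Suc k, cb) \<in> ?D" for k
      proof -
        have r: "Suc k < inv w cb" "cb < w (Suc k)" using that(3) by (auto simp: mem_rothe)
        have "\<not> w k < cb" using F1[of k "Suc k"] that r by auto
        moreover have "w k \<noteq> cb" using iww[of k] r(1) by auto
        ultimately show ?thesis using that r lead(3,4)[OF ne] q(2) by (auto simp: mem_rothe)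
      qed
    qed (rule q(1))
    have step: "col (ortho_step ?E) c = (if t ` col ?E c = {1..q} then {} else t ` col ?E c)" for c
      by (simp add: col_ortho_step tooth Let_def t_def)
    have "col ?Ev c = col (ortho_step ?E) c" for c
    proof (cases "c = w q")
      case True
      then show ?thesis using colq colvq step[of c] by (auto simp: col_ortho_E0)
    next
      case F: False
      show ?thesis
      proof (cases "\<exists>j. col ?D c = {1..j}")
        case True
        then have "col ?Ev c = {}" "col ?E c = {}"
          using colv[OF F] int_t[OF True] by (simp_all add: col_ortho_E0)
        then show ?thesis by (simp add: step)
      next
        case NI: False
        have "t ` col ?D c = {1..q}" if "t ` col ?D c = {1..j}" for j
        proof (rule ccontr)
          assume "t ` col ?D c \<noteq> {1..q}"
          then have "j \<noteq> q" using that by blast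
          then have "col ?D c = {1..j}"
            using that transpose_image_atLeastAtMost[of j q] q(1) transpose_image_eq_iff
            unfolding t_def by metis
          then show False using NI by blast
        qed
        then have "(\<exists>j. t ` col ?D c = {1..j}) \<longleftrightarrow> t ` col ?D c = {1..q}" by blast
        then show ?thesis using colv[OF F] NI by (simp add: step col_ortho_E0)
      qed
    qed
    then have "?Ev = ortho_step ?E" by (rule diagram_eqI)
    then show ?thesis using ne tooth by blast
  qed
  have Evsub: "?Ev \<subseteq> swap_rows q ?E"
    using cases ortho_step_subset[of ?E] by auto
  have rc: "row_count (?Dv - ?Ev) = row_count (?D - ?E) + (var_exp q + row_count (swap_rows q ?E - ?Ev))"
  proof -
    have sub: "swap_rows q ?E \<subseteq> swap_rows q ?D"
      using ortho_E0_subset[of n w] by (auto simp: swap_rows_def)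
    have sw: "swap_rows q ?D - swap_rows q ?E = ?D - ?E"
    proof -
      have "swap_rows q ?D - swap_rows q ?E = swap_rows q (?D - ?E)"
        by (auto simp: mem_swap_rows)
      then show ?thesis by (simp add: domfix)
    qed
    have nmem: "(q, w q) \<notin> swap_rows q ?D"
      by (simp add: mem_swap_rows mem_rothe iww)
    have "?Dv - ?Ev = (?D - ?E) \<union> ({(q, w q)} \<union> (swap_rows q ?E - ?Ev))"
      using sw sub nmem Evsub unfolding Dv by blast
    moreover have "row_count ((?D - ?E) \<union> ({(q, w q)} \<union> (swap_rows q ?E - ?Ev)))
      = row_count (?D - ?E) + row_count ({(q, w q)} \<union> (swap_rows q ?E - ?Ev))"
      using sw nmem finite_rothe finite_swap_rows[OF finE] by (intro row_count_Un) auto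
    moreover have "row_count ({(q, w q)} \<union> (swap_rows q ?E - ?Ev)) = var_exp q + row_count (swap_rows q ?E - ?Ev)"
      using row_count_Un[of "{(q, w q)}" "swap_rows q ?E - ?Ev"] finite_swap_rows[OF finE] sub nmem
      by (auto simp: row_count_single)
    ultimately show ?thesis by simp
  qed
  have "row_count (?D - ?E) q = row_count (swap_rows q (?D - ?E)) (Suc q)"
    by (simp add: row_count_swap_rows)
  then have "row_count (?D - ?E) q = row_count (?D - ?E) (Suc q)"
    by (simp only: domfix)
  from that[OF q(1-3) this] rc cases show ?thesis
    unfolding v_def t_def by blast
qed

lemma rothe_w0:
  shows "ortho_E0 n (w0 n) = {}" and "row_count (rothe n (w0 n)) = (\<lambda>j. if 1 \<le> j \<and> j \<le> n then n - j else 0)"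
proof -
  have ww: "w0 n (w0 n x) = x" for x
    by (auto simp: w0_def)
  have inv: "inv (w0 n) = w0 n"
    by (rule inv_equality) (auto simp: ww)
  have mem: "(r, c) \<in> rothe n (w0 n) \<longleftrightarrow> 1 \<le> r \<and> 1 \<le> c \<and> r + c \<le> n" for r c
    unfolding mem_rothe inv by (auto simp: w0_def)
  have "\<exists>j. col (rothe n (w0 n)) c = {1..j}" for c
  proof (cases "1 \<le> c")
    case True
    then have "col (rothe n (w0 n)) c = {1..n - c}"
      by (auto simp: mem)
    then show ?thesis by blast
  next
    case False
    then have "col (rothe n (w0 n)) c = {1..0}"
      by (auto simp: mem)
    then show ?thesis by blast
  qed
  then show "ortho_E0 n (w0 n) = {}"
    by (auto simp: ortho_E0_def)
  show "row_count (rothe n (w0 n)) = (\<lambda>j. if 1 \<le> j \<and> j \<le> n then n - j else 0)"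
  proof
    fix r
    have "{c. (r, c) \<in> rothe n (w0 n)} = (if 1 \<le> r \<and> r \<le> n then {1..n - r} else {})"
      by (auto simp: mem)
    then show "row_count (rothe n (w0 n)) r = (if 1 \<le> r \<and> r \<le> n then n - r else 0)"
      by (simp add: row_count_def)
  qed
qed

text \<open>The monomial of the stripped columns is symmetric in x_q and x_(q+1), so it passes
  through the divided difference, and the box added at (q, w_q) supplies the x_q that turns
  \<partial>_q into \<pi>_q. If the surviving diagram is unchanged, \<pi>_q acts trivially by
  \<open>ortho_char_symmetric\<close>.\<close>

theorem fk_schubert_orthodontia:
  assumes "w permutes {1..n}" "ortho_char l (ortho_E0 n w) g"
  shows "fk_schubert n w = shift (row_count (rothe n w - ortho_E0 n w)) g"
  using assms
proof (induction "perm_weight n w" arbitrary: w l g rule: less_induct)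
  case less
  let ?E = "ortho_E0 n w"
  let ?a = "row_count (rothe n w - ?E)"
  show ?case
  proof (cases "?E \<noteq> {} \<or> w \<noteq> w0 n")
    case False
    then have "?E = {}" by blast
    with less.prems(2) have "ortho_char l {} g"
      by (simp only:)
    then have g: "g = const_one"
      by cases auto
    have "row_count (rothe n w - ?E) = (\<lambda>j. if 1 \<le> j \<and> j \<le> n then n - j else 0)"
      using False rothe_w0[of n] by (simp only: not_not de_Morgan_disj Diff_empty)
    then show ?thesis
      using False by (simp only: g shift_const_one not_not de_Morgan_disj fk_schubert_w0 top_mono_def)
  next
    case True
    obtain q where q: "1 \<le> q" "q < n" "w q < w (Suc q)"
      and aq: "?a q = ?a (Suc q)"
      and rc: "row_count (rothe n (w \<circ> Transposition.transpose q (Suc q)) - ortho_E0 n (w \<circ> Transposition.transpose q (Suc q)))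
      = ?a + (var_exp q + row_count (swap_rows q ?E - ortho_E0 n (w \<circ> Transposition.transpose q (Suc q))))"
      and cases: "(ortho_E0 n (w \<circ> Transposition.transpose q (Suc q)) = ?E \<and> swap_rows q ?E = ?E \<and>
        (\<forall>c. (q, c) \<notin> ?E \<and> (Suc q, c) \<notin> ?E))
      \<or> (?E \<noteq> {} \<and> tooth ?E = q \<and> ortho_E0 n (w \<circ> Transposition.transpose q (Suc q)) = ortho_step ?E)"
      by (rule ortho_E0_ascent[OF less.prems(1) True]) (rule that, assumption+)
    define v where "v = w \<circ> Transposition.transpose q (Suc q)"
    have v: "v permutes {1..n}" "perm_weight n v < perm_weight n w"
      using permutes_comp_transpose[OF less.prems(1)] perm_weight_ascent[of q n w] q by (auto simp: v_def)
    note IH = less.hyps[OF v(2,1)]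
    have key: "fk_schubert n w = shift ?a (isobaric q h)"
      if "fk_schubert n v = shift (?a + var_exp q) h" for h
    proof (rule mult_diff_inj[of q])
      have a_t: "?a \<circ> Transposition.transpose q (Suc q) = ?a"
        using aq by (auto simp: fun_eq_iff Transposition.transpose_def)
      have "mult_diff q (fk_schubert n w) = fk_schubert n v - swap_vars q (fk_schubert n v)"
        unfolding v_def by (rule mult_diff_fk_schubert[OF q])
      also have "\<dots> = shift ?a (shift (var_exp q) h) - swap_vars q (shift ?a (shift (var_exp q) h))"
        by (simp only: that shift_shift)
      also have "\<dots> = shift ?a (shift (var_exp q) h - swap_vars q (shift (var_exp q) h))"
        by (simp only: shift_diff swap_vars_shift[of q ?a] a_t)
      also have "\<dots> = mult_diff q (shift ?a (isobaric q h))"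
        by (simp only: mult_diff_shift isobaric_mult_diff)
      finally show "mult_diff q (fk_schubert n w) = mult_diff q (shift ?a (isobaric q h))" .
    qed
    from cases show ?thesis
    proof
      assume A: "ortho_E0 n (w \<circ> Transposition.transpose q (Suc q)) = ?E \<and> swap_rows q ?E = ?E \<and>
        (\<forall>c. (q, c) \<notin> ?E \<and> (Suc q, c) \<notin> ?E)"
      then have "fk_schubert n v = shift (row_count (rothe n v - ortho_E0 n v)) g"
        using IH less.prems(2) by (simp add: v_def)
      moreover have "row_count (rothe n v - ortho_E0 n v) = ?a + var_exp q"
      proof -
        have "row_count {} = 0" by (simp add: row_count_def fun_eq_iff)
        then show ?thesis using rc A by (simp add: v_def)
      qed
      ultimately have "fk_schubert n w = shift ?a (isobaric q g)"
        using key by simp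
      moreover have "swap_vars q g = g"
        using ortho_char_symmetric[OF less.prems(2) orthodontic_ortho_E0 q(1)] A by blast
      ultimately show ?thesis by (simp add: isobaric_symmetric)
    next
      assume B: "?E \<noteq> {} \<and> tooth ?E = q \<and> ortho_E0 n (w \<circ> Transposition.transpose q (Suc q)) = ortho_step ?E"
      from less.prems(2) B obtain l1 g1 where g1: "ortho_char l1 (ortho_step ?E) g1"
        and g: "g = isobaric q (shift (row_count (swap_rows q ?E - ortho_step ?E)) g1)"
        by cases auto
      have "fk_schubert n v = shift (row_count (rothe n v - ortho_E0 n v)) g1"
        using IH g1 B by (simp add: v_def)
      also have "\<dots> = shift (?a + var_exp q) (shift (row_count (swap_rows q ?E - ortho_step ?E)) g1)"
        using rc B by (simp add: v_def shift_shift add.assoc)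
      finally show ?thesis
        using key g by simp
    qed
  qed
qed

text \<open>Ascents that leave E_0 unchanged are performed until one of them makes the step;
  \<open>perm_weight\<close> bounds their number. Consequently every stage of the process has the
  Rothe shape.\<close>

lemma ortho_E0_step_exists:
  assumes "w permutes {1..n}" "ortho_E0 n w \<noteq> {}"
  shows "\<exists>v. v permutes {1..n} \<and> ortho_E0 n v = ortho_step (ortho_E0 n w)"
  using assms
proof (induction "perm_weight n w" arbitrary: w rule: less_induct)
  case less
  obtain q where q: "1 \<le> q" "q < n" "w q < w (Suc q)"
    and cases: "ortho_E0 n (w \<circ> Transposition.transpose q (Suc q)) = ortho_E0 n w
      \<or> ortho_E0 n (w \<circ> Transposition.transpose q (Suc q)) = ortho_step (ortho_E0 n w)"
    by (rule ortho_E0_ascent[OF less.prems(1) disjI1[OF less.prems(2)]]) (rule that, assumption+, blast)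
  define v where "v = w \<circ> Transposition.transpose q (Suc q)"
  have v: "v permutes {1..n}" "perm_weight n v < perm_weight n w"
    using permutes_comp_transpose[OF less.prems(1)] perm_weight_ascent[of q n w] q by (auto simp: v_def)
  from cases show ?case
  proof
    assume "ortho_E0 n (w \<circ> Transposition.transpose q (Suc q)) = ortho_E0 n w"
    then show ?thesis
      using less.hyps[OF v(2,1)] less.prems(2) by (simp add: v_def)
  next
    assume "ortho_E0 n (w \<circ> Transposition.transpose q (Suc q)) = ortho_step (ortho_E0 n w)"
    then show ?thesis using v(1) by (auto simp: v_def)
  qed
qed

text \<open>As k < r < inv w c, the absence of (k, c) means w_k \<le> c. All boxes of row k then lie
  left of c, where no box survives.\<close>

lemma ortho_E0_row_empty:
  assumes w: "w permutes {1..n}" and "ortho_E0 n w \<noteq> {}" "c = lead_col (ortho_E0 n w)"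
    and "(r, c) \<in> ortho_E0 n w" "k < r" "(k, c) \<notin> ortho_E0 n w"
  shows "(k, c') \<notin> ortho_E0 n w"
proof
  assume k: "(k, c') \<in> ortho_E0 n w"
  have D: "(r, c) \<in> rothe n w" "(k, c') \<in> rothe n w"
    using assms(4) k ortho_E0_subset by auto
  have "(k, c) \<notin> rothe n w"
    using assms(4,6) by (auto simp: ortho_E0_def)
  then have "w k \<le> c"
    using D assms(5) by (auto simp: mem_rothe)
  then have "c' < c" using D(2) by (simp add: mem_rothe)
  moreover have "finite (ortho_E0 n w)"
    using orthodontic_ortho_E0 by (simp add: orthodontic_def)
  ultimately have "col (ortho_E0 n w) c' = {}"
    using lead_col_nonempty(2) assms(2,3) by blast
  then show False using k by (metis empty_iff mem_col)
qed

section \<open>Multiplicity-free orthodontia\<close>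

definition rothe_like :: "nat \<Rightarrow> diagram \<Rightarrow> bool" where
  "rothe_like n E \<longleftrightarrow> (\<exists>w. w permutes {1..n} \<and> E = ortho_E0 n w)"

definition impact_set :: "diagram \<Rightarrow> nat set" where
  "impact_set E = {c. (Suc (tooth E), c) \<in> E}"

text \<open>A form of \<open>multiplicity_free\<close> without n and l and with steps numbered from
  0, so that later stages inherit it.\<close>

definition mult_free :: "diagram \<Rightarrow> bool" where
  "mult_free E \<longleftrightarrow> (\<forall>r s. r \<noteq> s \<longrightarrow> (ortho_step ^^ r) E \<noteq> {} \<longrightarrow> (ortho_step ^^ s) E \<noteq> {} \<longrightarrow>
     tooth ((ortho_step ^^ r) E) = tooth ((ortho_step ^^ s) E) \<longrightarrow>
     (\<exists>c. impact_set ((ortho_step ^^ r) E) = {c} \<and> impact_set ((ortho_step ^^ s) E) = {c}))"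

definition teeth :: "diagram \<Rightarrow> nat set" where
  "teeth E = {tooth ((ortho_step ^^ r) E) | r. (ortho_step ^^ r) E \<noteq> {}}"

lemma rothe_like_orthodontic: "rothe_like n E \<Longrightarrow> orthodontic E"
  by (auto simp: rothe_like_def orthodontic_ortho_E0)

lemma rothe_like_step: "rothe_like n E \<Longrightarrow> rothe_like n (ortho_step E)"
  using ortho_E0_step_exists[of _ n] unfolding rothe_like_def
  by (cases "E = {}") (fastforce simp del: atLeastAtMost_iff)+

lemma rothe_like_funpow: "rothe_like n E \<Longrightarrow> rothe_like n ((ortho_step ^^ t) E)"
  by (induction t) (auto intro: rothe_like_step)

lemma rothe_like_row_empty:
  assumes "rothe_like n E" "(r, lead_col E) \<in> E" "k < r" "(k, lead_col E) \<notin> E"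
  shows "(k, c') \<notin> E"
proof -
  obtain w where w: "w permutes {1..n}" "E = ortho_E0 n w"
    using assms(1) unfolding rothe_like_def by blast
  show ?thesis
    unfolding w(2)
    by (rule ortho_E0_row_empty[OF w(1) _ refl]) (use assms w(2) in auto)
qed

lemma funpow_ortho_step_add: "(ortho_step ^^ s) ((ortho_step ^^ t) E) = (ortho_step ^^ (t + s)) E"
  by (simp add: funpow_add add.commute[of t s])

lemma mult_free_funpow:
  assumes "mult_free E"
  shows "mult_free ((ortho_step ^^ t) E)"
  unfolding mult_free_def funpow_ortho_step_add
proof (intro allI impI)
  fix r s :: nat
  assume *: "r \<noteq> s" "(ortho_step ^^ (t + r)) E \<noteq> {}" "(ortho_step ^^ (t + s)) E \<noteq> {}"
    "tooth ((ortho_step ^^ (t + r)) E) = tooth ((ortho_step ^^ (t + s)) E)"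
  then have "t + r \<noteq> t + s" by simp
  with * show "\<exists>c. impact_set ((ortho_step ^^ (t + r)) E) = {c} \<and> impact_set ((ortho_step ^^ (t + s)) E) = {c}"
    using assms unfolding mult_free_def by blast
qed

lemma teeth_funpow_subset: "teeth ((ortho_step ^^ t) E) \<subseteq> teeth E"
  unfolding teeth_def funpow_ortho_step_add by blast

lemma teeth_step:
  assumes "E \<noteq> {}"
  shows "teeth E = insert (tooth E) (teeth (ortho_step E))"
proof
  show "insert (tooth E) (teeth (ortho_step E)) \<subseteq> teeth E"
  proof -
    have "tooth ((ortho_step ^^ 0) E) \<in> teeth E"
      unfolding teeth_def using assms by (intro CollectI exI[of _ 0]) simp
    then show ?thesis using teeth_funpow_subset[of 1 E] by simp
  qed
  show "teeth E \<subseteq> insert (tooth E) (teeth (ortho_step E))"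
  proof
    fix j assume "j \<in> teeth E"
    then obtain r where r: "j = tooth ((ortho_step ^^ r) E)" "(ortho_step ^^ r) E \<noteq> {}"
      unfolding teeth_def by blast
    show "j \<in> insert (tooth E) (teeth (ortho_step E))"
    proof (cases r)
      case 0
      then show ?thesis using r by simp
    next
      case (Suc r')
      then have "j = tooth ((ortho_step ^^ r') (ortho_step E))" "(ortho_step ^^ r') (ortho_step E) \<noteq> {}"
        using r by (simp_all add: funpow_swap1)
      then show ?thesis unfolding teeth_def by blast
    qed
  qed
qed

lemma col_ortho_step_empty: "col E c = {} \<Longrightarrow> col (ortho_step E) c = {}"
  by (simp add: col_ortho_step Let_def)

lemma lead_col_ortho_step:
  assumes "orthodontic E" "E \<noteq> {}" "col (ortho_step E) (lead_col E) \<noteq> {}"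
  shows "lead_col (ortho_step E) = lead_col E"
proof (rule lead_col_eqI[OF _ assms(3)])
  show "finite (ortho_step E)"
    using orthodontic_step[OF assms(1,2)] by (simp add: orthodontic_def)
  show "col (ortho_step E) c' = {}" if "c' < lead_col E" for c'
    using assms(1,2) lead_col_nonempty(2)[OF _ assms(2) that] col_ortho_step_empty
    unfolding orthodontic_def by blast
qed

lemma mem_ortho_step:
  assumes "(Transposition.transpose (tooth E) (Suc (tooth E)) r, c) \<in> E"
    and "Transposition.transpose (tooth E) (Suc (tooth E)) ` col E c \<noteq> {1..tooth E}"
  shows "(r, c) \<in> ortho_step E"
proof -
  have "r \<in> col (ortho_step E) c"
    unfolding col_ortho_step Let_def if_not_P[OF assms(2)] mem_transpose_image using assms(1) by simp
  then show ?thesis by simp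
qed

text \<open>The cardinality in the conclusion identifies the box of the leading column that crosses the
  tooth $j$, so different boxes cross it at different times.\<close>

lemma lead_box_hits_tooth:
  assumes "(ortho_step ^^ l) E = {}" "rothe_like n E" "E \<noteq> {}" "(\<rho>, lead_col E) \<in> E" "(\<rho>, c') \<in> E"
    and "card (col E (lead_col E) \<inter> {1..\<rho>}) \<le> j" "j < \<rho>"
  shows "\<exists>s. (ortho_step ^^ s) E \<noteq> {} \<and> lead_col ((ortho_step ^^ s) E) = lead_col E
     \<and> tooth ((ortho_step ^^ s) E) = j \<and> (Suc j, c') \<in> (ortho_step ^^ s) E
     \<and> card (col ((ortho_step ^^ s) E) (lead_col E) \<inter> {1..Suc j}) = card (col E (lead_col E) \<inter> {1..\<rho>})"
  using assms
proof (induction l arbitrary: E \<rho>)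
  case 0
  then show ?case by simp
next
  case (Suc l)
  define c where "c = lead_col E"
  define i where "i = tooth E"
  define C where "C = col E c"
  let ?t = "Transposition.transpose i (Suc i)"
  let ?E1 = "ortho_step E"
  have orth: "orthodontic E" using Suc.prems(2) by (rule rothe_like_orthodontic)
  note i = tooth_props[OF orth Suc.prems(3), folded i_def c_def]
  have l1: "(ortho_step ^^ l) ?E1 = {}"
    using Suc.prems(1) by (simp add: funpow_swap1)
  have rl1: "rothe_like n ?E1" using Suc.prems(2) by (rule rothe_like_step)
  have rec: "?case" if r1: "(\<rho>1, c) \<in> ?E1" "(\<rho>1, c') \<in> ?E1" "j < \<rho>1"
    and card1: "card (col ?E1 c \<inter> {1..\<rho>1}) = card (C \<inter> {1..\<rho>})" for \<rho>1
  proof -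
    have ne1: "?E1 \<noteq> {}" "col ?E1 c \<noteq> {}"
      using r1(1) mem_col by blast+
    have lead1: "lead_col ?E1 = c"
      using lead_col_ortho_step[OF orth Suc.prems(3)] ne1(2) by (simp add: c_def)
    have "card (col ?E1 (lead_col ?E1) \<inter> {1..\<rho>1}) \<le> j"
      using card1 Suc.prems(6) lead1 by (simp only: C_def c_def)
    then obtain s where "(ortho_step ^^ s) ?E1 \<noteq> {} \<and> lead_col ((ortho_step ^^ s) ?E1) = lead_col ?E1
     \<and> tooth ((ortho_step ^^ s) ?E1) = j \<and> (Suc j, c') \<in> (ortho_step ^^ s) ?E1
     \<and> card (col ((ortho_step ^^ s) ?E1) (lead_col ?E1) \<inter> {1..Suc j}) = card (col ?E1 (lead_col ?E1) \<inter> {1..\<rho>1})"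
      using Suc.IH[OF l1 rl1 ne1(1), of \<rho>1] r1 lead1 by blast
    then show ?thesis
      using card1 unfolding lead1 C_def c_def
      by (intro exI[of _ "Suc s"]) (simp add: funpow_swap1)
  qed
  have cC: "card (C \<inter> {1..\<rho>}) \<le> j" using Suc.prems(6) by (simp only: C_def c_def)
  have memC: "r \<in> C \<longleftrightarrow> (r, c) \<in> E" for r by (simp add: C_def)
  show ?case
  proof (cases "\<rho> = Suc i")
    case True
    show ?thesis
    proof (cases "j = i")
      case True
      then show ?thesis
        using Suc.prems \<open>\<rho> = Suc i\<close> by (intro exI[of _ 0]) (simp add: i_def)
    next
      case False
      then have ji: "j < i" using Suc.prems(7) True by simp
      have ct: "card (?t ` C \<inter> {1..i}) = card (C \<inter> {1..\<rho>})"
      proof -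
        have "Suc i \<notin> ?t ` C"
          using i(2) memC unfolding mem_transpose_image by simp
        then have "card (?t ` C \<inter> {1..Suc i}) = card (?t ` C \<inter> {1..i})"
          using card_Int_Suc[of "?t ` C" i] by simp
        then show ?thesis
          using card_transpose_image_Int[of "Suc i" i C] i(1) True by simp
      qed
      have nint: "?t ` C \<noteq> {1..i}"
      proof
        assume "?t ` C = {1..i}"
        then have "card (?t ` C \<inter> {1..i}) = i" by simp
        then show False using ct cC ji by simp
      qed
      \<comment> \<open>The bound on the count leaves a gap in C above row i. That entire row is
        empty by \<open>rothe_like_row_empty\<close>, so column c' is not completed to [i] either
        and its box survives the step.\<close>
      have "\<not> {1..i - 1} \<subseteq> C"
      proof
        assume "{1..i - 1} \<subseteq> C"
        moreover have "Suc i \<in> C" using i(3) memC by simp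
        ultimately have "insert (Suc i) {1..i - 1} \<subseteq> C \<inter> {1..\<rho>}"
          using True by auto
        then have "card (insert (Suc i) {1..i - 1}) \<le> card (C \<inter> {1..\<rho>})"
          by (intro card_mono) auto
        then show False using cC ji i(1) by simp
      qed
      then obtain k where "k \<in> {1..i - 1}" "k \<notin> C" by blast
      then have k: "1 \<le> k" "k < i" "k \<notin> C"
        using i(1) by auto
      have "(k, c') \<notin> E"
        using rothe_like_row_empty[OF Suc.prems(2,4), of k] k True memC by (simp add: c_def)
      then have "k \<notin> ?t ` col E c'"
        using k unfolding mem_transpose_image by (simp add: Transposition.transpose_def)
      then have nint': "?t ` col E c' \<noteq> {1..i}"
        using k by auto
      have m: "(i, c) \<in> ?E1" "(i, c') \<in> ?E1"
        using mem_ortho_step[of E i, folded i_def] nint nint' i(3) Suc.prems(5) True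
        by (simp_all add: C_def)
      have "col ?E1 c = ?t ` C"
        using nint by (simp add: col_ortho_step Let_def i_def C_def)
      then show ?thesis
        using rec[OF m ji] ct by simp
    qed
  next
    case False
    have "\<rho> \<noteq> i" using Suc.prems(4) i(2) by (auto simp: c_def)
    \<comment> \<open>Above the tooth the column is an initial interval, where the count up to
      \<rho> would be \<rho> itself and exceed j.\<close>
    have "Suc i < \<rho>"
    proof (rule ccontr)
      assume "\<not> Suc i < \<rho>"
      then have "\<rho> \<le> i" using False \<open>\<rho> \<noteq> i\<close> by simp
      then have "{1..\<rho>} \<subseteq> C"
        using initial_below_tooth[OF orth Suc.prems(3,4)] memC by (auto simp: i_def c_def)
      then have "C \<inter> {1..\<rho>} = {1..\<rho>}" by blast
      then show False using cC Suc.prems(7) by simp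
    qed
    then have t\<rho>: "?t \<rho> = \<rho>" by (simp add: Transposition.transpose_def)
    have nint: "?t ` col E x \<noteq> {1..i}" if "(\<rho>, x) \<in> E" for x
    proof
      assume "?t ` col E x = {1..i}"
      moreover have "\<rho> \<in> ?t ` col E x" unfolding mem_transpose_image t\<rho> using that by simp
      ultimately show False using \<open>Suc i < \<rho>\<close> by simp
    qed
    have m: "(\<rho>, x) \<in> ?E1" if "(\<rho>, x) \<in> E" for x
      using mem_ortho_step[of E \<rho> x, folded i_def] nint[OF that] that t\<rho> by simp
    have "col ?E1 c = ?t ` C"
      using nint[of c] Suc.prems(4) by (simp add: col_ortho_step Let_def i_def C_def c_def)
    then have "card (col ?E1 c \<inter> {1..\<rho>}) = card (C \<inter> {1..\<rho>})"
      using card_transpose_image_Int[OF \<open>\<rho> \<noteq> i\<close> i(1)] by simp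
    then show ?thesis
      using rec[OF m m] Suc.prems(4,5,7) by (simp add: c_def)
  qed
qed

section \<open>Consequences of repeated teeth\<close>

lemma lead_col_in_impact_set:
  assumes "orthodontic E" "E \<noteq> {}"
  shows "lead_col E \<in> impact_set E"
  using tooth_props(3)[OF assms] by (simp add: impact_set_def)

text \<open>As long as column c is nonempty it is the leading one, because the columns to its left
  stay empty; so only swaps at its own teeth matter. Once empty it stays empty.\<close>

lemma lead_col_invariant:
  assumes "orthodontic E" "\<And>c'. c' < c \<Longrightarrow> col E c' = {}" "P (col E c)" "P {}"
    and step: "\<And>F. orthodontic F \<Longrightarrow> F \<noteq> {} \<Longrightarrow> lead_col F = c \<Longrightarrow> P (col F c) \<Longrightarrow>
      P (Transposition.transpose (tooth F) (Suc (tooth F)) ` col F c)"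
  shows "orthodontic ((ortho_step ^^ s) E) \<and> (\<forall>c'<c. col ((ortho_step ^^ s) E) c' = {}) \<and> P (col ((ortho_step ^^ s) E) c)"
proof (induction s)
  case 0
  then show ?case using assms by simp
next
  case (Suc s)
  let ?F = "(ortho_step ^^ s) E"
  show ?case
  proof (cases "?F = {}")
    case True
    then show ?thesis using Suc.IH by simp
  next
    case False
    have orth: "orthodontic (ortho_step ?F)" using orthodontic_step False Suc.IH by blast
    have left: "\<forall>c'<c. col (ortho_step ?F) c' = {}"
      using Suc.IH col_ortho_step_empty by blast
    have "P (col (ortho_step ?F) c)"
    proof (cases "col ?F c = {}")
      case True
      then show ?thesis using col_ortho_step_empty assms(4) by simp
    next
      case F: False
      have "lead_col ?F = c"
        using Suc.IH F by (intro lead_col_eqI) (auto simp: orthodontic_def)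
      then have "P (Transposition.transpose (tooth ?F) (Suc (tooth ?F)) ` col ?F c)"
        using step False Suc.IH by blast
      then show ?thesis using assms(4) by (simp add: col_ortho_step Let_def)
    qed
    then show ?thesis using orth left by simp
  qed
qed

text \<open>At a recurrence the impact would again be \<open>{c}\<close>, so i would be a tooth of
  the same column c. But after the swap that column either contains [i], and its later teeth exceed
  i, or is contained in [i], and its later teeth are smaller than i.\<close>

lemma tooth_not_repeated:
  assumes orth: "orthodontic E" and ne: "E \<noteq> {}" and mf: "mult_free E"
    and alt: "{1..tooth E - 1} \<subseteq> col E (lead_col E) \<or> col E (lead_col E) \<subseteq> {1..Suc (tooth E)}"
  shows "tooth E \<notin> teeth (ortho_step E)"
proof
  define i where "i = tooth E"
  define c where "c = lead_col E"
  let ?t = "Transposition.transpose i (Suc i)"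
  note i = tooth_props[OF orth ne, folded i_def c_def]
  assume "tooth E \<in> teeth (ortho_step E)"
  then obtain s where s: "i = tooth ((ortho_step ^^ s) (ortho_step E))" "(ortho_step ^^ s) (ortho_step E) \<noteq> {}"
    unfolding teeth_def i_def by blast
  let ?F = "(ortho_step ^^ s) (ortho_step E)"
  have F: "?F = (ortho_step ^^ Suc s) E" by (simp add: funpow_swap1)
  obtain c0 where "impact_set E = {c0}" and F0: "impact_set ?F = {c0}"
    using mf[unfolded mult_free_def, rule_format, of 0 "Suc s"] ne s unfolding F[symmetric] i_def by auto
  then have c0: "c0 = c"
    using lead_col_in_impact_set[OF orth ne] by (simp add: c_def)
  have orth1: "orthodontic (ortho_step E)" using orthodontic_step orth ne by blast
  have fin: "finite E" using orth by (simp add: orthodontic_def)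
  have left1: "col (ortho_step E) c' = {}" if "c' < c" for c'
    using lead_col_nonempty(2)[OF fin ne] that col_ortho_step_empty by (simp add: c_def)
  have col1: "col (ortho_step E) c = {} \<or> col (ortho_step E) c = ?t ` col E c"
    by (simp add: col_ortho_step Let_def i_def)
  have orthF: "orthodontic ?F"
    using lead_col_invariant[of "ortho_step E" c "\<lambda>_. True" s] orth1 left1 by simp
  have leadF: "lead_col ?F = c"
    using lead_col_in_impact_set[OF orthF s(2)] F0 c0 by simp
  note tF = tooth_props[OF orthF s(2), folded s(1), unfolded leadF]
  from alt show False
  proof
    assume a: "{1..tooth E - 1} \<subseteq> col E (lead_col E)"
    let ?P = "\<lambda>C. C = {} \<or> {1..i} \<subseteq> C"
    have base: "?P (col (ortho_step E) c)"
    proof -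
      have "{1..i} \<subseteq> ?t ` col E c"
      proof
        fix r assume r: "r \<in> {1..i}"
        show "r \<in> ?t ` col E c"
        proof (cases "r = i")
          case True
          then show ?thesis using i(3) unfolding mem_transpose_image by simp
        next
          case False
          then have "r \<in> {1..tooth E - 1}" "?t r = r"
            using r by (auto simp: i_def Transposition.transpose_def)
          then show ?thesis using a unfolding mem_transpose_image c_def by auto
        qed
      qed
      then show ?thesis using col1 by auto
    qed
    have inv: "?P (Transposition.transpose (tooth G) (Suc (tooth G)) ` col G c)"
      if G: "orthodontic G" "G \<noteq> {}" "lead_col G = c" "?P (col G c)" for G
    proof -
      note tG = tooth_props[OF G(1,2), unfolded G(3)]
      have sub: "{1..i} \<subseteq> col G c" using G(4) tG(3) by auto
      then have "i < tooth G" using tG(1,2) by (auto simp: subset_iff not_less[symmetric])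
      then have "{1..i} \<subseteq> Transposition.transpose (tooth G) (Suc (tooth G)) ` col G c"
        using sub by (auto simp: mem_transpose_image subset_iff Transposition.transpose_def)
      then show "?P (Transposition.transpose (tooth G) (Suc (tooth G)) ` col G c)" by blast
    qed
    have "?P (col ?F c)"
      using lead_col_invariant[of "ortho_step E" c ?P s, OF orth1 left1 base _ inv] by blast
    then show False using tF(1,2,3) by auto
  next
    assume a: "col E (lead_col E) \<subseteq> {1..Suc (tooth E)}"
    let ?P = "\<lambda>C. C \<subseteq> {1..i}"
    have base: "?P (col (ortho_step E) c)"
    proof -
      have "?t ` col E c \<subseteq> {1..i}"
      proof
        fix r assume "r \<in> ?t ` col E c"
        then have "?t r \<in> col E c" unfolding mem_transpose_image .
        then have "?t r \<in> {1..Suc i}" "?t r \<noteq> i"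
          using a i(2) by (auto simp: i_def c_def)
        then show "r \<in> {1..i}" using i(1) by (auto simp: Transposition.transpose_def split: if_splits)
      qed
      then show ?thesis using col1 by auto
    qed
    have inv: "?P (Transposition.transpose (tooth G) (Suc (tooth G)) ` col G c)"
      if G: "orthodontic G" "G \<noteq> {}" "lead_col G = c" "?P (col G c)" for G
    proof -
      note tG = tooth_props[OF G(1,2), unfolded G(3)]
      have ti: "tooth G < i" using G(4) tG(3) by (auto simp: subset_iff)
      show "?P (Transposition.transpose (tooth G) (Suc (tooth G)) ` col G c)"
      proof
        fix r assume "r \<in> Transposition.transpose (tooth G) (Suc (tooth G)) ` col G c"
        then have "Transposition.transpose (tooth G) (Suc (tooth G)) r \<in> {1..i}"
          using G(4) unfolding mem_transpose_image by blast
        then show "r \<in> {1..i}" using ti tG(1) by (auto simp: Transposition.transpose_def split: if_splits)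
      qed
    qed
    have "?P (col ?F c)"
      using lead_col_invariant[of "ortho_step E" c ?P s, OF orth1 left1 base _ inv] by blast
    then show False using tF(3) by auto
  qed
qed


lemma consecutive_elements:
  fixes C :: "nat set"
  assumes "finite C" "r \<in> C" "x \<in> C" "x < r" "\<And>y. y \<in> C \<Longrightarrow> 1 \<le> y"
  obtains y where "y \<in> C" "x \<le> y" "y < r" "card (C \<inter> {1..r}) = Suc (card (C \<inter> {1..y}))"
proof -
  let ?A = "{y \<in> C. y < r}"
  have fin: "finite ?A" and ne: "?A \<noteq> {}" using assms by auto
  define y where "y = Max ?A"
  have y: "y \<in> C" "y < r" using Max_in[OF fin ne] by (auto simp: y_def)
  have "x \<le> y" using Max_ge[OF fin, of x] assms by (simp add: y_def)
  have "z \<le> y" if "z \<in> C" "z < r" for z using Max_ge[OF fin, of z] that by (simp add: y_def)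
  then have "C \<inter> {1..r} = insert r (C \<inter> {1..y})"
    using assms(2,5) y by (auto simp: le_less)
  then have "card (C \<inter> {1..r}) = Suc (card (C \<inter> {1..y}))"
    using y(2) by simp
  then show ?thesis using that y \<open>x \<le> y\<close> by blast
qed

lemma next_element:
  fixes C :: "nat set"
  assumes "x \<in> C" "j < x"
  obtains r where "r \<in> C" "j < r" "r \<le> x" "card (C \<inter> {1..r}) = Suc (card (C \<inter> {1..j}))"
proof -
  define r where "r = (LEAST r. r \<in> C \<and> j < r)"
  have r: "r \<in> C" "j < r" using LeastI[of "\<lambda>r. r \<in> C \<and> j < r" x] assms by (auto simp: r_def)
  have le: "r \<le> z" if "z \<in> C" "j < z" for z
    using Least_le[of "\<lambda>r. r \<in> C \<and> j < r" z] that by (simp add: r_def)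
  have "C \<inter> {1..r} = insert r (C \<inter> {1..j})"
  proof (rule set_eqI)
    fix z
    show "z \<in> C \<inter> {1..r} \<longleftrightarrow> z \<in> insert r (C \<inter> {1..j})"
      using r le[of z] by (cases "j < z") auto
  qed
  then have "card (C \<inter> {1..r}) = Suc (card (C \<inter> {1..j}))"
    using r(2) by simp
  then show ?thesis using that r le assms by blast
qed

text \<open>Rows i-1 and i are gaps of C, so a box beyond them still has to rise by at least two
  rows. Hence two consecutive boxes both cross the tooth j, where j is the final row of the second
  one. They do so at different times, so both impacts are \<open>{c}\<close>; a box of another
  column in either row would be carried along and appear in an impact.\<close>

lemma lead_col_rows_isolated:
  assumes fin: "(ortho_step ^^ l) E = {}" and rl: "rothe_like n E" and ne: "E \<noteq> {}" and mf: "mult_free E"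
    and c: "c = lead_col E" and gap: "2 \<le> tooth E" "(tooth E - 1, c) \<notin> E"
    and more: "(x, c) \<in> E" "Suc (tooth E) < x"
    and r: "(r, c) \<in> E" "tooth E < r" "(r, c') \<in> E"
  shows "c' = c"
proof -
  define i where "i = tooth E"
  define C where "C = col E c"
  have memC: "y \<in> C \<longleftrightarrow> (y, c) \<in> E" for y by (simp add: C_def)
  have hit: "\<exists>s. (ortho_step ^^ s) E \<noteq> {} \<and> lead_col ((ortho_step ^^ s) E) = c
     \<and> tooth ((ortho_step ^^ s) E) = j \<and> (Suc j, d) \<in> (ortho_step ^^ s) E
     \<and> card (col ((ortho_step ^^ s) E) c \<inter> {1..Suc j}) = card (C \<inter> {1..y})"
    if "y \<in> C" "(y, d) \<in> E" "card (C \<inter> {1..y}) \<le> j" "j < y" for y d j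
    using lead_box_hits_tooth[OF fin rl ne, of y d j] that unfolding C_def c by simp
  have orth: "orthodontic E" using rl by (rule rothe_like_orthodontic)
  note i = tooth_props[OF orth ne, folded i_def c]
  have finC: "finite C" using orth finite_col by (simp add: orthodontic_def C_def)
  have pos: "1 \<le> y" if "y \<in> C" for y using that orth unfolding orthodontic_def C_def by (metis mem_col)
  have small: "card (C \<inter> {1..y}) + 2 \<le> y" if "i < y" for y
  proof -
    have "C \<inter> {1..y} \<subseteq> {1..y} - {i - 1, i}"
      using gap i(2) memC by (auto simp: i_def)
    then have "card (C \<inter> {1..y}) \<le> card ({1..y} - {i - 1, i})"
      by (intro card_mono) auto
    also have "card ({1..y} - {i - 1, i}) = y - 2"
    proof -
      have "{i - 1, i} \<subseteq> {1..y}" "card {i - 1, i} = 2"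
        using gap that by (auto simp: i_def)
      then show ?thesis by (simp add: card_Diff_subset)
    qed
    finally show ?thesis using that gap by (simp add: i_def)
  qed
  have main: False
    if "y1 \<in> C" "i < y1" "y2 \<in> C" "y1 < y2" "card (C \<inter> {1..y2}) = Suc (card (C \<inter> {1..y1}))"
      and cc: "(y1, d1) \<in> E" "(y2, d2) \<in> E" "d1 \<noteq> c \<or> d2 \<noteq> c" for y1 y2 d1 d2
  proof -
    define j where "j = card (C \<inter> {1..y2})"
    have "j < y1" "j < y2" using small[OF \<open>i < y1\<close>] that(4,5) by (simp_all add: j_def)
    have le: "card (C \<inter> {1..y1}) \<le> j" "card (C \<inter> {1..y2}) \<le> j"
      using that(5) by (simp_all add: j_def)
    obtain s1 where s1: "(ortho_step ^^ s1) E \<noteq> {}" "lead_col ((ortho_step ^^ s1) E) = c"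
      "tooth ((ortho_step ^^ s1) E) = j" "(Suc j, d1) \<in> (ortho_step ^^ s1) E"
      "card (col ((ortho_step ^^ s1) E) c \<inter> {1..Suc j}) = card (C \<inter> {1..y1})"
      using hit[OF \<open>y1 \<in> C\<close> cc(1) le(1) \<open>j < y1\<close>] by blast
    obtain s2 where s2: "(ortho_step ^^ s2) E \<noteq> {}" "lead_col ((ortho_step ^^ s2) E) = c"
      "tooth ((ortho_step ^^ s2) E) = j" "(Suc j, d2) \<in> (ortho_step ^^ s2) E"
      "card (col ((ortho_step ^^ s2) E) c \<inter> {1..Suc j}) = card (C \<inter> {1..y2})"
      using hit[OF \<open>y2 \<in> C\<close> cc(2) le(2) \<open>j < y2\<close>] by blast
    have "s1 \<noteq> s2" using s1(5) s2(5) that(5) by auto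
    then obtain c0 where c0: "impact_set ((ortho_step ^^ s1) E) = {c0}" "impact_set ((ortho_step ^^ s2) E) = {c0}"
      using mf[unfolded mult_free_def, rule_format, of s1 s2] s1 s2 by auto
    have "c \<in> impact_set ((ortho_step ^^ s1) E)"
      using lead_col_in_impact_set[OF rothe_like_orthodontic[OF rothe_like_funpow[OF rl]] s1(1)] s1(2) by simp
    moreover have "d1 \<in> impact_set ((ortho_step ^^ s1) E)" "d2 \<in> impact_set ((ortho_step ^^ s2) E)"
      using s1 s2 by (simp_all add: impact_set_def)
    ultimately show False using c0 cc(3) by auto
  qed
  show ?thesis
  proof (rule ccontr)
    assume "c' \<noteq> c"
    show False
    proof (cases "\<exists>y\<in>C. r < y")
      case True
      then obtain y where "y \<in> C" "r < y" by blast
      then obtain y2 where "y2 \<in> C" "r < y2" "card (C \<inter> {1..y2}) = Suc (card (C \<inter> {1..r}))"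
        using next_element by metis
      then show False
        using main[of r y2 c' c] r memC \<open>c' \<noteq> c\<close> by (simp add: i_def)
    next
      case False
      have "Suc i \<in> C" using i(3) memC by simp
      \<comment> \<open>Here r is the last box of C. The box x ensures that it has a predecessor in
        a row beyond i, with which it can be paired.\<close>
      moreover have "Suc i < r"
      proof -
        have "x \<in> C" using more(1) memC by simp
        then have "x \<le> r" using False by (meson not_le)
        then show ?thesis using more(2) by (simp add: i_def)
      qed
      ultimately obtain y1 where "y1 \<in> C" "Suc i \<le> y1" "y1 < r" "card (C \<inter> {1..r}) = Suc (card (C \<inter> {1..y1}))"
        using consecutive_elements[OF finC, of r "Suc i"] r memC pos by metis
      then show False
        using main[of y1 r c c'] r memC \<open>c' \<noteq> c\<close> by simp
    qed
  qed
qed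

text \<open>\<open>T\<close> collects the indices where partial sums may differ between the
  monomials of g; it will be the set of teeth.\<close>

definition fixed_sums :: "nat set \<Rightarrow> ipoly \<Rightarrow> bool" where
  "fixed_sums T g \<longleftrightarrow> (\<exists>\<beta>. \<forall>b. g b \<noteq> 0 \<longrightarrow> (\<forall>j. j \<notin> T \<longrightarrow> (\<Sum>k\<le>j. b k) = (\<beta> j :: nat)))"

definition unit_coeffs :: "ipoly \<Rightarrow> bool" where
  "unit_coeffs g \<longleftrightarrow> (\<forall>b. g b \<in> {-1, 0, 1})"

text \<open>The nonzero value is named independently of A: sums of f over two different sets both
  lie in \<open>{0, z}\<close> with the same z, which controls the difference occurring in
  \<open>isobaric\<close>.\<close>

lemma sum_at_most_one_nonzero:
  fixes f :: "'a \<Rightarrow> int"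
  assumes "finite A" "\<And>x y. f x \<noteq> 0 \<Longrightarrow> f y \<noteq> 0 \<Longrightarrow> x = y"
  shows "sum f A = (if \<exists>x\<in>A. f x \<noteq> 0 then f (THE x. f x \<noteq> 0) else 0)"
proof (cases "\<exists>x\<in>A. f x \<noteq> 0")
  case True
  then obtain x where x: "x \<in> A" "f x \<noteq> 0" by blast
  then have the: "(THE x. f x \<noteq> 0) = x" using assms(2) by blast
  have "sum f A = sum f {x}"
    using assms x by (intro sum.mono_neutral_right) auto
  then show ?thesis using True by (simp add: the)
qed simp

lemma unit_coeffs_shift: "unit_coeffs g \<Longrightarrow> unit_coeffs (shift a g)"
  by (simp add: unit_coeffs_def shift_def)

lemma fixed_sums_shift:
  assumes "fixed_sums T g"
  shows "fixed_sums T (shift a g)"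
proof -
  obtain \<beta> where \<beta>: "\<And>b j. g b \<noteq> 0 \<Longrightarrow> j \<notin> T \<Longrightarrow> (\<Sum>k\<le>j. b k) = \<beta> j"
    using assms unfolding fixed_sums_def by blast
  have "(\<Sum>k\<le>j. b k) = \<beta> j + (\<Sum>k\<le>j. a k)" if "shift a g b \<noteq> 0" "j \<notin> T" for b j
  proof -
    have ab: "a \<le> b" "g (b - a) \<noteq> 0" using that(1) by (auto simp: shift_def split: if_splits)
    have "(\<Sum>k\<le>j. b k) = (\<Sum>k\<le>j. (b - a) k + a k)"
      using ab(1) by (intro sum.cong) (auto simp: le_fun_def)
    then show ?thesis using \<beta>[OF ab(2) that(2)] by (simp add: sum.distrib)
  qed
  then show ?thesis unfolding fixed_sums_def by (intro exI[of _ "\<lambda>j. \<beta> j + (\<Sum>k\<le>j. a k)"]) blast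
qed

text \<open>Along an i-string the partial sum up to i is a constant plus the exponent of x_i. Since
  i \<notin> T prescribes this sum, that exponent is determined.\<close>

lemma isobaric_unit_coeffs:
  assumes "unit_coeffs h" "fixed_sums T h" "i \<notin> T"
  shows "unit_coeffs (isobaric i h)"
  unfolding unit_coeffs_def
proof
  fix b :: mono
  obtain \<beta> where \<beta>: "\<And>b j. h b \<noteq> 0 \<Longrightarrow> j \<notin> T \<Longrightarrow> (\<Sum>k\<le>j. b k) = \<beta> j"
    using assms(2) unfolding fixed_sums_def by blast
  define N where "N = b i + b (Suc i)"
  define f where "f a = h (b(i := a, Suc i := N - a))" for a
  have uniq: "x = y" if "f x \<noteq> 0" "f y \<noteq> 0" for x y
  proof -
    have "(\<Sum>k\<le>i. (b(i := a, Suc i := N - a)) k) = (\<Sum>k<i. b k) + a" for a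
    proof -
      have "(\<Sum>k\<le>i. (b(i := a, Suc i := N - a)) k) = (\<Sum>k<i. (b(i := a, Suc i := N - a)) k) + a"
        by (simp add: lessThan_Suc_atMost[symmetric])
      also have "(\<Sum>k<i. (b(i := a, Suc i := N - a)) k) = (\<Sum>k<i. b k)"
        by (rule sum.cong) auto
      finally show ?thesis .
    qed
    then have "(\<Sum>k<i. b k) + x = \<beta> i" "(\<Sum>k<i. b k) + y = \<beta> i"
      using \<beta>[OF that(1)[unfolded f_def] assms(3)] \<beta>[OF that(2)[unfolded f_def] assms(3)] by simp_all
    then show ?thesis by simp
  qed
  define z where "z = f (THE x. f x \<noteq> 0)"
  have sums: "sum f A \<in> {0, z}" if "finite A" for A
    using sum_at_most_one_nonzero[OF that uniq] by (simp add: z_def)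
  have "isobaric i h b = sum f {b i..N} - sum f {..<b (Suc i)}"
    by (simp add: isobaric_def Let_def N_def f_def)
  moreover have "z \<in> {-1, 0, 1}"
    using assms(1) by (simp add: z_def f_def unit_coeffs_def)
  then have "sum f {b i..N} - sum f {..<b (Suc i)} \<in> {-1, 0, 1}"
    using sums[OF finite_atLeastAtMost, of "b i" N] sums[OF finite_lessThan, of "b (Suc i)"] by auto
  ultimately show "isobaric i h b \<in> {-1, 0, 1}" by simp
qed

lemma isobaric_fixed_sums:
  assumes "fixed_sums T h"
  shows "fixed_sums (insert i T) (isobaric i h)"
proof -
  obtain \<beta> where \<beta>: "\<And>b j. h b \<noteq> 0 \<Longrightarrow> j \<notin> T \<Longrightarrow> (\<Sum>k\<le>j. b k) = \<beta> j"
    using assms unfolding fixed_sums_def by blast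
  have "(\<Sum>k\<le>j. b k) = \<beta> j" if nz: "isobaric i h b \<noteq> 0" and j: "j \<notin> insert i T" for b j
  proof -
    define N where "N = b i + b (Suc i)"
    define f where "f a = h (b(i := a, Suc i := N - a))" for a
    have "isobaric i h b = sum f {b i..N} - sum f {..<b (Suc i)}"
      by (simp add: isobaric_def Let_def N_def f_def)
    then have "sum f {b i..N} \<noteq> 0 \<or> sum f {..<b (Suc i)} \<noteq> 0" using nz by auto
    then have "\<exists>a\<in>{b i..N} \<union> {..<b (Suc i)}. f a \<noteq> 0"
      by (meson UnI1 UnI2 sum.not_neutral_contains_not_neutral)
    then obtain a where "a \<in> {b i..N} \<union> {..<b (Suc i)}" "f a \<noteq> 0" by blast
    then have a: "a \<le> N" "f a \<noteq> 0" by (auto simp: N_def)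
    let ?b = "b(i := a, Suc i := N - a)"
    have "(\<Sum>k\<le>j. ?b k) = (\<Sum>k\<le>j. b k)"
    proof (cases "j < i")
      case True
      then show ?thesis by (intro sum.cong) auto
    next
      case False
      then have "Suc i \<le> j" using j by auto
      then have "{..j} = insert i (insert (Suc i) ({..j} - {i, Suc i}))" by auto
      then have split: "(\<Sum>k\<le>j. g k) = g i + (g (Suc i) + (\<Sum>k\<in>{..j} - {i, Suc i}. g k))" for g :: mono
        by (metis (no_types, lifting) Diff_iff finite_Diff finite_atMost finite_insert insertI1 insert_iff n_not_Suc_n sum.insert)
      have "(\<Sum>k\<in>{..j} - {i, Suc i}. ?b k) = (\<Sum>k\<in>{..j} - {i, Suc i}. b k)"
        by (rule sum.cong) auto
      then show ?thesis unfolding split using a(1) by (simp add: N_def)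
    qed
    moreover have "(\<Sum>k\<le>j. ?b k) = \<beta> j"
      using \<beta>[of ?b j] a(2) j by (simp add: f_def)
    ultimately show ?thesis by simp
  qed
  then show ?thesis unfolding fixed_sums_def by (intro exI[of _ \<beta>]) blast
qed


lemma ortho_char_terminates: "ortho_char l E g \<Longrightarrow> (ortho_step ^^ l) E = {}"
  by (induction rule: ortho_char.induct) (simp_all add: funpow_swap1)

lemma sum_ind_exp: "V \<subseteq> {1..M} \<Longrightarrow> (\<Sum>k\<le>j. ind_exp V k) = card (V \<inter> {1..j})"
proof -
  assume "V \<subseteq> {1..M}"
  then have "{..j} \<inter> V = V \<inter> {1..j}" by auto
  then show ?thesis by (simp add: ind_exp_def sum.If_cases)
qed

text \<open>The induction is strong because splitting off a column skips t steps. If i = 1, or row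
  i-1 of the leading column is filled, or nothing of it lies beyond row i+1, then
  \<open>tooth_not_repeated\<close> allows a single \<pi>_i. In all other cases the column is
  isolated and becomes a factor.\<close>

lemma ortho_char_unit_coeffs:
  assumes "ortho_char l E g" "rothe_like n E" "mult_free E"
  shows "unit_coeffs g \<and> fixed_sums (teeth E) g"
  using assms
proof (induction l arbitrary: E g rule: less_induct)
  case (less l)
  show ?case
  proof (cases "E = {}")
    case True
    then have "ortho_char l {} g" using less.prems(1) by simp
    then have g: "g = const_one" by cases auto
    have "fixed_sums T const_one" for T
      unfolding fixed_sums_def by (intro exI[of _ "\<lambda>_. 0"]) (simp add: const_one_def)
    moreover have "unit_coeffs const_one"
      by (simp add: unit_coeffs_def const_one_def)
    ultimately show ?thesis by (simp add: g)
  next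
    case ne: False
    define i where "i = tooth E"
    define c where "c = lead_col E"
    define C where "C = col E c"
    have memC: "r \<in> C \<longleftrightarrow> (r, c) \<in> E" for r by (simp add: C_def)
    have orth: "orthodontic E" using less.prems(2) by (rule rothe_like_orthodontic)
    note i = tooth_props[OF orth ne, folded i_def c_def]
    have pos: "1 \<le> r" if "r \<in> C" for r using that orth unfolding orthodontic_def memC by blast
    have finC: "finite C" using orth finite_col by (simp add: orthodontic_def C_def)
    have init: "k \<in> C" if "r \<in> C" "r \<le> i" "1 \<le> k" "k \<le> r" for r k
      using initial_below_tooth[OF orth ne, folded c_def i_def] that memC by blast
    have fin: "(ortho_step ^^ l) E = {}" using less.prems(1) by (rule ortho_char_terminates)
    show ?thesis
    proof (cases "2 \<le> i \<and> i - 1 \<notin> C \<and> (\<exists>x\<in>C. Suc i < x)")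
      case False
      have "{1..i - 1} \<subseteq> C \<or> C \<subseteq> {1..Suc i}"
      proof -
        consider "i = 1" | "i - 1 \<in> C" | "\<forall>x\<in>C. x \<le> Suc i"
          using False i(1) by force
        then show ?thesis
        proof cases
          case 2
          then show ?thesis using init[of "i - 1"] by auto
        next
          case 3
          then show ?thesis using pos by auto
        qed simp
      qed
      then have nt: "i \<notin> teeth (ortho_step E)"
        using tooth_not_repeated[OF orth ne less.prems(3)] unfolding i_def C_def c_def by blast
      obtain l1 g1 where l1: "l = Suc l1" "ortho_char l1 (ortho_step E) g1"
        and g: "g = isobaric i (shift (row_count (swap_rows i E - ortho_step E)) g1)"
        using less.prems(1) ne by cases (auto simp: i_def)
      have "mult_free (ortho_step E)" using mult_free_funpow[OF less.prems(3), of 1] by simp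
      then have "unit_coeffs g1" "fixed_sums (teeth (ortho_step E)) g1"
        using less.IH[of l1 "ortho_step E" g1] l1 rothe_like_step[OF less.prems(2)] by simp_all
      then show ?thesis
        using isobaric_unit_coeffs[OF unit_coeffs_shift fixed_sums_shift nt]
          isobaric_fixed_sums[OF fixed_sums_shift, of "teeth (ortho_step E)" g1 i]
        by (simp add: g teeth_step[OF ne] i_def)
    next
      case True
      then obtain x where x: "x \<in> C" "Suc i < x" by blast
      \<comment> \<open>Above its first missing tooth the column is an initial interval [p]. Since
        i-1 is not in C, row p+1 is a gap strictly above row i.\<close>
      have "\<exists>p. C \<inter> {1..i} = {1..p}"
        by (rule down_closed_eq_initial) (use init in auto)
      then obtain p where p: "C \<inter> {1..i} = {1..p}" by blast
      have iC: "i \<notin> C" using i(2) memC by simp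
      have pi: "Suc p < i"
      proof (rule ccontr)
        assume "\<not> Suc p < i"
        then have "i - 1 \<in> {1..p}" using True by auto
        then show False using p True by blast
      qed
      have pC: "{1..p} \<subseteq> C" using p by blast
      define M where "M = Max C"
      have M: "M \<in> C" "\<And>r. r \<in> C \<Longrightarrow> r \<le> M"
        using Max_in[OF finC] Max_ge[OF finC] x(1) by (auto simp: M_def)
      have iM: "Suc i < M" using M(2)[OF x(1)] x(2) by simp
      have CM: "C \<subseteq> {1..M}" using pos M(2) by auto
      have big: "i < r" if "r \<in> C" "p < r" for r
      proof (rule ccontr)
        assume "\<not> i < r"
        then have "r \<in> C \<inter> {1..i}" using that pos by auto
        then have "r \<in> {1..p}" unfolding p .
        then show False using that by simp
      qed
      \<comment> \<open>Rows of C are free of other columns by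
        \<open>lead_col_rows_isolated\<close>; gaps of C are empty rows by the Rothe shape.\<close>
      have others: "(r, c') \<notin> E" if "c' \<noteq> c" "p < r" "r \<le> M" for r c'
      proof (cases "r \<in> C")
        case rC: True
        show ?thesis
        proof
          assume "(r, c') \<in> E"
          then have "c' = c"
            using lead_col_rows_isolated[OF fin less.prems(2) ne less.prems(3) c_def, folded i_def, of x r c']
              True x rC big[OF rC that(2)] memC by simp
          then show False using that(1) by simp
        qed
      next
        case False
        then have "r < M" using M(1) that(3) le_neq_implies_less by blast
        then show ?thesis
          using rothe_like_row_empty[OF less.prems(2), folded c_def, of M r] M(1) False memC by simp
      qed
      obtain t g' where t: "0 < t" "t \<le> l" "(ortho_step ^^ t) E = {(r, c') \<in> E. c' \<noteq> c}"
        "ortho_char (l - t) {(r, c') \<in> E. c' \<noteq> c} g'" and g: "g = col_mult M C g'"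
        using ortho_char_lead_col[OF less.prems(1) orth ne c_def, of p M] pC CM others
        unfolding C_def by blast
      define E' where "E' = {(r, c') \<in> E. c' \<noteq> c}"
      have E't: "E' = (ortho_step ^^ t) E" using t(3) by (simp add: E'_def)
      have rl': "rothe_like n E'" using rothe_like_funpow[OF less.prems(2)] by (simp add: E't)
      have mf': "mult_free E'" using mult_free_funpow[OF less.prems(3)] by (simp add: E't)
      have ch': "ortho_char (l - t) E' g'" using t(4) by (simp add: E'_def)
      have "l - t < l" using t(1,2) by simp
      then have IH: "unit_coeffs g'" "fixed_sums (teeth E') g'"
        using less.IH[OF _ ch' rl' mf'] by simp_all
      have T': "teeth E' \<subseteq> teeth E" unfolding E't by (rule teeth_funpow_subset)
      \<comment> \<open>Because of the gap at p+1 at most j-1 boxes of C lie up to row j, so the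
        next one still has to cross the tooth j.\<close>
      have hit: "\<exists>s. (ortho_step ^^ s) E \<noteq> {} \<and> tooth ((ortho_step ^^ s) E) = j
          \<and> (Suc j, c) \<in> (ortho_step ^^ s) E" if j: "p < j" "j < M" for j
      proof -
        obtain r where r: "r \<in> C" "j < r" "card (C \<inter> {1..r}) = Suc (card (C \<inter> {1..j}))"
          using next_element[OF M(1) j(2)] by metis
        have "Suc p \<notin> C"
        proof
          assume "Suc p \<in> C"
          then have "Suc p \<in> C \<inter> {1..i}" using pi by simp
          then have "Suc p \<in> {1..p}" unfolding p .
          then show False by simp
        qed
        then have "C \<inter> {1..j} \<subseteq> {1..j} - {Suc p}" by blast
        then have "card (C \<inter> {1..j}) \<le> card ({1..j} - {Suc p})"
          by (intro card_mono) auto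
        also have "\<dots> = j - 1" using j by simp
        finally have "card (C \<inter> {1..r}) \<le> j" using r(3) j by simp
        then show ?thesis
          using lead_box_hits_tooth[OF fin less.prems(2) ne, folded c_def C_def, of r c j] r memC
          unfolding C_def by blast
      qed
      have inT: "j \<in> teeth E" if "p < j" "j < M" for j
        using hit[OF that] unfolding teeth_def by blast
      \<comment> \<open>After t steps column c is empty, whereas a recurrence of j would require its
        impact to be the same singleton \<open>{c}\<close>.\<close>
      have notT': "j \<notin> teeth E'" if j: "p < j" "j < M" for j
      proof
        assume "j \<in> teeth E'"
        then obtain s' where s': "j = tooth ((ortho_step ^^ (t + s')) E)" "(ortho_step ^^ (t + s')) E \<noteq> {}"
          unfolding teeth_def E't funpow_ortho_step_add by blast
        have "col ((ortho_step ^^ (t + k)) E) c = {}" for k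
        proof (induction k)
          case 0
          have "col E' c = {}" by (auto simp: E'_def)
          then show ?case by (simp add: E't)
        next
          case (Suc k)
          then show ?case using col_ortho_step_empty by simp
        qed
        then have nc: "(r, c) \<notin> (ortho_step ^^ (t + s')) E" for r by (metis empty_iff mem_col)
        obtain s where s: "(ortho_step ^^ s) E \<noteq> {}" "tooth ((ortho_step ^^ s) E) = j" "(Suc j, c) \<in> (ortho_step ^^ s) E"
          using hit[OF j] by blast
        then have "s \<noteq> t + s'" using nc by blast
        then obtain c0 where "impact_set ((ortho_step ^^ s) E) = {c0}" "impact_set ((ortho_step ^^ (t + s')) E) = {c0}"
          using less.prems(3)[unfolded mult_free_def, rule_format, of s "t + s'"] s s' by blast
        moreover have "c \<in> impact_set ((ortho_step ^^ s) E)" using s by (simp add: impact_set_def)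
        ultimately have "c \<in> impact_set ((ortho_step ^^ (t + s')) E)" by simp
        then show False using nc by (simp add: impact_set_def)
      qed
      obtain \<beta> where \<beta>: "\<And>b j. g' b \<noteq> 0 \<Longrightarrow> j \<notin> teeth E' \<Longrightarrow> (\<Sum>k\<le>j. b k) = \<beta> j"
        using IH(2) unfolding fixed_sums_def by blast
      \<comment> \<open>By symmetry both b and its swap occur in \<open>g'\<close>. The prescribed
        sum up to k is the same for both, which forces equal exponents at k and k+1.\<close>
      have flat: "b (Suc k) = b k" if nz: "g' b \<noteq> 0" and k: "p < k" "k < M" for b k
      proof -
        have "swap_vars k g' = g'"
        proof (rule ortho_char_symmetric[OF ch' rothe_like_orthodontic[OF rl']])
          show "1 \<le> k" using k by simp
          show "(k, c') \<notin> E'" "(Suc k, c') \<notin> E'" for c'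
            using others[of c' k] others[of c' "Suc k"] k by (auto simp: E'_def)
        qed
        let ?b = "b \<circ> Transposition.transpose k (Suc k)"
        have "g' ?b = swap_vars k g' b" by (simp add: swap_vars_def)
        then have nzb: "g' ?b \<noteq> 0" using nz \<open>swap_vars k g' = g'\<close> by simp
        have "(\<Sum>m\<le>k. ?b m) = (\<Sum>m\<le>k. b m)"
          using \<beta>[OF nzb notT'[OF k]] \<beta>[OF nz notT'[OF k]] by (simp only:)
        moreover have "(\<Sum>m\<le>k. ?b m) = (\<Sum>m<k. b m) + b (Suc k)"
        proof -
          have "(\<Sum>m<k. ?b m) = (\<Sum>m<k. b m)"
            by (rule sum.cong) auto
          then show ?thesis by (simp add: lessThan_Suc_atMost[symmetric])
        qed
        moreover have "(\<Sum>m\<le>k. b m) = (\<Sum>m<k. b m) + b k"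
          by (simp add: lessThan_Suc_atMost[symmetric])
        ultimately show ?thesis by simp
      qed
      \<comment> \<open>The common exponent is the difference of two prescribed sums; p+1 and p+2
        are admissible indices because p+1 < i and i+1 < M.\<close>
      have const: "b k = \<beta> (Suc (Suc p)) - \<beta> (Suc p)" if nz: "g' b \<noteq> 0" and k: "p < k" "k \<le> M" for b k
      proof -
        have all: "b m = b (Suc p)" if "Suc p \<le> m" "m \<le> M" for m
          using that
        proof (induction m rule: dec_induct)
          case (step m)
          then show ?case using flat[OF nz, of m] by simp
        qed simp
        have "(\<Sum>m\<le>Suc (Suc p). b m) = \<beta> (Suc (Suc p))" "(\<Sum>m\<le>Suc p. b m) = \<beta> (Suc p)"
          using \<beta>[OF nz notT'[of "Suc (Suc p)"]] \<beta>[OF nz notT'[of "Suc p"]] pi iM by simp_all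
        then have "b (Suc (Suc p)) = \<beta> (Suc (Suc p)) - \<beta> (Suc p)" by simp
        then show ?thesis using all[of k] all[of "Suc (Suc p)"] k pi iM by simp
      qed
      have below: "{1..p} \<subseteq> V" "V \<subseteq> {1..M}" "card V = card C" if V: "V \<in> col_below M C" for V
      proof -
        have "card (C \<inter> {1..p}) \<le> card (V \<inter> {1..p})" using V unfolding col_below_def by blast
        moreover have "C \<inter> {1..p} = {1..p}" using pC by blast
        ultimately have "V \<inter> {1..p} = {1..p}" by (intro card_seteq) auto
        then show "{1..p} \<subseteq> V" by blast
        show "V \<subseteq> {1..M}" "card V = card C" using V unfolding col_below_def by blast+
      qed
      have gb: "g b = (\<Sum>V\<in>col_below M C. shift (ind_exp V) g' b)" for b
      proof -
        have "(\<Sum>V\<in>A. f V) b = (\<Sum>V\<in>A. f V b)" if "finite A" for A and f :: "nat set \<Rightarrow> ipoly"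
          using that by (induction A rule: finite_induct) (simp_all only: sum.empty sum.insert zero_fun_apply plus_fun_apply not_False_eq_True)
        then show ?thesis by (simp add: g col_mult_def)
      qed
      have nzD: "ind_exp V \<le> b" "g' (b - ind_exp V) \<noteq> 0" if "shift (ind_exp V) g' b \<noteq> 0" for V b
        using that by (auto simp: shift_def split: if_splits)
      have val: "b k = ind_exp V k + (\<beta> (Suc (Suc p)) - \<beta> (Suc p))"
        if nz: "shift (ind_exp V) g' b \<noteq> 0" and k: "p < k" "k \<le> M" for V b k
      proof -
        have "ind_exp V k \<le> b k" using nzD(1)[OF nz] by (simp add: le_fun_def)
        then show ?thesis using const[OF nzD(2)[OF nz] k] by simp
      qed
      have unit: "g b \<in> {-1, 0, 1}" for b
      proof -
        define f where "f V = (if V \<in> col_below M C then shift (ind_exp V) g' b else 0)" for V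
        \<comment> \<open>The exponent b determines V: every V contains [p] and nothing beyond M,
          and in between V is the excess of b over the constant exponent.\<close>
        have uniq: "V = W" if "f V \<noteq> 0" "f W \<noteq> 0" for V W
        proof (rule set_eqI)
          have VW: "V \<in> col_below M C" "W \<in> col_below M C" "shift (ind_exp V) g' b \<noteq> 0" "shift (ind_exp W) g' b \<noteq> 0"
            using that by (auto simp: f_def split: if_splits)
          fix k
          consider "k \<in> {1..p}" | "p < k" "k \<le> M" | "k \<notin> {1..M}" "k \<notin> {1..p}" by force
          then show "k \<in> V \<longleftrightarrow> k \<in> W"
          proof cases
            case 1
            then show ?thesis using below(1)[OF VW(1)] below(1)[OF VW(2)] by blast
          next
            case 2
            then have "ind_exp V k = ind_exp W k"
              using val[OF VW(3) 2] val[OF VW(4) 2] by simp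
            then show ?thesis by (simp add: ind_exp_def split: if_splits)
          next
            case 3
            then show ?thesis using below(2)[OF VW(1)] below(2)[OF VW(2)] by blast
          qed
        qed
        have "g b = sum f (col_below M C)" unfolding gb by (rule sum.cong) (simp_all add: f_def)
        also have "\<dots> = (if \<exists>x\<in>col_below M C. f x \<noteq> 0 then f (THE x. f x \<noteq> 0) else 0)"
          by (rule sum_at_most_one_nonzero[OF finite_col_below uniq])
        finally have *: "g b = (if \<exists>x\<in>col_below M C. f x \<noteq> 0 then f (THE x. f x \<noteq> 0) else 0)" .
        have "f V \<in> {-1, 0, 1}" for V
          using unit_coeffs_shift[OF IH(1), of "ind_exp V"] by (simp add: f_def unit_coeffs_def)
        then show ?thesis unfolding * by simp
      qed
      \<comment> \<open>Every index strictly between p and M is a tooth. An index j that is no tooth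
        is thus at most p, where V has j elements, or at least M, where all of V is counted.\<close>
      have "(\<Sum>k\<le>j. b k) = \<beta> j + (if j \<le> p then j else card C)" if nz: "g b \<noteq> 0" and j: "j \<notin> teeth E" for b j
      proof -
        obtain V where V: "V \<in> col_below M C" "shift (ind_exp V) g' b \<noteq> 0"
          using nz unfolding gb by (meson sum.not_neutral_contains_not_neutral)
        have "(\<Sum>k\<le>j. b k) = (\<Sum>k\<le>j. (b - ind_exp V) k + ind_exp V k)"
          using nzD(1)[OF V(2)] by (intro sum.cong) (auto simp: le_fun_def)
        also have "\<dots> = (\<Sum>k\<le>j. (b - ind_exp V) k) + (\<Sum>k\<le>j. ind_exp V k)"
          by (rule sum.distrib)
        also have "(\<Sum>k\<le>j. (b - ind_exp V) k) = \<beta> j"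
          using \<beta>[OF nzD(2)[OF V(2)]] j T' by blast
        also have "(\<Sum>k\<le>j. ind_exp V k) = (if j \<le> p then j else card C)"
        proof (cases "j \<le> p")
          case True
          then have "{1..j} \<subseteq> {1..p}" by auto
          then have "V \<inter> {1..j} = {1..j}" using below(1)[OF V(1)] by blast
          then show ?thesis using True by (simp only: sum_ind_exp[OF below(2)[OF V(1)]]) simp
        next
          case False
          then have "M \<le> j" using inT[of j] j by (meson not_le)
          then have "{1..M} \<subseteq> {1..j}" by auto
          then have "V \<inter> {1..j} = V" using below(2)[OF V(1)] by blast
          then show ?thesis using False below(3)[OF V(1)] by (simp only: sum_ind_exp[OF below(2)[OF V(1)]]) simp
        qed
        finally show ?thesis .
      qed
      then have "fixed_sums (teeth E) g"
        unfolding fixed_sums_def by (intro exI[of _ "\<lambda>j. \<beta> j + (if j \<le> p then j else card C)"]) blast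
      then show ?thesis using unit by (simp add: unit_coeffs_def)
    qed
  qed
qed

theorem theorem3p6:
  fixes n :: nat and w :: "nat \<Rightarrow> nat"
  assumes "w permutes {1..n}"
    and "multiplicity_free n w"
  shows "\<forall>b. schubert n w b \<in> {0, 1}"
proof
  fix b
  let ?E = "ortho_E0 n w"
  obtain l where l: "ortho_E n w l = {}" "\<forall>r<l. ortho_E n w r \<noteq> {}"
    and mf: "\<forall>r\<in>{1..l}. \<forall>s\<in>{1..l}. r \<noteq> s \<and> ortho_i n w r = ortho_i n w s \<longrightarrow>
        (\<exists>c\<in>{1..n}. impact n w r = {c} \<and> impact n w s = {c})"
    using assms(2) unfolding multiplicity_free_def by blast
  have rl: "rothe_like n ?E" using assms(1) unfolding rothe_like_def by blast
  obtain g where g: "ortho_char l ?E g"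
    using ortho_char_exists[of l ?E] l by (auto simp: ortho_E_def)
  have lt: "r < l" if "(ortho_step ^^ r) ?E \<noteq> {}" for r
  proof (rule ccontr)
    assume "\<not> r < l"
    then have "(ortho_step ^^ r) ?E = (ortho_step ^^ (r - l)) ((ortho_step ^^ l) ?E)"
      unfolding funpow_ortho_step_add by simp
    also have "(ortho_step ^^ l) ?E = {}" using l(1) by (simp add: ortho_E_def)
    also have "(ortho_step ^^ k) {} = {}" for k by (induction k) simp_all
    finally show False using that by simp
  qed
  \<comment> \<open>Every stage is the E_0 of some permutation of 1..n, so the restriction of
    \<open>impact\<close> to these columns discards nothing.\<close>
  have imp: "impact_set ((ortho_step ^^ r) ?E) = impact n w (Suc r)" for r
  proof -
    have "c \<in> {1..n}" if "(k, c) \<in> (ortho_step ^^ r) ?E" for k c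
    proof -
      obtain v where "(ortho_step ^^ r) ?E = ortho_E0 n v"
        using rothe_like_funpow[OF rl] unfolding rothe_like_def by blast
      then have "(k, c) \<in> rothe n v" using that ortho_E0_subset by blast
      then show ?thesis by (simp add: mem_rothe)
    qed
    then show ?thesis
      by (auto simp: impact_set_def impact_def ortho_i_def ortho_E_def)
  qed
  have "mult_free ?E"
    unfolding mult_free_def imp
  proof (intro allI impI)
    fix r s
    assume *: "r \<noteq> s" "(ortho_step ^^ r) ?E \<noteq> {}" "(ortho_step ^^ s) ?E \<noteq> {}"
      "tooth ((ortho_step ^^ r) ?E) = tooth ((ortho_step ^^ s) ?E)"
    have "Suc r \<in> {1..l}" "Suc s \<in> {1..l}" using lt *(2,3) by (simp_all add: Suc_le_eq)
    moreover have "ortho_i n w (Suc r) = ortho_i n w (Suc s)"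
      using *(4) by (simp add: ortho_i_def ortho_E_def)
    ultimately show "\<exists>c. impact n w (Suc r) = {c} \<and> impact n w (Suc s) = {c}"
      using mf *(1) by (metis nat.inject)
  qed
  then have "unit_coeffs g" using ortho_char_unit_coeffs[OF g rl] by blast
  then have "schubert n w b \<in> {-1, 0, 1}"
    using unit_coeffs_shift[of g] fk_schubert_orthodontia[OF assms(1) g]
    by (simp add: schubert_eq_fk_schubert[OF assms(1)] unit_coeffs_def)
  moreover have "0 \<le> schubert n w b"
    using fk_schubert_nonneg by (simp add: schubert_eq_fk_schubert[OF assms(1)])
  ultimately show "schubert n w b \<in> {0, 1}" by auto
qed

end
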